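(* Let $m\ge 0$ and let $\Gamma\in\mathbb{C}^{4\times 4}$ satisfy $$\Gamma(\alpha\cdot\omega)+(\alpha\cdot\omega)\Gamma=0\qquad\text{for every }\omega\in\mathbb{S}^2 .$$ Then there is a constant $C_\Gamma>0$, depending only on $\Gamma$ (and on the fixed frequency cutoff), such that for all $T>0$, all dyadic $N_1,N_2$, and all dyadic components $\Phi_{N_1}=S_m(t)P_{N_1}\Phi_0$ and $\Psi_{N_2}=S_m(t)P_{N_2}\Psi_0$ of free Dirac solutions of mass $m$ with data $\Phi_0,\Psi_0\in L^2(\mathbb{R}^3;\mathbb{C}^4)$, $$\big\|B_\Gamma(\Phi_{N_1},\Psi_{N_2})\big\|_{L^2([0,T]\times\mathbb{R}^3)}\le C_\Gamma\,\mathcal{C}_{m,T}(N_1,N_2)\,\|\Phi_{N_1}(0)\|_{L^2_x}\|\Psi_{N_2}(0)\|_{L^2_x},$$ where $$\mathcal{C}_{m,T}(N_1,N_2):=\min\big\{N_*\sqrt{2+mT},\;N_*^{3/2}T^{1/2}\big\},\qquad N_*:=\min\{N_1,N_2\}.$$ The constant $C_\Gamma$ is independent of $m,T,N_1,N_2,\Phi_0,\Psi_0$. Moreover, suppose that $\Gamma_1,\Gamma_2\in\mathbb{C}^{4\times4}$ both satisfy the same anticommutation condition ($\Gamma_i(\alpha\cdot\omega)=-(\alpha\cdot\omega)\Gamma_i$ for every $\omega\in\mathbb{S}^2$, $i=1,2$). Then there is a constant $C_{\Gamma_1,\Gamma_2}>0$, depending only on $\Gamma_1,\Gamma_2$ (and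 on the fixed frequency cutoff), such that for all $T>0$, all dyadic $N_0,N_1,N_2,N_3$, and all dyadic components $\Phi^j_{N_j}=S_m(t)P_{N_j}\Phi^j_0$, $j=0,1,2,3$, of free Dirac solutions of mass $m$ with data $\Phi^j_0\in L^2(\mathbb{R}^3;\mathbb{C}^4)$, $$\left|\int_0^T\!\!\int_{\mathbb{R}^3}\Big\langle B_{\Gamma_1}\big(\Phi^1_{N_1},\Phi^2_{N_2}\big)\,\Gamma_2\Phi^3_{N_3},\,\Phi^0_{N_0}\Big\rangle_{\mathbb{C}^4}dx\,dt\right|\le C_{\Gamma_1,\Gamma_2}\,\mathcal{C}_{m,T}(N_1,N_2)\,\mathcal{C}_{m,T}(N_3,N_0)\prod_{j=0}^3\|\Phi^j_{N_j}(0)\|_{L^2_x}.$$ The constant $C_{\Gamma_1,\Gamma_2}$ is independent of $m$, $T$, the $N_j$ and the data.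
   Context: Gamma matrices (Dirac representation): $\gamma^0=\begin{pmatrix}I_2&0\\0&-I_2\end{pmatrix}$, $\gamma^j=\begin{pmatrix}0&\sigma^j\\-\sigma^j&0\end{pmatrix}$, $j=1,2,3$, with Pauli matrices $\sigma^1=\begin{pmatrix}0&1\\1&0\end{pmatrix}$, $\sigma^2=\begin{pmatrix}0&-i\\i&0\end{pmatrix}$, $\sigma^3=\begin{pmatrix}1&0\\0&-1\end{pmatrix}$. Set $\beta=\gamma^0$, $\alpha^j=\gamma^0\gamma^j$, and $\alpha\cdot\omega=\sum_{j=1}^3\omega_j\alpha^j$. Free Dirac equation of mass $m\ge 0$ for $\Phi:\mathbb{R}^{1+3}\to\mathbb{C}^4$: $i\partial_t\Phi=(\alpha\cdot D)\Phi+m\beta\Phi=:H_m(D)\Phi$, with $D=-i\nabla$. Its propagator is $S_m(t)=e^{-itH_m(D)}$, i.e. the Fourier multiplier with matrix symbol $e^{-it(\alpha\cdot\xi+m\beta)}$. $P_N$, for a dyadic number $N\in 2^{\mathbb{Z}}$, is the standard Littlewood-Paley frequency projection to $\{|\xi|\sim N\}$: the Fourier multiplier with symbol $\chi(\xi/N)$, where $\chi:\mathbb{R}^3\to[0,1]$ is a fixed smooth cutoff supported in a fixed annulus $\{c_0\le|\xi|\le C_0\}$ with $0<c_0<C_0$. $\langle z,w\rangle_{\mathbb{C}^4}=z^*w$ is the Hermitian inner product (conjugate-linear in the first slot), and $B_\Gamma(z,w):=\langle\Gamma z,w\rangle_{\mathbb{C}^4}$, applied pointwise in $(t,x)$. 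*)

theory Defs
  imports "HOL-Analysis.Analysis"
begin

section \<open>Matrices and the Dirac symbol\<close>

definition block_matrix ::
  "complex^2^2 \<Rightarrow> complex^2^2 \<Rightarrow> complex^2^2 \<Rightarrow> complex^2^2 \<Rightarrow> complex^4^4" where
  "block_matrix A B C D = vector
     [vector [A$1$1, A$1$2, B$1$1, B$1$2],
      vector [A$2$1, A$2$2, B$2$1, B$2$2],
      vector [C$1$1, C$1$2, D$1$1, D$1$2],
      vector [C$2$1, C$2$2, D$2$1, D$2$2]]"

definition pauli :: "3 \<Rightarrow> complex^2^2" where
  "pauli j =
     (if j = 1 then vector [vector [0, 1], vector [1, 0]]
      else if j = 2 then vector [vector [0, -\<i>], vector [\<i>, 0]]
      else vector [vector [1, 0], vector [0, -1]])"

definition gamma0 :: "complex^4^4" where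
  "gamma0 = block_matrix (mat 1) 0 0 (- mat 1)"

definition gamma_space :: "3 \<Rightarrow> complex^4^4" where
  "gamma_space j = block_matrix 0 (pauli j) (- pauli j) 0"

definition dirac_beta :: "complex^4^4" where
  "dirac_beta = gamma0"

definition dirac_alpha :: "3 \<Rightarrow> complex^4^4" where
  "dirac_alpha j = gamma0 ** gamma_space j"

definition alpha_dot :: "real^3 \<Rightarrow> complex^4^4" where
  "alpha_dot \<omega> = (\<Sum>j\<in>UNIV. (\<omega> $ j) *\<^sub>R dirac_alpha j)"

definition anticommutes_alpha :: "complex^4^4 \<Rightarrow> bool" where
  "anticommutes_alpha \<Gamma> \<longleftrightarrow>
     (\<forall>\<omega>\<in>sphere 0 1. \<Gamma> ** alpha_dot \<omega> + alpha_dot \<omega> ** \<Gamma> = 0)"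

definition dirac_symbol :: "real \<Rightarrow> real^3 \<Rightarrow> complex^4^4" where
  "dirac_symbol m \<xi> = alpha_dot \<xi> + m *\<^sub>R dirac_beta"

text \<open>The library's \<open>*\<close> and \<open>^\<close> on vectors are componentwise, so the matrix exponential is
  built from powers with respect to \<open>**\<close>.\<close>

definition matrix_exp :: "complex^4^4 \<Rightarrow> complex^4^4" where
  "matrix_exp A = (\<Sum>n. (1 / fact n) *\<^sub>R (((**) A ^^ n) (mat 1)))"

definition cscale_matrix :: "complex \<Rightarrow> complex^4^4 \<Rightarrow> complex^4^4" where
  "cscale_matrix c A = map_matrix ((*) c) A"

definition propagator_symbol :: "real \<Rightarrow> real \<Rightarrow> real^3 \<Rightarrow> complex^4^4" where
  "propagator_symbol m t \<xi> = matrix_exp (cscale_matrix (- \<i> * of_real t) (dirac_symbol m \<xi>))"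

text \<open>Conjugate-linear in the first slot.\<close>

definition herm :: "complex^4 \<Rightarrow> complex^4 \<Rightarrow> complex" where
  "herm z w = (\<Sum>k\<in>UNIV. cnj (z $ k) * w $ k)"

definition bilin :: "complex^4^4 \<Rightarrow> complex^4 \<Rightarrow> complex^4 \<Rightarrow> complex" where
  "bilin \<Gamma> z w = herm (\<Gamma> *v z) w"

section \<open>Square-integrable functions, Fourier transform, Fourier multipliers\<close>

text \<open>Elements of $L^2$ are handled through Borel representatives; every notion below is invariant
  under changing a representative on a null set.\<close>

definition square_integrable ::
  "'a measure \<Rightarrow> ('a \<Rightarrow> 'b::{real_normed_vector, second_countable_topology}) \<Rightarrow> bool" where
  "square_integrable M f \<longleftrightarrow> f \<in> borel_measurable M \<and> integrable M (\<lambda>x. (norm (f x))\<^sup>2)"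

text \<open>Meaningful only together with \<open>square_integrable\<close>: the Bochner integral is \<open>0\<close> otherwise.\<close>

definition L2_norm :: "'a measure \<Rightarrow> ('a \<Rightarrow> 'b::real_normed_vector) \<Rightarrow> real" where
  "L2_norm M f = sqrt (\<integral>x. (norm (f x))\<^sup>2 \<partial>M)"

definition converges_L2 ::
  "'a measure \<Rightarrow> (nat \<Rightarrow> 'a \<Rightarrow> 'b::{real_normed_vector, second_countable_topology})
     \<Rightarrow> ('a \<Rightarrow> 'b) \<Rightarrow> bool" where
  "converges_L2 M F f \<longleftrightarrow>
     (\<forall>n. square_integrable M (\<lambda>x. F n x - f x)) \<and>
     (\<lambda>n. L2_norm M (\<lambda>x. F n x - f x)) \<longlonglongrightarrow> 0"

definition fourier_integral :: "(real^3 \<Rightarrow> complex^4) \<Rightarrow> real^3 \<Rightarrow> complex^4" where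
  "fourier_integral f \<xi> = (\<integral>x. cis (- (x \<bullet> \<xi>)) *s f x \<partial>lborel)"

text \<open>The Fourier transform on $L^2$ is the extension by density of the integral on
  $L^1 \cap L^2$. It determines \<open>fh\<close> up to null sets, hence is given as a relation: \<open>fh\<close> represents
  the transform of \<open>f\<close>. With this convention $D = -i\nabla$ has symbol $\xi$; the normalisation
  constant plays no role for multipliers.\<close>

definition has_fourier_L2 :: "(real^3 \<Rightarrow> complex^4) \<Rightarrow> (real^3 \<Rightarrow> complex^4) \<Rightarrow> bool" where
  "has_fourier_L2 f fh \<longleftrightarrow>
     square_integrable lborel f \<and> square_integrable lborel fh \<and>
     (\<exists>F. (\<forall>n. integrable lborel (F n) \<and> square_integrable lborel (F n)) \<and>
          converges_L2 lborel F f \<and>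
          converges_L2 lborel (\<lambda>n. fourier_integral (F n)) fh)"

text \<open>\<open>u\<close> represents $\sigma(D) f$ in $L^2$.\<close>

definition fourier_multiplier ::
  "(real^3 \<Rightarrow> complex^4^4) \<Rightarrow> (real^3 \<Rightarrow> complex^4) \<Rightarrow> (real^3 \<Rightarrow> complex^4) \<Rightarrow> bool" where
  "fourier_multiplier \<sigma> f u \<longleftrightarrow>
     (\<exists>fh. has_fourier_L2 f fh \<and> has_fourier_L2 u (\<lambda>\<xi>. \<sigma> \<xi> *v fh \<xi>))"

section \<open>Littlewood--Paley projections and dyadic Dirac components\<close>

primrec C_order :: "nat \<Rightarrow> (real^3 \<Rightarrow> real) \<Rightarrow> bool" where
  "C_order 0 f \<longleftrightarrow> continuous_on UNIV f"
| "C_order (Suc k) f \<longleftrightarrow>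
     f differentiable_on UNIV \<and> (\<forall>v. C_order k (\<lambda>x. frechet_derivative f (at x) v))"

definition smooth :: "(real^3 \<Rightarrow> real) \<Rightarrow> bool" where
  "smooth f \<longleftrightarrow> (\<forall>k. C_order k f)"

definition frequency_cutoff :: "(real^3 \<Rightarrow> real) \<Rightarrow> bool" where
  "frequency_cutoff cutoff \<longleftrightarrow>
     smooth cutoff \<and> range cutoff \<subseteq> {0..1} \<and>
     (\<exists>c0 C0. 0 < c0 \<and> c0 < C0 \<and> closure {\<xi>. cutoff \<xi> \<noteq> 0} \<subseteq> {\<xi>. c0 \<le> norm \<xi> \<and> norm \<xi> \<le> C0})"

definition dyadic :: "real set" where
  "dyadic = range (\<lambda>k::int. 2 powi k)"

definition LP_projection ::
  "(real^3 \<Rightarrow> real) \<Rightarrow> real \<Rightarrow> (real^3 \<Rightarrow> complex^4) \<Rightarrow> (real^3 \<Rightarrow> complex^4) \<Rightarrow> bool" where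
  "LP_projection cutoff N = fourier_multiplier (\<lambda>\<xi>. mat (of_real (cutoff (\<xi> /\<^sub>R N))))"

definition dirac_propagator ::
  "real \<Rightarrow> real \<Rightarrow> (real^3 \<Rightarrow> complex^4) \<Rightarrow> (real^3 \<Rightarrow> complex^4) \<Rightarrow> bool" where
  "dirac_propagator m t = fourier_multiplier (propagator_symbol m t)"

text \<open>\<open>\<Phi> t\<close> represents $S_m(t) P_N f$ for every time \<open>t\<close>. Since representatives are chosen for
  each \<open>t\<close> separately, joint measurability is required; any two such \<open>\<Phi>\<close> agree almost
  everywhere on space-time.\<close>

definition dirac_component ::
  "(real^3 \<Rightarrow> real) \<Rightarrow> real \<Rightarrow> real \<Rightarrow> (real^3 \<Rightarrow> complex^4) \<Rightarrow> (real \<Rightarrow> real^3 \<Rightarrow> complex^4) \<Rightarrow> bool"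
where
  "dirac_component cutoff m N f \<Phi> \<longleftrightarrow>
     (\<lambda>(t, x). \<Phi> t x) \<in> borel_measurable borel \<and>
     (\<exists>g. LP_projection cutoff N f g \<and> (\<forall>t. dirac_propagator m t g (\<Phi> t)))"

definition spacetime_slab :: "real \<Rightarrow> (real \<times> (real^3)) measure" where
  "spacetime_slab T = restrict_space lborel ({0..T} \<times> UNIV)"

definition bilinear_const :: "real \<Rightarrow> real \<Rightarrow> real \<Rightarrow> real \<Rightarrow> real" where
  "bilinear_const m T N1 N2 =
     min (min N1 N2 * sqrt (2 + m * T)) (min N1 N2 powr (3/2) * T powr (1/2))"

end

theory Submission
  imports Defs "HOL-Probability.Characteristic_Functions"
begin

text \<open>
  By $L^2$ Fourier inversion every dyadic component is almost everywhere a multiple of an explicit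
  oscillatory integral over the frequency annulus, which is what
  the estimates are proved for. The key point is the energy flux: for a free solution $\Psi$ of any mass,
  the current $(|\Psi|^2, \langle\Psi,\alpha\Psi\rangle)$ is conserved, so the part
  $\Pi_-(\eta)\Psi$ is square integrable against every integrable weight in
  $x\cdot\eta - t|\eta|$, with norm controlled by the initial data. Averaging over dilations
  $\xi = l\eta$, $1\le l\le 2$, writes a massless wave as a superposition of functions
  $\Pi_\pm(\eta)\,G_\eta(x\cdot\eta \mp t|\eta|)$; as $\Gamma\Pi_+ = \Pi_-\Gamma$, each of them
  pairs exactly with the controlled part of $\Psi$. Cauchy--Schwarz in $\eta$ gives the massless bound
  with constant $N_*$ and no dependence on time. On a time interval of length at most $1/m$ the
  massive flow differs from the massless one by a profile with time derivative of size $m$, hence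
  obeys the same bound; $[0,T]$ is covered by at most $2 + mT$ such intervals. The other bound is
  Bernstein's inequality, and the quadrilinear estimate is Cauchy--Schwarz in space-time.
\<close>

section \<open>Gaussians\<close>

text \<open>The flux bound asks for a weight that is integrable in the null variable
  \<open>x \<bullet> \<eta> - t * norm \<eta>\<close>. A single plane wave has constant modulus and
  supplies none; grouping all frequencies on the ray through \<eta> gives a function of the null
  variable whose square is integrable, by the one-dimensional Bessel inequality. Dilations produce
  the rays from Lebesgue measure alone, without polar coordinates or a surface measure on the
  sphere. The power of the frequency comes from two sources: \<eta> ranges over a volume of order
  N^3, and the flux carries the factor 1/|\<eta>|, of order 1/N. Together they give N^2 for the
  squared norm. Only the wave that is split into rays pays for its frequency; the other one enters
  through its L2 norm at the initial time. So the wave of lower frequency is split, and the adjoint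
  of \<Gamma> exchanges the slots when it stands second. The mass leaves the flux of the unsplit
  wave untouched, but it destroys the dependence of the split wave on null variables; hence the
  comparison with the massless flow on short intervals.\<close>

definition gauss :: "'a::euclidean_space \<Rightarrow> real" where
  "gauss x = exp (- (norm x)\<^sup>2 / 2)"

text \<open>The sign \<open>s\<close> lets one set of lemmas serve the transform
  (\<open>- 1\<close>) and its inverse (\<open>1\<close>). Factors of 2 \<pi> are left out and
  reappear as explicit constants.\<close>

definition ft :: "real \<Rightarrow> ('a::euclidean_space \<Rightarrow> complex) \<Rightarrow> 'a \<Rightarrow> complex" where
  "ft s f \<xi> = (\<integral>x. cis (s * (x \<bullet> \<xi>)) * f x \<partial>lborel)"

lemma measurable_cis [measurable]: "cis \<in> borel_measurable borel"
  by (intro borel_measurable_continuous_onI continuous_intros)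

lemma gauss_continuous: "continuous_on UNIV gauss"
  unfolding gauss_def by (intro continuous_intros) auto

lemma gauss_measurable [measurable]: "gauss \<in> borel_measurable borel"
  by (rule borel_measurable_continuous_onI[OF gauss_continuous])

lemma gauss_nonneg: "0 \<le> gauss x" and gauss_le_1: "gauss x \<le> 1" and gauss_pos: "0 < gauss x"
  by (auto simp: gauss_def)

lemma gauss_uminus [simp]: "gauss (- x) = gauss x" by (simp add: gauss_def)

lemma gauss_prod: "gauss (x::'a::euclidean_space) = (\<Prod>b\<in>Basis. exp (- (x \<bullet> b)\<^sup>2 / 2))"
proof -
  have "(norm x)\<^sup>2 = (\<Sum>b\<in>Basis. (x \<bullet> b)\<^sup>2)"
    unfolding power2_norm_eq_inner euclidean_inner[of x x] by (simp add: power2_eq_square)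
  then show ?thesis
    by (simp add: gauss_def exp_sum[symmetric] sum_negf sum_divide_distrib)
qed

text \<open>Up to the density constant \<open>sqrt (2 * pi)\<close> the integral is the
  characteristic function of the standard normal distribution.\<close>

lemma
  shows gauss_1d_integrable: "integrable lborel (\<lambda>x::real. cis (a * x) * complex_of_real (exp (- x\<^sup>2 / 2)))"
    and gauss_1d_integral: "(\<integral>x. cis (a * x) * complex_of_real (exp (- x\<^sup>2 / 2)) \<partial>lborel)
        = complex_of_real (sqrt (2 * pi) * exp (- a\<^sup>2 / 2))"
proof -
  have d: "std_normal_density x = exp (- x\<^sup>2 / 2) / sqrt (2 * pi)" for x
    by (simp add: std_normal_density_def)
  have "integrable lborel (\<lambda>x. sqrt (2 * pi) * std_normal_density x)"
    by (intro integrable_mult_right integrable_normal_density) auto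
  then have I: "integrable lborel (\<lambda>x::real. exp (- x\<^sup>2 / 2))" by (simp add: d)
  show "integrable lborel (\<lambda>x::real. cis (a * x) * complex_of_real (exp (- x\<^sup>2 / 2)))"
    by (rule Bochner_Integration.integrable_bound[OF I]) (auto simp: norm_mult)
  have "char std_normal_distribution a = complex_of_real (exp (- a\<^sup>2 / 2))"
    by (simp add: char_std_normal_distribution)
  moreover have "char std_normal_distribution a = (\<integral>x. std_normal_density x *\<^sub>R iexp (a * x) \<partial>lborel)"
    unfolding char_def by (subst integral_density) (auto simp: normal_density_nonneg)
  moreover have "\<dots> = (\<integral>x. (1 / sqrt (2 * pi)) *\<^sub>R (cis (a * x) * complex_of_real (exp (- x\<^sup>2 / 2))) \<partial>lborel)"
    by (intro Bochner_Integration.integral_cong) (auto simp: d cis_conv_exp scaleR_conv_of_real)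
  moreover have "\<dots> = (1 / sqrt (2 * pi)) *\<^sub>R (\<integral>x. (cis (a * x) * complex_of_real (exp (- x\<^sup>2 / 2))) \<partial>lborel)"
    by (rule integral_scaleR_right)
  ultimately have "(1 / sqrt (2 * pi)) *\<^sub>R (\<integral>x. (cis (a * x) * complex_of_real (exp (- x\<^sup>2 / 2))) \<partial>lborel) = complex_of_real (exp (- a\<^sup>2 / 2))"
    by simp
  then have "sqrt (2 * pi) *\<^sub>R ((1 / sqrt (2 * pi)) *\<^sub>R (\<integral>x. (cis (a * x) * complex_of_real (exp (- x\<^sup>2 / 2))) \<partial>lborel)) =
     sqrt (2*pi) *\<^sub>R complex_of_real (exp (- a\<^sup>2 / 2))" by metis
  then show "(\<integral>x. cis (a * x) * complex_of_real (exp (- x\<^sup>2 / 2)) \<partial>lborel)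
        = complex_of_real (sqrt (2 * pi) * exp (- a\<^sup>2 / 2))"
    by (simp add: scaleR_conv_of_real)
qed

lemma cis_sum: "finite A \<Longrightarrow> cis (\<Sum>b\<in>A. f b) = (\<Prod>b\<in>A. cis (f b))"
  by (induction A rule: finite_induct) (auto simp: cis_mult[symmetric])

text \<open>By \<open>lborel_eq\<close>, Lebesgue measure is the image of the finite product measure
  over the basis, where products of one-variable functions integrate factor by factor.\<close>

lemma
  fixes f :: "'a::euclidean_space \<Rightarrow> real \<Rightarrow> complex"
  assumes "\<And>b. b \<in> Basis \<Longrightarrow> integrable lborel (f b)"
  shows lborel_integral_prod: "(\<integral>x. (\<Prod>b\<in>Basis. f b (x \<bullet> b)) \<partial>lborel) = (\<Prod>b\<in>Basis. \<integral>t. f b t \<partial>lborel)"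
    and lborel_integrable_prod: "integrable lborel (\<lambda>x::'a. \<Prod>b\<in>Basis. f b (x \<bullet> b))"
proof -
  interpret product_sigma_finite "\<lambda>_::'a. lborel :: real measure" by standard
  have [measurable]: "b \<in> Basis \<Longrightarrow> f b \<in> borel_measurable borel" for b
    using assms[of b] by auto
  have eq: "(\<Prod>b\<in>Basis. f b ((\<Sum>b\<in>Basis. g b *\<^sub>R b) \<bullet> b)) = (\<Prod>b\<in>Basis. f b (g b))" for g :: "'a \<Rightarrow> real"
    by (intro prod.cong) auto
  show "(\<integral>x. (\<Prod>b\<in>Basis. f b (x \<bullet> b)) \<partial>lborel) = (\<Prod>b\<in>Basis. \<integral>t. f b t \<partial>lborel)"
    apply (subst lborel_eq)
    apply (subst integral_distr)
      apply simp
     apply measurable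
    apply (simp only: eq)
    apply (rule product_integral_prod)
     apply (auto intro: assms)
    done
  show "integrable lborel (\<lambda>x::'a. \<Prod>b\<in>Basis. f b (x \<bullet> b))"
    apply (subst lborel_eq)
    apply (subst integrable_distr_eq)
      apply simp
     apply measurable
    apply (simp only: eq)
    apply (rule product_integrable_prod)
     apply (auto intro: assms)
    done
qed

lemma
  fixes x :: "'a::euclidean_space"
  shows gauss_ft_integrable: "integrable lborel (\<lambda>\<xi>. cis (x \<bullet> \<xi>) * complex_of_real (gauss \<xi>))"
    and gauss_ft_integral: "(\<integral>\<xi>. cis (x \<bullet> \<xi>) * complex_of_real (gauss \<xi>) \<partial>lborel)
        = complex_of_real (sqrt (2 * pi) ^ DIM('a) * gauss x)"
proof -
  have eq: "cis (x \<bullet> \<xi>) * complex_of_real (gauss \<xi>)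
      = (\<Prod>b\<in>Basis. (cis ((x \<bullet> b) * (\<xi> \<bullet> b)) * complex_of_real (exp (- (\<xi> \<bullet> b)\<^sup>2 / 2))))" for \<xi>
    unfolding gauss_prod euclidean_inner[of x \<xi>] cis_sum[OF finite_Basis] of_real_prod prod.distrib ..
  show "integrable lborel (\<lambda>\<xi>. cis (x \<bullet> \<xi>) * complex_of_real (gauss \<xi>))"
    unfolding eq by (rule lborel_integrable_prod) (rule gauss_1d_integrable)
  show "(\<integral>\<xi>. cis (x \<bullet> \<xi>) * complex_of_real (gauss \<xi>) \<partial>lborel)
        = complex_of_real (sqrt (2 * pi) ^ DIM('a) * gauss x)"
    unfolding eq
    apply (subst lborel_integral_prod)
     apply (rule gauss_1d_integrable)
    apply (simp only: gauss_1d_integral gauss_prod[of x])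
    apply (simp add: prod.distrib)
    done
qed

lemma gauss_integrable: "integrable lborel (gauss :: 'a::euclidean_space \<Rightarrow> real)"
proof -
  have "integrable lborel (\<lambda>\<xi>::'a. complex_of_real (gauss \<xi>))"
    using gauss_ft_integrable[of "0::'a"] by simp
  then show ?thesis by (simp only: complex_of_real_integrable_eq)
qed

lemma gauss_integral: "(\<integral>x. gauss (x::'a::euclidean_space) \<partial>lborel) = sqrt (2 * pi) ^ DIM('a)"
proof -
  have "(\<integral>x. complex_of_real (gauss (x::'a)) \<partial>lborel) = complex_of_real (sqrt (2 * pi) ^ DIM('a))"
    using gauss_ft_integral[of "0::'a"] by (simp add: gauss_def[of "0::'a"])
  then show ?thesis by (simp only: integral_complex_of_real of_real_eq_iff)
qed

lemma lborel_scale_distr: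
  assumes "c \<noteq> 0"
  shows "density (distr lborel borel (\<lambda>x. c *\<^sub>R x)) (\<lambda>_. ennreal (\<bar>c\<bar> ^ DIM('a))) = (lborel :: 'a::euclidean_space measure)"
  using lborel_affine[OF assms, of "0::'a"] by simp

lemma nn_integral_lborel_scale:
  fixes f :: "'a::euclidean_space \<Rightarrow> ennreal"
  assumes [measurable]: "f \<in> borel_measurable borel" and c: "c \<noteq> 0"
  shows "(\<integral>\<^sup>+x. f x \<partial>lborel) = ennreal (\<bar>c\<bar> ^ DIM('a)) * (\<integral>\<^sup>+x. f (c *\<^sub>R x) \<partial>lborel)"
  apply (subst lborel_scale_distr[OF c, symmetric])
  apply (subst nn_integral_density)
    apply simp_all
  apply (subst nn_integral_distr)
    apply simp_all
  apply (subst nn_integral_cmult)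
   apply simp_all
  done

lemma
  fixes f :: "'a::euclidean_space \<Rightarrow> 'b::{banach,second_countable_topology}"
  assumes f: "f \<in> borel_measurable borel" and c: "c \<noteq> 0"
  shows lborel_integral_scale: "(\<integral>x. f x \<partial>lborel) = (\<bar>c\<bar> ^ DIM('a)) *\<^sub>R (\<integral>x. f (c *\<^sub>R x) \<partial>lborel)"
    and lborel_integrable_scale: "integrable lborel f \<longleftrightarrow> integrable lborel (\<lambda>x. f (c *\<^sub>R x))"
proof -
  note [measurable] = f
  show "(\<integral>x. f x \<partial>lborel) = (\<bar>c\<bar> ^ DIM('a)) *\<^sub>R (\<integral>x. f (c *\<^sub>R x) \<partial>lborel)"
    apply (subst lborel_scale_distr[OF c, symmetric])
    apply (subst integral_density)
       apply simp_all
    apply (subst integral_distr)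
      apply simp_all
    done
  have "integrable lborel f \<longleftrightarrow> integrable (density (distr lborel borel (\<lambda>x. c *\<^sub>R x)) (\<lambda>_. ennreal (\<bar>c\<bar> ^ DIM('a)))) f"
    using lborel_scale_distr[OF c, where 'a='a] by simp
  also have "\<dots> \<longleftrightarrow> integrable (distr lborel borel (\<lambda>x. c *\<^sub>R x)) (\<lambda>x. \<bar>c\<bar> ^ DIM('a) *\<^sub>R f x)"
    by (rule integrable_density) auto
  also have "\<dots> \<longleftrightarrow> integrable lborel (\<lambda>x. \<bar>c\<bar> ^ DIM('a) *\<^sub>R f (c *\<^sub>R x))"
    by (rule integrable_distr_eq) auto
  also have "\<dots> \<longleftrightarrow> integrable lborel (\<lambda>x. f (c *\<^sub>R x))"
    (is "integrable lborel ?g \<longleftrightarrow> integrable lborel ?h")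
  proof
    assume "integrable lborel ?g"
    then have "integrable lborel (\<lambda>x. (1 / \<bar>c\<bar> ^ DIM('a)) *\<^sub>R ?g x)"
      by (rule integrable_scaleR_right)
    then show "integrable lborel ?h" using c by simp
  qed auto
  finally show "integrable lborel f \<longleftrightarrow> integrable lborel (\<lambda>x. f (c *\<^sub>R x))" .
qed

lemma nn_integral_lborel_translate:
  fixes f :: "'a::euclidean_space \<Rightarrow> ennreal"
  assumes [measurable]: "f \<in> borel_measurable borel"
  shows "(\<integral>\<^sup>+x. f (a + x) \<partial>lborel) = (\<integral>\<^sup>+x. f x \<partial>lborel)"
  apply (subst (2) lborel_distr_plus[of a, symmetric])
  apply (subst nn_integral_distr)
    apply simp_all
  done

lemma lborel_integral_translate:
  fixes f :: "'a::euclidean_space \<Rightarrow> 'b::{banach,second_countable_topology}"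
  assumes [measurable]: "f \<in> borel_measurable borel"
  shows "(\<integral>x. f (a + x) \<partial>lborel) = (\<integral>x. f x \<partial>lborel)"
    and "integrable lborel (\<lambda>x. f (a + x)) \<longleftrightarrow> integrable lborel f"
   apply (subst (2) lborel_distr_plus[of a, symmetric])
   apply (subst integral_distr)
     apply simp_all
  apply (subst (2) lborel_distr_plus[of a, symmetric])
  apply (subst integrable_distr_eq)
    apply simp_all
  done

lemma
  fixes x :: "'a::euclidean_space"
  assumes "\<epsilon> > 0"
  shows gauss_ft_integrable_scale: "integrable lborel (\<lambda>\<xi>. cis (x \<bullet> \<xi>) * complex_of_real (gauss (\<epsilon> *\<^sub>R \<xi>)))"
    and gauss_ft_integral_scale: "(\<integral>\<xi>. cis (x \<bullet> \<xi>) * complex_of_real (gauss (\<epsilon> *\<^sub>R \<xi>)) \<partial>lborel)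
        = complex_of_real (sqrt (2 * pi) ^ DIM('a) / \<epsilon> ^ DIM('a) * gauss (x /\<^sub>R \<epsilon>))"
proof -
  let ?f = "\<lambda>\<xi>. cis ((x /\<^sub>R \<epsilon>) \<bullet> \<xi>) * complex_of_real (gauss \<xi>)"
  have [measurable]: "?f \<in> borel_measurable borel" by measurable
  have eq: "?f (\<epsilon> *\<^sub>R \<xi>) = cis (x \<bullet> \<xi>) * complex_of_real (gauss (\<epsilon> *\<^sub>R \<xi>))" for \<xi>
    using assms by (simp add: mult.assoc[symmetric])
  show "integrable lborel (\<lambda>\<xi>. cis (x \<bullet> \<xi>) * complex_of_real (gauss (\<epsilon> *\<^sub>R \<xi>)))"
    using lborel_integrable_scale[of ?f \<epsilon>] assms gauss_ft_integrable[of "x /\<^sub>R \<epsilon>"] unfolding eq by auto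
  have "complex_of_real (sqrt (2 * pi) ^ DIM('a) * gauss (x /\<^sub>R \<epsilon>)) =
     \<epsilon> ^ DIM('a) *\<^sub>R (\<integral>\<xi>. cis (x \<bullet> \<xi>) * complex_of_real (gauss (\<epsilon> *\<^sub>R \<xi>)) \<partial>lborel)"
    using lborel_integral_scale[of ?f \<epsilon>] assms gauss_ft_integral[of "x /\<^sub>R \<epsilon>"] unfolding eq by simp
  then show "(\<integral>\<xi>. cis (x \<bullet> \<xi>) * complex_of_real (gauss (\<epsilon> *\<^sub>R \<xi>)) \<partial>lborel)
        = complex_of_real (sqrt (2 * pi) ^ DIM('a) / \<epsilon> ^ DIM('a) * gauss (x /\<^sub>R \<epsilon>))"
    using assms by (simp add: scaleR_conv_of_real field_simps)
qed

section \<open>The Bessel inequality on Euclidean space\<close>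

text \<open>For a function that is not integrable the Bochner integral is 0 by convention, so the
  bound is trivial in that case.\<close>

lemma ennreal_norm_integral_le:
  fixes f :: "_ \<Rightarrow> 'b::{banach,second_countable_topology}"
  shows "ennreal (norm (\<integral>x. f x \<partial>M)) \<le> (\<integral>\<^sup>+x. ennreal (norm (f x)) \<partial>M)"
  by (cases "integrable M f") (auto intro: integral_norm_bound_ennreal simp: not_integrable_integral_eq)

lemma ft_measurable [measurable]:
  assumes [measurable]: "f \<in> borel_measurable borel"
  shows "ft s f \<in> borel_measurable borel"
  unfolding ft_def by measurable

lemma ft_bound: "norm (ft s f \<xi>) \<le> (\<integral>x. norm (f x) \<partial>lborel)"
proof (cases "integrable lborel (\<lambda>x. cis (s * (x \<bullet> \<xi>)) * f x)")
  case True
  have "norm (ft s f \<xi>) \<le> (\<integral>x. norm (cis (s * (x \<bullet> \<xi>)) * f x) \<partial>lborel)"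
    unfolding ft_def by (rule integral_norm_bound)
  then show ?thesis by (simp add: norm_mult)
qed (auto simp: ft_def not_integrable_integral_eq)

lemma ft_integrable:
  assumes "integrable lborel f"
  shows "integrable lborel (\<lambda>x. cis (s * (x \<bullet> \<xi>)) * f x)"
  using assms by (rule Bochner_Integration.integrable_bound) (use assms in \<open>auto simp: norm_mult\<close>)

lemma integrable_mult_bounded:
  fixes f g :: "'a::euclidean_space \<Rightarrow> complex"
  assumes "integrable lborel g" and [measurable]: "f \<in> borel_measurable borel" and "\<And>x. norm (f x) \<le> B"
  shows "integrable lborel (\<lambda>x. f x * g x)"
proof (rule Bochner_Integration.integrable_bound)
  show "integrable lborel (\<lambda>x. of_real B * g x)" using assms by auto
  show "(\<lambda>x. f x * g x) \<in> borel_measurable lborel" using assms by auto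
  have "B \<ge> 0" using norm_ge_zero order_trans assms(3) by blast
  then show "AE x in lborel. norm (f x * g x) \<le> norm (of_real B * g x)"
    using assms(3) by (auto simp: norm_mult intro!: mult_right_mono)
qed

text \<open>Fubini: the kernel \<open>cis (s * (x \<bullet> \<xi>))\<close> is symmetric in its two
  arguments, so the transform moves from one factor to the other.\<close>

lemma ft_mult:
  fixes f g :: "'a::euclidean_space \<Rightarrow> complex"
  assumes f: "integrable lborel f" and g: "integrable lborel g"
  shows "(\<integral>\<xi>. ft s f \<xi> * g \<xi> \<partial>lborel) = (\<integral>x. f x * ft s g x \<partial>lborel)"
proof -
  have [measurable]: "f \<in> borel_measurable borel" "g \<in> borel_measurable borel" using f g by auto
  let ?F = "\<lambda>\<xi> x. cis (s * (x \<bullet> \<xi>)) * f x * g \<xi>"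
  have int: "integrable (lborel \<Otimes>\<^sub>M lborel) (case_prod ?F)"
  proof (rule lborel_pair.Fubini_integrable)
    show "case_prod ?F \<in> borel_measurable (lborel \<Otimes>\<^sub>M lborel)" by measurable
    show "integrable lborel (\<lambda>x. \<integral>y. norm (case (x, y) of (\<xi>, x) \<Rightarrow> ?F \<xi> x) \<partial>lborel)"
      using g by (simp add: norm_mult)
    show "AE x in lborel. integrable lborel (\<lambda>y. case (x, y) of (\<xi>, x) \<Rightarrow> ?F \<xi> x)"
      using ft_integrable[OF f] by auto
  qed
  have "(\<integral>\<xi>. ft s f \<xi> * g \<xi> \<partial>lborel) = (\<integral>\<xi>. \<integral>x. ?F \<xi> x \<partial>lborel \<partial>lborel)"
    unfolding ft_def by (intro Bochner_Integration.integral_cong refl) simp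
  also have "\<dots> = (\<integral>x. \<integral>\<xi>. ?F \<xi> x \<partial>lborel \<partial>lborel)"
    by (rule lborel_pair.Fubini_integral[OF int, symmetric])
  also have "\<dots> = (\<integral>x. \<integral>\<xi>. f x * (cis (s * (\<xi> \<bullet> x)) * g \<xi>) \<partial>lborel \<partial>lborel)"
    by (intro Bochner_Integration.integral_cong refl) (simp add: inner_commute mult_ac)
  also have "\<dots> = (\<integral>x. f x * ft s g x \<partial>lborel)"
    unfolding ft_def by simp
  finally show ?thesis .
qed

text \<open>The transform of the damping factor \<open>gauss (\<epsilon> *\<^sub>R \<xi>)\<close>.
  It has total mass \<open>(2 * pi) ^ DIM('a)\<close> for every \<epsilon> and concentrates at the
  origin as \<epsilon> tends to 0.\<close>

definition kern :: "real \<Rightarrow> 'a::euclidean_space \<Rightarrow> real" where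
  "kern \<epsilon> x = sqrt (2 * pi) ^ DIM('a) / \<epsilon> ^ DIM('a) * gauss (x /\<^sub>R \<epsilon>)"

lemma kern_measurable [measurable]: "kern \<epsilon> \<in> borel_measurable borel"
  unfolding kern_def by measurable

lemma kern_nonneg: "\<epsilon> > 0 \<Longrightarrow> 0 \<le> kern \<epsilon> x"
  by (simp add: kern_def gauss_nonneg)

lemma kern_nn_integral:
  assumes e: "\<epsilon> > 0"
  shows "(\<integral>\<^sup>+x. ennreal (kern \<epsilon> (x::'a::euclidean_space)) \<partial>lborel) = ennreal ((2 * pi) ^ DIM('a))"
proof -
  have "(\<integral>\<^sup>+x. ennreal (kern \<epsilon> (x::'a)) \<partial>lborel)
      = ennreal (\<epsilon> ^ DIM('a)) * (\<integral>\<^sup>+x. ennreal (sqrt (2 * pi) ^ DIM('a) / \<epsilon> ^ DIM('a)) * ennreal (gauss (x::'a)) \<partial>lborel)"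
    using nn_integral_lborel_scale[of "\<lambda>x. ennreal (kern \<epsilon> (x::'a))" \<epsilon>] e
    by (simp add: kern_def ennreal_mult'[symmetric] gauss_nonneg)
  also have "\<dots> = ennreal (\<epsilon> ^ DIM('a)) * (ennreal (sqrt (2 * pi) ^ DIM('a) / \<epsilon> ^ DIM('a)) * ennreal (sqrt (2 * pi) ^ DIM('a)))"
    by (simp add: nn_integral_cmult nn_integral_eq_integral gauss_integrable gauss_nonneg gauss_integral)
  also have "\<dots> = ennreal (\<epsilon> ^ DIM('a) * (sqrt (2 * pi) ^ DIM('a) / \<epsilon> ^ DIM('a) * sqrt (2 * pi) ^ DIM('a)))"
    using e by (subst ennreal_mult[symmetric], simp, simp, subst ennreal_mult[symmetric]) auto
  also have "\<epsilon> ^ DIM('a) * (sqrt (2 * pi) ^ DIM('a) / \<epsilon> ^ DIM('a) * sqrt (2 * pi) ^ DIM('a)) = (sqrt (2 * pi) * sqrt (2 * pi)) ^ DIM('a)"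
    using e unfolding power_mult_distrib by simp
  also have "\<dots> = (2 * pi) ^ DIM('a)" by simp
  finally show ?thesis .
qed

text \<open>The Gaussian makes the frequency integral absolutely convergent, so
  \<open>ft_mult\<close> can be applied twice. The opposite signs of the two transforms make the
  resulting kernel depend on \<open>y - x\<close> only.\<close>

lemma ft_pairing:
  fixes F G :: "'a::euclidean_space \<Rightarrow> complex"
  assumes F: "integrable lborel F" and G: "integrable lborel G" and e: "\<epsilon> > 0" and s: "s \<in> {1, - 1}"
  shows "integrable lborel (\<lambda>\<xi>. ft (- s) F \<xi> * (ft s G \<xi> * complex_of_real (gauss (\<epsilon> *\<^sub>R \<xi>))))"
    and "(\<integral>\<xi>. ft (- s) F \<xi> * (ft s G \<xi> * complex_of_real (gauss (\<epsilon> *\<^sub>R \<xi>))) \<partial>lborel)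
      = (\<integral>x. F x * (\<integral>y. G y * complex_of_real (kern \<epsilon> (y - x)) \<partial>lborel) \<partial>lborel)"
proof -
  have [measurable]: "F \<in> borel_measurable borel" "G \<in> borel_measurable borel" using F G by auto
  have g: "integrable lborel (\<lambda>\<xi>::'a. complex_of_real (gauss (\<epsilon> *\<^sub>R \<xi>)))"
    using gauss_ft_integrable_scale[OF e, of "0::'a"] by simp
  have Gg: "integrable lborel (\<lambda>\<xi>. ft s G \<xi> * complex_of_real (gauss (\<epsilon> *\<^sub>R \<xi>)))"
    by (rule integrable_mult_bounded[OF g _ ft_bound]) auto
  show "integrable lborel (\<lambda>\<xi>. ft (- s) F \<xi> * (ft s G \<xi> * complex_of_real (gauss (\<epsilon> *\<^sub>R \<xi>))))"
    by (rule integrable_mult_bounded[OF Gg _ ft_bound]) auto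
  have in1: "ft s (\<lambda>\<xi>. cis (- s * (\<xi> \<bullet> x)) * complex_of_real (gauss (\<epsilon> *\<^sub>R \<xi>))) y
      = complex_of_real (kern \<epsilon> (y - x))" for x y :: 'a
  proof -
    have "ft s (\<lambda>\<xi>. cis (- s * (\<xi> \<bullet> x)) * complex_of_real (gauss (\<epsilon> *\<^sub>R \<xi>))) y
       = (\<integral>\<xi>. cis ((s *\<^sub>R (y - x)) \<bullet> \<xi>) * complex_of_real (gauss (\<epsilon> *\<^sub>R \<xi>)) \<partial>lborel)"
      unfolding ft_def mult.assoc[symmetric] cis_mult
      by (intro Bochner_Integration.integral_cong refl) (simp add: inner_commute algebra_simps)
    \<comment> \<open>For \<open>s = - 1\<close> the argument is reflected, which the even Gaussian
      does not see.\<close>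
    also have "\<dots> = complex_of_real (kern \<epsilon> (y - x))"
      using s by (subst gauss_ft_integral_scale[OF e]) (auto simp: kern_def scaleR_minus_right gauss_uminus[of "(y - x) /\<^sub>R \<epsilon>", symmetric] simp del: gauss_uminus)
    finally show ?thesis .
  qed
  have in2: "ft (- s) (\<lambda>\<xi>. ft s G \<xi> * complex_of_real (gauss (\<epsilon> *\<^sub>R \<xi>))) x
     = (\<integral>y. G y * complex_of_real (kern \<epsilon> (y - x)) \<partial>lborel)" for x
  proof -
    have "ft (- s) (\<lambda>\<xi>. ft s G \<xi> * complex_of_real (gauss (\<epsilon> *\<^sub>R \<xi>))) x
      = (\<integral>\<xi>. ft s G \<xi> * (cis (- s * (\<xi> \<bullet> x)) * complex_of_real (gauss (\<epsilon> *\<^sub>R \<xi>))) \<partial>lborel)"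
      unfolding ft_def[of "- s"] by (intro Bochner_Integration.integral_cong refl) (simp add: mult_ac)
    also have "\<dots> = (\<integral>y. G y * ft s (\<lambda>\<xi>. cis (- s * (\<xi> \<bullet> x)) * complex_of_real (gauss (\<epsilon> *\<^sub>R \<xi>))) y \<partial>lborel)"
      by (rule ft_mult[OF G ft_integrable[OF g]])
    finally show ?thesis unfolding in1 .
  qed
  show "(\<integral>\<xi>. ft (- s) F \<xi> * (ft s G \<xi> * complex_of_real (gauss (\<epsilon> *\<^sub>R \<xi>))) \<partial>lborel)
      = (\<integral>x. F x * (\<integral>y. G y * complex_of_real (kern \<epsilon> (y - x)) \<partial>lborel) \<partial>lborel)"
    unfolding ft_mult[OF F Gg] in2 ..
qed

lemma ft_cnj: "ft s (\<lambda>x. cnj (f x)) \<xi> = cnj (ft (- s) f \<xi>)"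
proof -
  have "ft s (\<lambda>x. cnj (f x)) \<xi> = (\<integral>x. cnj (cis (- s * (x \<bullet> \<xi>)) * f x) \<partial>lborel)"
    unfolding ft_def by (intro Bochner_Integration.integral_cong) (auto simp: cis_cnj)
  also have "\<dots> = cnj (\<integral>x. cis (- s * (x \<bullet> \<xi>)) * f x \<partial>lborel)"
    by (rule Bochner_Integration.integral_cnj)
  finally show ?thesis unfolding ft_def .
qed

text \<open>The damped integral of the squared modulus is a quadratic form in \<open>F\<close> with
  a nonnegative kernel whose rows and columns have mass \<open>(2 * pi) ^ DIM('a)\<close>. Schur's
  test bounds it uniformly in \<epsilon>, and Fatou's lemma removes the damping.\<close>

theorem bessel:
  fixes F :: "'a::euclidean_space \<Rightarrow> complex"
  assumes F: "integrable lborel F" and s: "s \<in> {1, - 1}"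
  shows "(\<integral>\<^sup>+\<xi>. ennreal ((norm (ft s F \<xi>))\<^sup>2) \<partial>lborel)
     \<le> ennreal ((2 * pi) ^ DIM('a)) * (\<integral>\<^sup>+x. ennreal ((norm (F x))\<^sup>2) \<partial>lborel)"
proof -
  have [measurable]: "F \<in> borel_measurable borel" using F by auto
  let ?N = "\<integral>\<^sup>+x. ennreal ((norm (F x))\<^sup>2) \<partial>lborel"
  let ?C = "ennreal ((2 * pi) ^ DIM('a))"
  have s': "- s \<in> {1, - 1}" using s by auto
  have reg: "(\<integral>\<^sup>+\<xi>. ennreal ((norm (ft s F \<xi>))\<^sup>2 * gauss (\<epsilon> *\<^sub>R \<xi>)) \<partial>lborel) \<le> ?C * ?N" if e: "\<epsilon> > 0" for \<epsilon>
  proof -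
    \<comment> \<open>Pairing \<open>F\<close> with its conjugate, at the opposite sign, turns the
      product of the two transforms into the squared modulus of one.\<close>
    have G: "integrable lborel (\<lambda>x. cnj (F x))" using F by simp
    have eq: "ft (- (- s)) F \<xi> * (ft (- s) (\<lambda>x. cnj (F x)) \<xi> * complex_of_real (gauss (\<epsilon> *\<^sub>R \<xi>)))
        = complex_of_real ((norm (ft s F \<xi>))\<^sup>2 * gauss (\<epsilon> *\<^sub>R \<xi>))" for \<xi>
      unfolding ft_cnj by (simp add: complex_norm_square del: of_real_power)
    have I: "integrable lborel (\<lambda>\<xi>. (norm (ft s F \<xi>))\<^sup>2 * gauss (\<epsilon> *\<^sub>R \<xi>))"
      using ft_pairing(1)[OF F G e s'] unfolding eq complex_of_real_integrable_eq .
    have E: "complex_of_real (\<integral>\<xi>. (norm (ft s F \<xi>))\<^sup>2 * gauss (\<epsilon> *\<^sub>R \<xi>) \<partial>lborel)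
       = (\<integral>x. F x * (\<integral>y. cnj (F y) * complex_of_real (kern \<epsilon> (y - x)) \<partial>lborel) \<partial>lborel)"
      using ft_pairing(2)[OF F G e s'] unfolding eq integral_complex_of_real .
    have nn: "0 \<le> (\<integral>\<xi>. (norm (ft s F \<xi>))\<^sup>2 * gauss (\<epsilon> *\<^sub>R \<xi>) \<partial>lborel)"
      by (intro Bochner_Integration.integral_nonneg) (auto simp: gauss_nonneg)
    have "(\<integral>\<^sup>+\<xi>. ennreal ((norm (ft s F \<xi>))\<^sup>2 * gauss (\<epsilon> *\<^sub>R \<xi>)) \<partial>lborel)
       = ennreal (\<integral>\<xi>. (norm (ft s F \<xi>))\<^sup>2 * gauss (\<epsilon> *\<^sub>R \<xi>) \<partial>lborel)"
      by (intro nn_integral_eq_integral I) (auto simp: gauss_nonneg)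
    also have "\<dots> = ennreal (norm (\<integral>x. F x * (\<integral>y. cnj (F y) * complex_of_real (kern \<epsilon> (y - x)) \<partial>lborel) \<partial>lborel))"
      unfolding E[symmetric] using nn by simp
    also have "\<dots> \<le> (\<integral>\<^sup>+x. ennreal (norm (F x * (\<integral>y. cnj (F y) * complex_of_real (kern \<epsilon> (y - x)) \<partial>lborel))) \<partial>lborel)"
      by (rule ennreal_norm_integral_le)
    also have "\<dots> \<le> (\<integral>\<^sup>+x. (\<integral>\<^sup>+y. ennreal (norm (F x) * (norm (F y) * kern \<epsilon> (y - x))) \<partial>lborel) \<partial>lborel)"
    proof (intro nn_integral_mono)
      fix x
      have "ennreal (norm (F x * (\<integral>y. cnj (F y) * complex_of_real (kern \<epsilon> (y - x)) \<partial>lborel)))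
        = ennreal (norm (F x)) * ennreal (norm (\<integral>y. cnj (F y) * complex_of_real (kern \<epsilon> (y - x)) \<partial>lborel))"
        by (simp add: norm_mult ennreal_mult)
      also have "\<dots> \<le> ennreal (norm (F x)) * (\<integral>\<^sup>+y. ennreal (norm (cnj (F y) * complex_of_real (kern \<epsilon> (y - x)))) \<partial>lborel)"
        by (intro mult_left_mono ennreal_norm_integral_le) auto
      also have "\<dots> = (\<integral>\<^sup>+y. ennreal (norm (F x)) * ennreal (norm (F y) * kern \<epsilon> (y - x)) \<partial>lborel)"
        by (subst nn_integral_cmult[symmetric]) (auto simp: norm_mult kern_nonneg[OF e])
      also have "\<dots> = (\<integral>\<^sup>+y. ennreal (norm (F x) * (norm (F y) * kern \<epsilon> (y - x))) \<partial>lborel)"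
        by (simp add: ennreal_mult[symmetric] kern_nonneg[OF e])
      finally show "ennreal (norm (F x * (\<integral>y. cnj (F y) * complex_of_real (kern \<epsilon> (y - x)) \<partial>lborel)))
        \<le> (\<integral>\<^sup>+y. ennreal (norm (F x) * (norm (F y) * kern \<epsilon> (y - x))) \<partial>lborel)" .
    qed
    \<comment> \<open>Schur's test: the arithmetic-geometric mean inequality leaves one of the two
      variables free in each half, and integrating the kernel in that variable gives the constant
      mass.\<close>
    also have "\<dots> \<le> (\<integral>\<^sup>+x. (\<integral>\<^sup>+y. ennreal (1/2) * (ennreal ((norm (F x))\<^sup>2) * ennreal (kern \<epsilon> (y - x)))
          + ennreal (1/2) * (ennreal ((norm (F y))\<^sup>2) * ennreal (kern \<epsilon> (y - x))) \<partial>lborel) \<partial>lborel)"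
    proof (intro nn_integral_mono)
      fix x y
      have "norm (F x) * norm (F y) \<le> 1/2 * (norm (F x))\<^sup>2 + 1/2 * (norm (F y))\<^sup>2"
        using sum_squares_bound[of "norm (F x)" "norm (F y)"] by simp
      from mult_right_mono[OF this kern_nonneg[OF e, of "y - x"]]
      have "norm (F x) * (norm (F y) * kern \<epsilon> (y - x))
         \<le> 1/2 * ((norm (F x))\<^sup>2 * kern \<epsilon> (y - x)) + 1/2 * ((norm (F y))\<^sup>2 * kern \<epsilon> (y - x))"
        by (simp add: algebra_simps)
      then have "ennreal (norm (F x) * (norm (F y) * kern \<epsilon> (y - x)))
         \<le> ennreal (1/2 * ((norm (F x))\<^sup>2 * kern \<epsilon> (y - x)) + 1/2 * ((norm (F y))\<^sup>2 * kern \<epsilon> (y - x)))"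
        by (rule ennreal_leI)
      also have "\<dots> = ennreal (1/2) * (ennreal ((norm (F x))\<^sup>2) * ennreal (kern \<epsilon> (y - x)))
          + ennreal (1/2) * (ennreal ((norm (F y))\<^sup>2) * ennreal (kern \<epsilon> (y - x)))"
      proof -
        have sp: "ennreal (1/2 * (a * kern \<epsilon> (y - x))) = ennreal (1/2) * (ennreal a * ennreal (kern \<epsilon> (y - x)))"
          if "0 \<le> a" for a
          by (subst ennreal_mult', simp, subst ennreal_mult'[OF that], rule refl)
        show ?thesis
          using kern_nonneg[OF e, of "y - x"] by (subst ennreal_plus) (simp, simp, simp only: sp zero_le_power2)
      qed
      finally show "ennreal (norm (F x) * (norm (F y) * kern \<epsilon> (y - x)))
         \<le> ennreal (1/2) * (ennreal ((norm (F x))\<^sup>2) * ennreal (kern \<epsilon> (y - x)))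
          + ennreal (1/2) * (ennreal ((norm (F y))\<^sup>2) * ennreal (kern \<epsilon> (y - x)))" .
    qed
    also have "\<dots> = ennreal (1/2) * (\<integral>\<^sup>+x. (\<integral>\<^sup>+y. ennreal ((norm (F x))\<^sup>2) * ennreal (kern \<epsilon> (y - x)) \<partial>lborel) \<partial>lborel)
        + ennreal (1/2) * (\<integral>\<^sup>+x. (\<integral>\<^sup>+y. ennreal ((norm (F y))\<^sup>2) * ennreal (kern \<epsilon> (y - x)) \<partial>lborel) \<partial>lborel)"
      by (simp add: nn_integral_add nn_integral_cmult)
    also have "(\<integral>\<^sup>+x. (\<integral>\<^sup>+y. ennreal ((norm (F x))\<^sup>2) * ennreal (kern \<epsilon> (y - x)) \<partial>lborel) \<partial>lborel) = ?C * ?N"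
    proof -
      have "(\<integral>\<^sup>+y. ennreal (kern \<epsilon> (y - x)) \<partial>lborel) = ?C" for x :: 'a
        using nn_integral_lborel_translate[of "\<lambda>y. ennreal (kern \<epsilon> y)" "- x"] by (simp add: kern_nn_integral[OF e])
      then show ?thesis by (simp add: nn_integral_cmult nn_integral_multc mult.commute)
    qed
    also have "(\<integral>\<^sup>+x. (\<integral>\<^sup>+y. ennreal ((norm (F y))\<^sup>2) * ennreal (kern \<epsilon> (y - x)) \<partial>lborel) \<partial>lborel) = ?C * ?N"
    proof -
      have k: "kern \<epsilon> (y - x) = kern \<epsilon> (x - y)" for x y :: 'a
        unfolding kern_def by (metis gauss_uminus minus_diff_eq scaleR_minus_right)
      have "(\<integral>\<^sup>+x. ennreal (kern \<epsilon> (y - x)) \<partial>lborel) = ?C" for y :: 'a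
        unfolding k[of y] using nn_integral_lborel_translate[of "\<lambda>y. ennreal (kern \<epsilon> y)" "- y"] by (simp add: kern_nn_integral[OF e])
      moreover have "(\<integral>\<^sup>+x. (\<integral>\<^sup>+y. ennreal ((norm (F y))\<^sup>2) * ennreal (kern \<epsilon> (y - x)) \<partial>lborel) \<partial>lborel)
         = (\<integral>\<^sup>+y. (\<integral>\<^sup>+x. ennreal ((norm (F y))\<^sup>2) * ennreal (kern \<epsilon> (y - x)) \<partial>lborel) \<partial>lborel)"
        by (rule lborel_pair.Fubini') measurable
      ultimately show ?thesis by (simp add: nn_integral_cmult nn_integral_multc mult.commute)
    qed
    also have "ennreal (1/2) * (?C * ?N) + ennreal (1/2) * (?C * ?N) = ?C * ?N"
    proof -
      have *: "ennreal (1/2) + ennreal (1/2) = 1"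
        by (subst ennreal_plus[symmetric]) (simp_all del: ennreal_plus)
      show ?thesis unfolding distrib_right[symmetric] * by (rule mult_1)
    qed
    finally show ?thesis .
  qed
  have lim: "(\<lambda>n. (norm (ft s F \<xi>))\<^sup>2 * gauss ((1 / real (Suc n)) *\<^sub>R \<xi>)) \<longlonglongrightarrow> (norm (ft s F \<xi>))\<^sup>2" for \<xi>
  proof -
    have "(\<lambda>n. (1 / real (Suc n)) *\<^sub>R \<xi>) \<longlonglongrightarrow> 0 *\<^sub>R \<xi>"
      by (intro tendsto_intros LIMSEQ_Suc lim_1_over_n)
    then have "(\<lambda>n. gauss ((1 / real (Suc n)) *\<^sub>R \<xi>)) \<longlonglongrightarrow> gauss (0 *\<^sub>R \<xi>)"
      by (rule continuous_on_tendsto_compose[OF gauss_continuous]) auto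
    from tendsto_mult[OF tendsto_const this, of "(norm (ft s F \<xi>))\<^sup>2"]
    show ?thesis by (simp add: gauss_def)
  qed
  \<comment> \<open>The damping factors tend to 1 pointwise, so Fatou's lemma carries the uniform
    bound \<open>reg\<close> over to the undamped integral.\<close>
  have "(\<integral>\<^sup>+\<xi>. ennreal ((norm (ft s F \<xi>))\<^sup>2) \<partial>lborel)
     = (\<integral>\<^sup>+\<xi>. liminf (\<lambda>n. ennreal ((norm (ft s F \<xi>))\<^sup>2 * gauss ((1 / real (Suc n)) *\<^sub>R \<xi>))) \<partial>lborel)"
    by (intro nn_integral_cong lim_imp_Liminf[symmetric] tendsto_ennrealI lim) simp
  also have "\<dots> \<le> liminf (\<lambda>n. \<integral>\<^sup>+\<xi>. ennreal ((norm (ft s F \<xi>))\<^sup>2 * gauss ((1 / real (Suc n)) *\<^sub>R \<xi>)) \<partial>lborel)"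
    by (intro nn_integral_liminf) measurable
  also have "\<dots> \<le> liminf (\<lambda>n. ?C * ?N)"
    by (intro Liminf_mono always_eventually allI reg) auto
  also have "\<dots> = ?C * ?N" by (simp add: Liminf_const)
  finally show ?thesis .
qed

section \<open>Squared L2 norms and Cauchy--Schwarz\<close>

text \<open>Values in \<open>ennreal\<close> let estimates be chained before finiteness is known,
  whereas \<open>L2_norm\<close> collapses to 0 where the squared norm is not integrable.\<close>

definition L2sq :: "'a measure \<Rightarrow> ('a \<Rightarrow> 'b::real_normed_vector) \<Rightarrow> ennreal" where
  "L2sq M f = (\<integral>\<^sup>+x. ennreal ((norm (f x))\<^sup>2) \<partial>M)"

lemma square_integrable_L2sq: "square_integrable M f \<Longrightarrow> L2sq M f = ennreal ((L2_norm M f)\<^sup>2)"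
  unfolding square_integrable_def L2sq_def L2_norm_def
  by (subst nn_integral_eq_integral) auto

lemma square_integrable_iff_L2sq:
  "square_integrable M f \<longleftrightarrow> f \<in> borel_measurable M \<and> L2sq M f < \<infinity>"
  unfolding square_integrable_def L2sq_def integrable_iff_bounded by auto

lemma L2_norm_nonneg: "0 \<le> L2_norm M f"
  unfolding L2_norm_def by simp

text \<open>Squares replace the triangle inequality by
  \<open>(p + q)\<^sup>2 \<le> 2 * (p\<^sup>2 + q\<^sup>2)\<close>; only constants are
  affected.\<close>

lemma L2sq_add_le:
  assumes [measurable]: "f \<in> borel_measurable M" "g \<in> borel_measurable M"
  shows "L2sq M (\<lambda>x. f x + (g x :: 'b::{real_normed_vector,second_countable_topology})) \<le> 2 * (L2sq M f + L2sq M g)"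
proof -
  have "L2sq M (\<lambda>x. f x + g x) \<le> (\<integral>\<^sup>+x. 2 * (ennreal ((norm (f x))\<^sup>2) + ennreal ((norm (g x))\<^sup>2)) \<partial>M)"
    unfolding L2sq_def
  proof (intro nn_integral_mono)
    fix x
    have "(norm (f x + g x))\<^sup>2 \<le> (norm (f x) + norm (g x))\<^sup>2"
      by (intro power_mono norm_triangle_ineq) auto
    also have "\<dots> \<le> 2 * ((norm (f x))\<^sup>2 + (norm (g x))\<^sup>2)"
      using sum_squares_bound[of "norm (f x)" "norm (g x)"] by (simp add: power2_sum)
    finally have "ennreal ((norm (f x + g x))\<^sup>2) \<le> ennreal (2 * ((norm (f x))\<^sup>2 + (norm (g x))\<^sup>2))"
      by (rule ennreal_leI)
    also have "\<dots> = 2 * (ennreal ((norm (f x))\<^sup>2) + ennreal ((norm (g x))\<^sup>2))"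
      by (subst ennreal_mult) auto
    finally show "ennreal ((norm (f x + g x))\<^sup>2) \<le> 2 * (ennreal ((norm (f x))\<^sup>2) + ennreal ((norm (g x))\<^sup>2))" .
  qed
  also have "\<dots> = 2 * (L2sq M f + L2sq M g)"
    unfolding L2sq_def by (simp add: nn_integral_cmult nn_integral_add)
  finally show ?thesis .
qed

lemma L2sq_minus_commute: "L2sq M (\<lambda>x. f x - g x) = L2sq M (\<lambda>x. g x - f x)"
  by (simp add: L2sq_def norm_minus_commute)

lemma ennreal_power2_le_imp_le:
  assumes "a\<^sup>2 \<le> (ennreal b)\<^sup>2" shows "a \<le> ennreal b"
proof (cases a)
  case (real r)
  show ?thesis
  proof (cases "0 \<le> b")
    case True
    with real assms have "r\<^sup>2 \<le> b\<^sup>2" by (simp add: ennreal_power)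
    then show ?thesis using real True by (auto intro: power2_le_imp_le ennreal_leI)
  next
    case False
    with real assms show ?thesis by (simp add: ennreal_neg ennreal_power)
  qed
next
  case top
  with assms show ?thesis by (simp add: ennreal_power power2_eq_square top_unique ennreal_mult_eq_top_iff)
qed

lemma
  assumes u: "square_integrable M u" and v: "square_integrable M v"
  shows square_integrable_mult_norm: "integrable M (\<lambda>x. norm (u x) * norm (v x))"
    and L2_cauchy_schwarz: "(\<integral>x. norm (u x) * norm (v x) \<partial>M) \<le> L2_norm M u * L2_norm M v"
proof -
  have [measurable]: "u \<in> borel_measurable M" "v \<in> borel_measurable M"
    using u v by (auto simp: square_integrable_def)
  have "(\<integral>\<^sup>+x. ennreal (norm (u x)) * ennreal (norm (v x)) \<partial>M)\<^sup>2
     \<le> (\<integral>\<^sup>+x. (ennreal (norm (u x)))\<^sup>2 \<partial>M) * (\<integral>\<^sup>+x. (ennreal (norm (v x)))\<^sup>2 \<partial>M)"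
    by (rule Cauchy_Schwarz_nn_integral) measurable
  also have "\<dots> = L2sq M u * L2sq M v" by (simp add: L2sq_def ennreal_power)
  also have "\<dots> = ennreal ((L2_norm M u * L2_norm M v)\<^sup>2)"
    by (simp add: square_integrable_L2sq u v ennreal_mult power_mult_distrib)
  finally have *: "(\<integral>\<^sup>+x. ennreal (norm (u x)) * ennreal (norm (v x)) \<partial>M)\<^sup>2 \<le> (ennreal (L2_norm M u * L2_norm M v))\<^sup>2"
    by (simp add: ennreal_power L2_norm_nonneg)
  then have **: "(\<integral>\<^sup>+x. ennreal (norm (u x)) * ennreal (norm (v x)) \<partial>M) \<le> ennreal (L2_norm M u * L2_norm M v)"
    by (rule ennreal_power2_le_imp_le)
  show I: "integrable M (\<lambda>x. norm (u x) * norm (v x))"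
    unfolding integrable_iff_bounded
    using le_less_trans[OF **, of \<infinity>] by (auto simp: ennreal_mult abs_mult)
  show "(\<integral>x. norm (u x) * norm (v x) \<partial>M) \<le> L2_norm M u * L2_norm M v"
    using ** nn_integral_eq_integral[OF I] L2_norm_nonneg[of M u] L2_norm_nonneg[of M v]
    by (simp add: ennreal_mult[symmetric] ennreal_le_iff)
qed

lemma square_integrable_mult:
  fixes u v :: "'a \<Rightarrow> complex"
  assumes u: "square_integrable M u" and v: "square_integrable M v"
  shows "integrable M (\<lambda>x. u x * v x)"
proof (rule Bochner_Integration.integrable_bound[OF square_integrable_mult_norm[OF u v]])
  show "(\<lambda>x. u x * v x) \<in> borel_measurable M" using u v by (auto simp: square_integrable_def)
qed (simp add: norm_mult)

lemma L2_pairing_tendsto: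
  fixes f :: "nat \<Rightarrow> 'a \<Rightarrow> complex"
  assumes f: "square_integrable M (\<lambda>x. g x)" and v: "square_integrable M v"
    and d: "\<And>n. square_integrable M (\<lambda>x. f n x - g x)"
    and l: "(\<lambda>n. L2sq M (\<lambda>x. f n x - g x)) \<longlonglongrightarrow> 0"
  shows "(\<lambda>n. \<integral>x. f n x * v x \<partial>M) \<longlonglongrightarrow> (\<integral>x. g x * v x \<partial>M)"
proof -
  have eq: "(\<integral>x. f n x * v x \<partial>M) - (\<integral>x. g x * v x \<partial>M) = (\<integral>x. (f n x - g x) * v x \<partial>M)" for n
  proof -
    have "integrable M (\<lambda>x. (f n x - g x) * v x + g x * v x)"
      by (intro Bochner_Integration.integrable_add square_integrable_mult f v d)
    then have "integrable M (\<lambda>x. f n x * v x)" by (simp add: algebra_simps)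
    then show ?thesis
      by (subst Bochner_Integration.integral_diff[symmetric]) (auto intro: square_integrable_mult f v simp: algebra_simps)
  qed
  have "(\<lambda>n. ennreal ((L2_norm M (\<lambda>x. f n x - g x))\<^sup>2)) \<longlonglongrightarrow> ennreal 0"
    using l by (simp add: square_integrable_L2sq[OF d])
  then have "(\<lambda>n. (L2_norm M (\<lambda>x. f n x - g x))\<^sup>2) \<longlonglongrightarrow> 0"
    by (subst (asm) tendsto_ennreal_iff) auto
  then have "(\<lambda>n. sqrt ((L2_norm M (\<lambda>x. f n x - g x))\<^sup>2)) \<longlonglongrightarrow> sqrt 0"
    by (rule tendsto_real_sqrt)
  then have "(\<lambda>n. L2_norm M (\<lambda>x. f n x - g x)) \<longlonglongrightarrow> 0"
    by (simp add: L2_norm_nonneg)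
  then have lim: "(\<lambda>n. L2_norm M (\<lambda>x. f n x - g x) * L2_norm M v) \<longlonglongrightarrow> 0"
    by (rule tendsto_mult_left_zero)
  have "(\<lambda>n. (\<integral>x. f n x * v x \<partial>M) - (\<integral>x. g x * v x \<partial>M)) \<longlonglongrightarrow> 0"
  proof (rule Lim_null_comparison[OF _ lim], intro always_eventually allI)
    fix n
    have "norm (\<integral>x. (f n x - g x) * v x \<partial>M) \<le> (\<integral>x. norm ((f n x - g x) * v x) \<partial>M)"
      by (rule integral_norm_bound)
    also have "\<dots> \<le> L2_norm M (\<lambda>x. f n x - g x) * L2_norm M v"
      unfolding norm_mult by (rule L2_cauchy_schwarz[OF d v])
    finally show "norm ((\<integral>x. f n x * v x \<partial>M) - (\<integral>x. g x * v x \<partial>M)) \<le> L2_norm M (\<lambda>x. f n x - g x) * L2_norm M v"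
      unfolding eq .
  qed
  then show ?thesis by (rule LIM_zero_cancel)
qed

section \<open>Parseval against indicators of boxes\<close>

text \<open>The substitution y = x + \<epsilon> z moves \<epsilon> from the kernel into the set, so
  that limits in \<epsilon> can be taken under a fixed Gaussian.\<close>

lemma kern_box_eq:
  fixes x :: "'a::euclidean_space"
  assumes [measurable]: "Q \<in> sets borel" and e: "\<epsilon> > 0"
  shows "(\<integral>y. indicator Q y * complex_of_real (kern \<epsilon> (y - x)) \<partial>lborel)
    = complex_of_real (sqrt (2 * pi) ^ DIM('a) * (\<integral>z. indicator Q (x + \<epsilon> *\<^sub>R z) * gauss z \<partial>lborel))"
proof -
  have m: "(\<lambda>y. indicator Q (x + y) * kern \<epsilon> y) \<in> borel_measurable borel" by measurable
  have "(\<integral>y. indicator Q y * complex_of_real (kern \<epsilon> (y - x)) \<partial>lborel)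
     = (\<integral>y. complex_of_real (indicator Q y * kern \<epsilon> (y - x)) \<partial>lborel)"
    by (intro Bochner_Integration.integral_cong) (auto simp: indicator_def)
  also have "\<dots> = complex_of_real (\<integral>y. indicator Q y * kern \<epsilon> (y - x) \<partial>lborel)"
    by (rule integral_complex_of_real)
  also have "(\<integral>y. indicator Q y * kern \<epsilon> (y - x) \<partial>lborel) = (\<integral>y. indicator Q (x + y) * kern \<epsilon> y \<partial>lborel)"
    using lborel_integral_translate(1)[of "\<lambda>y. indicator Q y * kern \<epsilon> (y - x)" x] by simp
  also have "\<dots> = \<bar>\<epsilon>\<bar> ^ DIM('a) *\<^sub>R (\<integral>z. indicator Q (x + \<epsilon> *\<^sub>R z) * kern \<epsilon> (\<epsilon> *\<^sub>R z) \<partial>lborel)"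
    using lborel_integral_scale[OF m, of \<epsilon>] e by simp
  also have "\<dots> = \<bar>\<epsilon>\<bar> ^ DIM('a) *\<^sub>R (\<integral>z. (sqrt (2 * pi) ^ DIM('a) / \<epsilon> ^ DIM('a)) * (indicator Q (x + \<epsilon> *\<^sub>R z) * gauss z) \<partial>lborel)"
    using e by (simp add: kern_def mult_ac)
  also have "\<dots> = sqrt (2 * pi) ^ DIM('a) * (\<integral>z. indicator Q (x + \<epsilon> *\<^sub>R z) * gauss z \<partial>lborel)"
    using e by (subst integral_mult_right_zero) simp
  finally show ?thesis .
qed

lemma kern_box_bound:
  fixes x :: "'a::euclidean_space"
  assumes [measurable]: "Q \<in> sets borel" and e: "\<epsilon> > 0"
  shows "norm (\<integral>y. indicator Q y * complex_of_real (kern \<epsilon> (y - x)) \<partial>lborel) \<le> (2 * pi) ^ DIM('a)"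
proof -
  have "(\<integral>z. indicator Q (x + \<epsilon> *\<^sub>R z) * gauss z \<partial>lborel) \<le> (\<integral>z. gauss (z::'a) \<partial>lborel)"
  proof (rule integral_mono')
    show "integrable lborel (gauss :: 'a \<Rightarrow> real)" by (rule gauss_integrable)
  qed (auto simp: indicator_def gauss_nonneg)
  moreover have "0 \<le> (\<integral>z. indicator Q (x + \<epsilon> *\<^sub>R z) * gauss z \<partial>lborel)"
    by (intro Bochner_Integration.integral_nonneg) (auto simp: gauss_nonneg)
  ultimately have "norm (\<integral>y. indicator Q y * complex_of_real (kern \<epsilon> (y - x)) \<partial>lborel)
     \<le> sqrt (2 * pi) ^ DIM('a) * sqrt (2 * pi) ^ DIM('a)"
    unfolding kern_box_eq[OF assms] norm_of_real gauss_integral by (simp add: abs_mult)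
  then show ?thesis unfolding power_mult_distrib[symmetric] by simp
qed

text \<open>Off the frontier the indicator is continuous at \<open>x\<close>, and dominated
  convergence with the Gaussian as majorant applies. Boxes are suitable test sets because their
  frontier is a null set.\<close>

lemma kern_box_tendsto:
  fixes x :: "'a::euclidean_space"
  assumes [measurable]: "Q \<in> sets borel" and x: "x \<notin> frontier Q"
  shows "(\<lambda>n. \<integral>y. indicator Q y * complex_of_real (kern (1 / real (Suc n)) (y - x)) \<partial>lborel)
     \<longlonglongrightarrow> complex_of_real ((2 * pi) ^ DIM('a)) * indicator Q x"
proof -
  have c: "isCont (indicator Q :: 'a \<Rightarrow> real) x" using x by (simp add: isCont_indicator)
  have "(\<lambda>n. \<integral>z. indicator Q (x + (1 / real (Suc n)) *\<^sub>R z) * gauss z \<partial>lborel) \<longlonglongrightarrow> (\<integral>z. indicator Q x * gauss (z::'a) \<partial>lborel)"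
  proof (rule integral_dominated_convergence[where w = gauss])
    show "integrable lborel (gauss :: 'a \<Rightarrow> real)" by (rule gauss_integrable)
    have "(\<lambda>n. x + (1 / real (Suc n)) *\<^sub>R z) \<longlonglongrightarrow> x + 0 *\<^sub>R z" for z
      by (intro tendsto_intros LIMSEQ_Suc lim_1_over_n)
    then have "(\<lambda>n. indicator Q (x + (1 / real (Suc n)) *\<^sub>R z) :: real) \<longlonglongrightarrow> indicator Q x" for z
      using isCont_tendsto_compose[OF c] by (metis add.right_neutral scale_zero_left)
    then show "AE z in lborel. (\<lambda>n. indicator Q (x + (1 / real (Suc n)) *\<^sub>R z) * gauss z) \<longlonglongrightarrow> indicator Q x * gauss z"
      by (auto intro!: tendsto_intros)
  qed (auto simp: indicator_def gauss_nonneg)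
  then have "(\<lambda>n. complex_of_real (sqrt (2 * pi) ^ DIM('a) * (\<integral>z. indicator Q (x + (1 / real (Suc n)) *\<^sub>R z) * gauss z \<partial>lborel)))
     \<longlonglongrightarrow> complex_of_real (sqrt (2 * pi) ^ DIM('a) * (\<integral>z. indicator Q x * gauss (z::'a) \<partial>lborel))"
    by (intro tendsto_intros)
  also have "complex_of_real (sqrt (2 * pi) ^ DIM('a) * (\<integral>z. indicator Q x * gauss (z::'a) \<partial>lborel))
     = complex_of_real ((2 * pi) ^ DIM('a)) * indicator Q x"
  proof -
    have "sqrt (2 * pi) ^ DIM('a) * sqrt (2 * pi) ^ DIM('a) = (2 * pi) ^ DIM('a)"
      unfolding power_mult_distrib[symmetric] by simp
    then show ?thesis by (auto simp: gauss_integral indicator_def simp flip: of_real_mult of_real_power)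
  qed
  finally show ?thesis by (subst kern_box_eq) (auto simp del: of_nat_Suc)
qed

text \<open>This is \<open>ft_pairing\<close> with \<epsilon> = 1/(n+1) and n tending to infinity.
  On the frequency side the product of the two transforms is a majorant, since \<open>bessel\<close>
  makes both square integrable.\<close>

lemma box_formula:
  fixes F :: "'a::euclidean_space \<Rightarrow> complex" and a b :: 'a
  defines "Q \<equiv> cbox a b"
  assumes F: "integrable lborel F" and F2: "L2sq lborel F < \<infinity>"
  shows "(\<integral>\<xi>. ft (- 1) F \<xi> * ft 1 (indicator Q) \<xi> \<partial>lborel)
     = complex_of_real ((2 * pi) ^ DIM('a)) * (\<integral>x. F x * indicator Q x \<partial>lborel)"
    and "square_integrable lborel (ft 1 (indicator Q :: 'a \<Rightarrow> complex))"
proof -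
  have [measurable]: "F \<in> borel_measurable borel" "Q \<in> sets borel" using F by (auto simp: Q_def)
  have fin: "emeasure lborel Q < \<infinity>" unfolding Q_def by (rule emeasure_lborel_cbox_finite)
  have G: "integrable lborel (indicator Q :: 'a \<Rightarrow> complex)"
  proof -
    have "integrable lborel (\<lambda>x. complex_of_real (indicator Q x))"
      using fin by (intro integrable_of_real integrable_real_indicator) auto
    moreover have "(\<lambda>x. complex_of_real (indicator Q x)) = indicator Q" by (auto simp: indicator_def)
    ultimately show ?thesis by simp
  qed
  have "L2sq lborel (indicator Q :: 'a \<Rightarrow> complex) = (\<integral>\<^sup>+x. indicator Q x \<partial>lborel)"
    unfolding L2sq_def by (intro nn_integral_cong) (auto simp: indicator_def)
  then have G2: "L2sq lborel (indicator Q :: 'a \<Rightarrow> complex) < \<infinity>" using fin by simp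
  show S: "square_integrable lborel (ft 1 (indicator Q :: 'a \<Rightarrow> complex))"
    using bessel[OF G, of 1] G2 unfolding square_integrable_iff_L2sq L2sq_def
    by (auto simp: ennreal_mult_less_top intro: le_less_trans)
  have SF: "square_integrable lborel (ft (- 1) F)"
    using bessel[OF F, of "- 1"] F2 unfolding square_integrable_iff_L2sq L2sq_def
    by (auto simp: ennreal_mult_less_top intro: le_less_trans)
  have prod: "integrable lborel (\<lambda>\<xi>. ft (- 1) F \<xi> * ft 1 (indicator Q) \<xi>)"
    by (rule square_integrable_mult[OF SF S])
  have lim1: "(\<lambda>n. \<integral>\<xi>. ft (- 1) F \<xi> * (ft 1 (indicator Q) \<xi> * complex_of_real (gauss ((1 / real (Suc n)) *\<^sub>R \<xi>))) \<partial>lborel)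
     \<longlonglongrightarrow> (\<integral>\<xi>. ft (- 1) F \<xi> * ft 1 (indicator Q) \<xi> \<partial>lborel)"
  proof (rule integral_dominated_convergence[where w = "\<lambda>\<xi>. norm (ft (- 1) F \<xi> * ft 1 (indicator Q) \<xi>)"])
    show "integrable lborel (\<lambda>\<xi>. norm (ft (- 1) F \<xi> * ft 1 (indicator Q) \<xi>))" using prod by simp
    have "(\<lambda>n. ft (- 1) F \<xi> * (ft 1 (indicator Q) \<xi> * complex_of_real (gauss ((1 / real (Suc n)) *\<^sub>R \<xi>))))
        \<longlonglongrightarrow> ft (- 1) F \<xi> * (ft 1 (indicator Q) \<xi> * complex_of_real (gauss (0 *\<^sub>R \<xi>)))" for \<xi>
      by (intro tendsto_intros continuous_on_tendsto_compose[OF gauss_continuous] LIMSEQ_Suc lim_1_over_n) auto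
    then show "AE \<xi> in lborel. (\<lambda>n. ft (- 1) F \<xi> * (ft 1 (indicator Q) \<xi> * complex_of_real (gauss ((1 / real (Suc n)) *\<^sub>R \<xi>))))
        \<longlonglongrightarrow> ft (- 1) F \<xi> * ft 1 (indicator Q) \<xi>"
      by (simp add: gauss_def[of 0])
    show "AE \<xi> in lborel. norm (ft (- 1) F \<xi> * (ft 1 (indicator Q) \<xi> * complex_of_real (gauss ((1 / real (Suc n)) *\<^sub>R \<xi>))))
       \<le> norm (ft (- 1) F \<xi> * ft 1 (indicator Q) \<xi>)" for n
      by (auto simp: norm_mult gauss_nonneg gauss_le_1 intro!: mult_left_mono mult_left_le)
  qed (measurable)
  \<comment> \<open>Convergence can fail only on the null frontier of the box, and
    \<open>kern_box_bound\<close> gives the majorant.\<close>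
  have lim2: "(\<lambda>n. \<integral>x. F x * (\<integral>y. indicator Q y * complex_of_real (kern (1 / real (Suc n)) (y - x)) \<partial>lborel) \<partial>lborel)
      \<longlonglongrightarrow> (\<integral>x. F x * (complex_of_real ((2 * pi) ^ DIM('a)) * indicator Q x) \<partial>lborel)"
  proof (rule integral_dominated_convergence[where w = "\<lambda>x. norm (F x) * (2 * pi) ^ DIM('a)"])
    show "integrable lborel (\<lambda>x. norm (F x) * (2 * pi) ^ DIM('a))" using F by simp
    have "frontier Q \<in> null_sets lborel"
      unfolding Q_def frontier_cbox by (rule null_sets_cbox_Diff_box)
    then have "AE x in lborel. x \<notin> frontier Q" by (rule AE_not_in)
    then show "AE x in lborel. (\<lambda>n. F x * (\<integral>y. indicator Q y * complex_of_real (kern (1 / real (Suc n)) (y - x)) \<partial>lborel))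
      \<longlonglongrightarrow> F x * (complex_of_real ((2 * pi) ^ DIM('a)) * indicator Q x)"
    proof eventually_elim
      case (elim x)
      show ?case by (intro tendsto_mult tendsto_const kern_box_tendsto elim) auto
    qed
    show "AE x in lborel. norm (F x * (\<integral>y. indicator Q y * complex_of_real (kern (1 / real (Suc n)) (y - x)) \<partial>lborel))
       \<le> norm (F x) * (2 * pi) ^ DIM('a)" for n
      unfolding norm_mult by (intro AE_I2 mult_left_mono kern_box_bound) auto
  qed (measurable)
  have "(\<integral>\<xi>. ft (- 1) F \<xi> * (ft 1 (indicator Q) \<xi> * complex_of_real (gauss ((1 / real (Suc n)) *\<^sub>R \<xi>))) \<partial>lborel)
     = (\<integral>x. F x * (\<integral>y. indicator Q y * complex_of_real (kern (1 / real (Suc n)) (y - x)) \<partial>lborel) \<partial>lborel)" for n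
    by (rule ft_pairing(2)[OF F G, of "1 / real (Suc n)" 1]) auto
  with lim1 have "(\<lambda>n. \<integral>x. F x * (\<integral>y. indicator Q y * complex_of_real (kern (1 / real (Suc n)) (y - x)) \<partial>lborel) \<partial>lborel)
     \<longlonglongrightarrow> (\<integral>\<xi>. ft (- 1) F \<xi> * ft 1 (indicator Q) \<xi> \<partial>lborel)" by simp
  from LIMSEQ_unique[OF this lim2] have "(\<integral>\<xi>. ft (- 1) F \<xi> * ft 1 (indicator Q) \<xi> \<partial>lborel)
     = (\<integral>x. F x * (complex_of_real ((2 * pi) ^ DIM('a)) * indicator Q x) \<partial>lborel)" .
  also have "\<dots> = (\<integral>x. complex_of_real ((2 * pi) ^ DIM('a)) * (F x * indicator Q x) \<partial>lborel)"
    by (intro Bochner_Integration.integral_cong refl mult.left_commute)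
  also have "\<dots> = complex_of_real ((2 * pi) ^ DIM('a)) * (\<integral>x. F x * indicator Q x \<partial>lborel)"
    by (rule integral_mult_right_zero)
  finally show "(\<integral>\<xi>. ft (- 1) F \<xi> * ft 1 (indicator Q) \<xi> \<partial>lborel)
     = complex_of_real ((2 * pi) ^ DIM('a)) * (\<integral>x. F x * indicator Q x \<partial>lborel)" .
qed

section \<open>Fourier inversion in $L^2$\<close>

lemma continuous_on_vec_nth_complex: "continuous_on UNIV (\<lambda>v::complex^'n. v $ k)"
  by (intro continuous_intros)

lemma borel_measurable_vec_nth_complex [measurable (raw)]:
  fixes f :: "'a \<Rightarrow> complex^'n"
  assumes "f \<in> borel_measurable M" shows "(\<lambda>x. f x $ k) \<in> borel_measurable M"
  using measurable_compose[OF assms borel_measurable_continuous_onI[OF continuous_on_vec_nth_complex]] .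

lemma norm_vector_smult: "norm (c *s (v::complex^'n)) = norm c * norm v"
  by (simp add: norm_vec_def L2_set_def norm_mult power_mult_distrib sum_distrib_left[symmetric] real_sqrt_mult)

lemma bounded_bilinear_smult: "bounded_bilinear ((*s) :: complex \<Rightarrow> complex^'n \<Rightarrow> complex^'n)"
proof
  show "\<exists>K. \<forall>a b. norm (a *s (b::complex^'n)) \<le> norm a * norm b * K"
    by (rule exI[of _ 1]) (simp add: norm_vector_smult)
qed (simp_all add: vec_eq_iff algebra_simps)

lemmas bounded_linear_smult_right = bounded_bilinear.bounded_linear_right[OF bounded_bilinear_smult]

lemma borel_measurable_smult [measurable (raw)]:
  fixes g :: "'a \<Rightarrow> complex^'n"
  assumes "f \<in> borel_measurable M" "g \<in> borel_measurable M"
  shows "(\<lambda>x. f x *s g x) \<in> borel_measurable M"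
  using assms
  by (rule borel_measurable_continuous_Pair)
     (intro bounded_bilinear.continuous_on[OF bounded_bilinear_smult] continuous_intros)

lemma norm_vec_sq: "(norm (v::complex^'n))\<^sup>2 = (\<Sum>k\<in>UNIV. (norm (v $ k))\<^sup>2)"
  by (simp add: norm_vec_def L2_set_def sum_nonneg)

lemma integrable_vec_nth: "integrable M f \<Longrightarrow> integrable M (\<lambda>x. (f x :: complex^'n) $ k)"
  by (rule integrable_bounded_linear[OF bounded_linear_vec_nth])

lemma integral_vec_nth:
  "integrable M f \<Longrightarrow> (\<integral>x. (f x :: complex^'n) \<partial>M) $ k = (\<integral>x. f x $ k \<partial>M)"
  by (rule integral_bounded_linear[OF bounded_linear_vec_nth, symmetric])

lemma L2sq_vec:
  fixes f :: "'a \<Rightarrow> complex^'n"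
  assumes [measurable]: "f \<in> borel_measurable M"
  shows "L2sq M f = (\<Sum>k\<in>UNIV. L2sq M (\<lambda>x. f x $ k))"
  unfolding L2sq_def norm_vec_sq by (subst nn_integral_sum[symmetric]) (auto simp: sum_ennreal)

lemma L2sq_component_le:
  fixes f :: "'a \<Rightarrow> complex^'n"
  shows "L2sq M (\<lambda>x. f x $ k) \<le> L2sq M f"
  unfolding L2sq_def by (intro nn_integral_mono ennreal_leI power_mono Finite_Cartesian_Product.norm_nth_le) auto

lemma square_integrable_component:
  fixes f :: "'a \<Rightarrow> complex^'n"
  assumes "square_integrable M f" shows "square_integrable M (\<lambda>x. f x $ k)"
  using assms le_less_trans[OF L2sq_component_le] unfolding square_integrable_iff_L2sq by auto

text \<open>Componentwise this is \<open>ft\<close>: \<open>s = - 1\<close> gives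
  \<open>fourier_integral\<close>, and \<open>s = 1\<close> rebuilds a function from its
  transform.\<close>

definition osc :: "real \<Rightarrow> ('a::euclidean_space \<Rightarrow> complex^'n) \<Rightarrow> 'a \<Rightarrow> complex^'n" where
  "osc s f x = (\<integral>\<xi>. cis (s * (x \<bullet> \<xi>)) *s f \<xi> \<partial>lborel)"

lemma fourier_integral_osc: "fourier_integral f = osc (- 1) f"
  by (rule ext) (simp add: fourier_integral_def osc_def inner_commute)

lemma integrable_cis_smult:
  fixes f :: "'a::euclidean_space \<Rightarrow> complex^'n"
  assumes "integrable lborel f" and [measurable]: "g \<in> borel_measurable borel"
  shows "integrable lborel (\<lambda>\<xi>. cis (g \<xi>) *s f \<xi>)"
  using assms(1) by (rule Bochner_Integration.integrable_bound) (use assms(1) in \<open>auto simp: norm_vector_smult\<close>)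

lemma osc_component:
  fixes f :: "'a::euclidean_space \<Rightarrow> complex^'n"
  assumes "integrable lborel f"
  shows "osc s f x $ k = ft s (\<lambda>\<xi>. f \<xi> $ k) x"
  unfolding osc_def ft_def
  by (subst integral_vec_nth) (auto intro: integrable_cis_smult assms simp: inner_commute)

lemma osc_measurable [measurable]:
  fixes f :: "'a::euclidean_space \<Rightarrow> complex^'n"
  assumes [measurable]: "f \<in> borel_measurable borel" shows "osc s f \<in> borel_measurable borel"
  unfolding osc_def by measurable

lemma osc_bessel:
  fixes f :: "'a::euclidean_space \<Rightarrow> complex^'n"
  assumes f: "integrable lborel f" and s: "s \<in> {1, - 1}"
  shows "L2sq lborel (osc s f) \<le> ennreal ((2 * pi) ^ DIM('a)) * L2sq lborel f"
proof -
  have [measurable]: "f \<in> borel_measurable borel" using f by auto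
  have "L2sq lborel (osc s f) = (\<Sum>k\<in>UNIV. L2sq lborel (ft s (\<lambda>\<xi>. f \<xi> $ k)))"
    by (subst L2sq_vec) (simp_all add: osc_component[OF f] eta_contract_eq)
  also have "\<dots> \<le> (\<Sum>k\<in>UNIV. ennreal ((2 * pi) ^ DIM('a)) * L2sq lborel (\<lambda>\<xi>. f \<xi> $ k))"
    unfolding L2sq_def by (intro sum_mono bessel[OF _ s] integrable_vec_nth f)
  also have "\<dots> = ennreal ((2 * pi) ^ DIM('a)) * L2sq lborel f"
  proof -
    have "L2sq lborel f = (\<Sum>k\<in>UNIV. L2sq lborel (\<lambda>\<xi>. f \<xi> $ k))" by (rule L2sq_vec) measurable
    then show ?thesis by (simp only: sum_distrib_left)
  qed
  finally show ?thesis .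
qed

lemma osc_diff:
  fixes f g :: "'a::euclidean_space \<Rightarrow> complex^'n"
  assumes "integrable lborel f" "integrable lborel g"
  shows "osc s (\<lambda>\<xi>. f \<xi> - g \<xi>) x = osc s f x - osc s g x"
  unfolding osc_def
  by (subst Bochner_Integration.integral_diff[symmetric])
     (auto intro!: integrable_cis_smult assms Bochner_Integration.integral_cong simp: bounded_bilinear.diff_right[OF bounded_bilinear_smult])

lemma converges_L2_L2sq:
  assumes "converges_L2 M F f" shows "(\<lambda>n. L2sq M (\<lambda>x. F n x - f x)) \<longlonglongrightarrow> 0"
proof -
  have "L2sq M (\<lambda>x. F n x - f x) = ennreal ((L2_norm M (\<lambda>x. F n x - f x))\<^sup>2)" for n
    using assms by (intro square_integrable_L2sq) (simp add: converges_L2_def)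
  moreover have "(\<lambda>n. ennreal ((L2_norm M (\<lambda>x. F n x - f x))\<^sup>2)) \<longlonglongrightarrow> ennreal (0\<^sup>2)"
    using assms unfolding converges_L2_def by (intro tendsto_ennrealI tendsto_intros) auto
  ultimately show ?thesis by simp
qed

lemma ennreal_tendsto_cmult0:
  assumes "(f \<longlongrightarrow> (0::ennreal)) F" "c < top" shows "((\<lambda>x. c * f x) \<longlongrightarrow> 0) F"
  using ennreal_tendsto_cmult[OF assms(2,1)] by simp

text \<open>The Bessel bound survives L2 limits; each of the two uses of \<open>L2sq_add_le\<close>
  contributes a factor 2, hence the 4. The hypotheses speak of approximating sequences instead of
  \<open>has_fourier_L2\<close>, so that the lemma also applies to differences of such
  sequences.\<close>

lemma fourier_limit_bound:
  fixes A :: "nat \<Rightarrow> real^3 \<Rightarrow> complex^4"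
  assumes A: "\<And>n. integrable lborel (A n)"
    and [measurable]: "f \<in> borel_measurable borel" "fh \<in> borel_measurable borel"
    and l1: "(\<lambda>n. L2sq lborel (\<lambda>x. A n x - f x)) \<longlonglongrightarrow> 0"
    and l2: "(\<lambda>n. L2sq lborel (\<lambda>x. osc (- 1) (A n) x - fh x)) \<longlonglongrightarrow> 0"
  shows "L2sq lborel fh \<le> ennreal (4 * (2 * pi) ^ 3) * L2sq lborel f"
proof -
  have [measurable]: "A n \<in> borel_measurable borel" for n using A by auto
  let ?K = "ennreal ((2 * pi) ^ 3)"
  have bound: "L2sq lborel fh \<le> 2 * (L2sq lborel (\<lambda>x. osc (- 1) (A n) x - fh x) + ?K * (2 * (L2sq lborel (\<lambda>x. A n x - f x) + L2sq lborel f)))" for n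
  proof -
    have 1: "L2sq lborel (A n) \<le> 2 * (L2sq lborel (\<lambda>x. A n x - f x) + L2sq lborel f)"
      using L2sq_add_le[of "\<lambda>x. A n x - f x" lborel f] by simp
    have "L2sq lborel (osc (- 1) (A n)) \<le> ?K * L2sq lborel (A n)"
      using osc_bessel[OF A, of "- 1" n] by simp
    also have "\<dots> \<le> ?K * (2 * (L2sq lborel (\<lambda>x. A n x - f x) + L2sq lborel f))"
      by (rule mult_left_mono[OF 1]) simp
    finally have 2: "L2sq lborel (osc (- 1) (A n)) \<le> ?K * (2 * (L2sq lborel (\<lambda>x. A n x - f x) + L2sq lborel f))" .
    have "L2sq lborel fh \<le> 2 * (L2sq lborel (\<lambda>x. fh x - osc (- 1) (A n) x) + L2sq lborel (osc (- 1) (A n)))"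
      using L2sq_add_le[of "\<lambda>x. fh x - osc (- 1) (A n) x" lborel "osc (- 1) (A n)"] by simp
    also have "L2sq lborel (\<lambda>x. fh x - osc (- 1) (A n) x) = L2sq lborel (\<lambda>x. osc (- 1) (A n) x - fh x)"
      by (rule L2sq_minus_commute)
    also have "2 * (L2sq lborel (\<lambda>x. osc (- 1) (A n) x - fh x) + L2sq lborel (osc (- 1) (A n)))
        \<le> 2 * (L2sq lborel (\<lambda>x. osc (- 1) (A n) x - fh x) + ?K * (2 * (L2sq lborel (\<lambda>x. A n x - f x) + L2sq lborel f)))"
      by (intro mult_left_mono add_left_mono 2) simp
    finally show ?thesis .
  qed
  have "(\<lambda>n. 2 * (L2sq lborel (\<lambda>x. osc (- 1) (A n) x - fh x) + ?K * (2 * (L2sq lborel (\<lambda>x. A n x - f x) + L2sq lborel f))))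
     \<longlonglongrightarrow> 2 * (0 + ?K * (2 * (0 + L2sq lborel f)))"
    by (intro ennreal_tendsto_cmult tendsto_add l1 l2 tendsto_const) auto
  then have "L2sq lborel fh \<le> 2 * (0 + ?K * (2 * (0 + L2sq lborel f)))"
    by (rule LIMSEQ_le_const) (use bound in auto)
  also have "\<dots> = ennreal (4 * (2 * pi) ^ 3) * L2sq lborel f"
  proof -
    have *: "ennreal (4 * (2 * pi) ^ 3) = 2 * 2 * ?K"
      by (subst ennreal_mult) (auto simp del: ennreal_mult)
    show ?thesis unfolding * by (simp only: add_0 mult_ac)
  qed
  finally show ?thesis .
qed

lemma has_fourier_L2_bound:
  assumes "has_fourier_L2 f fh"
  shows "L2sq lborel fh \<le> ennreal (4 * (2 * pi) ^ 3) * L2sq lborel f"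
proof -
  obtain A where A: "\<And>n. integrable lborel (A n)" and c: "converges_L2 lborel A f"
      "converges_L2 lborel (\<lambda>n. fourier_integral (A n)) fh"
    and [measurable]: "f \<in> borel_measurable borel" "fh \<in> borel_measurable borel"
    using assms unfolding has_fourier_L2_def square_integrable_def by auto
  show ?thesis
    by (rule fourier_limit_bound[OF A]) (use c[THEN converges_L2_L2sq] in \<open>simp_all add: fourier_integral_osc\<close>)
qed

text \<open>The difference of two approximating sequences tends to 0 while its transforms tend to
  \<open>a - b\<close>, so \<open>fourier_limit_bound\<close> with limit function 0 forces
  \<open>a - b\<close> to vanish almost everywhere.\<close>

lemma has_fourier_L2_unique:
  assumes "has_fourier_L2 f a" "has_fourier_L2 f b"
  shows "AE \<xi> in lborel. a \<xi> = b \<xi>"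
proof -
  obtain A where A: "\<And>n. integrable lborel (A n)" and cA: "converges_L2 lborel A f"
      "converges_L2 lborel (\<lambda>n. fourier_integral (A n)) a"
    and [measurable]: "f \<in> borel_measurable borel" "a \<in> borel_measurable borel"
    using assms unfolding has_fourier_L2_def square_integrable_def by auto
  obtain B where B: "\<And>n. integrable lborel (B n)" and cB: "converges_L2 lborel B f"
      "converges_L2 lborel (\<lambda>n. fourier_integral (B n)) b"
    and [measurable]: "b \<in> borel_measurable borel"
    using assms unfolding has_fourier_L2_def square_integrable_def by auto
  have [measurable]: "A n \<in> borel_measurable borel" "B n \<in> borel_measurable borel" for n using A B by auto
  have sub: "(\<lambda>n. L2sq lborel (\<lambda>x. (P n x - Q n x) - (p x - q x))) \<longlonglongrightarrow> 0"
    if "(\<lambda>n. L2sq lborel (\<lambda>x. P n x - p x)) \<longlonglongrightarrow> 0" "(\<lambda>n. L2sq lborel (\<lambda>x. Q n x - q x)) \<longlonglongrightarrow> 0"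
      and [measurable]: "\<And>n. P n \<in> borel_measurable borel" "\<And>n. Q n \<in> borel_measurable borel"
       "p \<in> borel_measurable borel" "q \<in> borel_measurable borel"
    for P Q :: "nat \<Rightarrow> real^3 \<Rightarrow> complex^4" and p q
  proof (rule tendsto_sandwich[OF _ _ tendsto_const])
    show "(\<lambda>n. 2 * (L2sq lborel (\<lambda>x. P n x - p x) + L2sq lborel (\<lambda>x. Q n x - q x))) \<longlonglongrightarrow> 0"
      using ennreal_tendsto_cmult0[OF tendsto_add[OF that(1,2), simplified], of 2] by simp
    have "L2sq lborel (\<lambda>x. (P n x - Q n x) - (p x - q x)) \<le> 2 * (L2sq lborel (\<lambda>x. P n x - p x) + L2sq lborel (\<lambda>x. Q n x - q x))" for n
    proof -
      have "L2sq lborel (\<lambda>x. (P n x - Q n x) - (p x - q x)) = L2sq lborel (\<lambda>x. (P n x - p x) + (q x - Q n x))"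
        by (simp add: algebra_simps)
      also have "\<dots> \<le> 2 * (L2sq lborel (\<lambda>x. P n x - p x) + L2sq lborel (\<lambda>x. q x - Q n x))"
        by (rule L2sq_add_le) measurable
      also have "L2sq lborel (\<lambda>x. q x - Q n x) = L2sq lborel (\<lambda>x. Q n x - q x)" by (rule L2sq_minus_commute)
      finally show ?thesis .
    qed
    then show "\<forall>\<^sub>F n in sequentially. L2sq lborel (\<lambda>x. (P n x - Q n x) - (p x - q x)) \<le> 2 * (L2sq lborel (\<lambda>x. P n x - p x) + L2sq lborel (\<lambda>x. Q n x - q x))"
      by (intro always_eventually allI)
  qed simp
  have "L2sq lborel (\<lambda>\<xi>. a \<xi> - b \<xi>) \<le> ennreal (4 * (2 * pi) ^ 3) * L2sq lborel (\<lambda>x::real^3. 0 :: complex^4)"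
  proof (rule fourier_limit_bound[where A = "\<lambda>n x. A n x - B n x"])
    show "(\<lambda>n. L2sq lborel (\<lambda>x. A n x - B n x - 0)) \<longlonglongrightarrow> 0"
      using sub[of A f B f] cA(1) cB(1) by (simp add: converges_L2_L2sq)
    show "(\<lambda>n. L2sq lborel (\<lambda>x. osc (- 1) (\<lambda>x. A n x - B n x) x - (a x - b x))) \<longlonglongrightarrow> 0"
      using sub[of "\<lambda>n. osc (- 1) (A n)" a "\<lambda>n. osc (- 1) (B n)" b] cA(2)[THEN converges_L2_L2sq] cB(2)[THEN converges_L2_L2sq]
      by (simp add: osc_diff[OF A B] fourier_integral_osc)
  qed (use A B in auto)
  then have "L2sq lborel (\<lambda>\<xi>. a \<xi> - b \<xi>) = 0" by (simp add: L2sq_def)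
  then show ?thesis unfolding L2sq_def by (subst (asm) nn_integral_0_iff_AE) auto
qed

text \<open>Lebesgue differentiation: outside a null set \<open>w x\<close> is the limit of averages
  over cubes with lower corner \<open>x\<close>, and these averages are all 0.\<close>

lemma AE_zero_of_cbox_integrals:
  fixes w :: "'a::euclidean_space \<Rightarrow> complex"
  assumes w: "\<And>a b. integrable lborel (\<lambda>x. w x * indicator (cbox a b) x)"
    and z: "\<And>a b. (\<integral>x. w x * indicator (cbox a b) x \<partial>lborel) = 0"
    and [measurable]: "w \<in> borel_measurable borel"
  shows "AE x in lborel. w x = 0"
proof -
  have eq: "(\<lambda>x. w x * indicator (cbox a b) x) = (\<lambda>x. if x \<in> cbox a b then w x else 0)" for a b
    by (auto simp: indicator_def)
  have "((\<lambda>x. if x \<in> cbox a b then w x else 0) has_integral 0) UNIV" for a b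
    using has_integral_integral_lborel[OF w[of a b]] z[of a b] unfolding eq by simp
  then have hi: "(w has_integral 0) (cbox a b)" for a b by (simp add: has_integral_restrict_UNIV)
  obtain N where N: "negligible N"
    and d: "\<And>x e. \<lbrakk>x \<notin> N; 0 < e\<rbrakk> \<Longrightarrow> \<exists>d>0. \<forall>h. 0 < h \<and> h < d \<longrightarrow>
         norm (integral (cbox x (x + h *\<^sub>R One)) w /\<^sub>R h ^ DIM('a) - w x) < e"
    using integrable_ccontinuous_explicit[of w] hi by blast
  have "w x = 0" if "x \<notin> N" for x
  proof (rule ccontr)
    assume "w x \<noteq> 0"
    with d[OF that, of "norm (w x)"] obtain d where "d > 0"
      and *: "\<And>h. 0 < h \<Longrightarrow> h < d \<Longrightarrow> norm (integral (cbox x (x + h *\<^sub>R One)) w /\<^sub>R h ^ DIM('a) - w x) < norm (w x)"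
      by auto
    have "integral (cbox x (x + (d/2) *\<^sub>R One)) w = 0" using hi by (rule integral_unique)
    with *[of "d/2"] \<open>d > 0\<close> show False by simp
  qed
  then have sub: "{x. w x \<noteq> 0} \<subseteq> N" by auto
  have "negligible {x. w x \<noteq> 0}" by (rule negligible_subset[OF N sub])
  then have "{x. w x \<noteq> 0} \<in> null_sets lborel"
    by (auto simp: negligible_iff_null_sets null_sets_completion_iff)
  then show ?thesis by (auto simp: AE_iff_null_sets dest!: AE_not_in)
qed

text \<open>Each component of the difference of the two sides is tested against boxes.
  \<open>box_formula\<close> holds for the integrable approximants and passes to the limit because
  both pairings are continuous in L2; \<open>AE_zero_of_cbox_integrals\<close> concludes.\<close>

theorem has_fourier_L2_inversion:
  assumes h: "has_fourier_L2 u uh" and uh: "integrable lborel uh"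
  shows "AE x in lborel. u x = (1 / (2 * pi) ^ 3) *\<^sub>R osc 1 uh x"
proof -
  obtain A where A: "\<And>n. integrable lborel (A n)" "\<And>n. square_integrable lborel (A n)" and cA: "converges_L2 lborel A u"
      "converges_L2 lborel (\<lambda>n. fourier_integral (A n)) uh"
    and u: "square_integrable lborel u" and uh2: "square_integrable lborel uh"
    using h unfolding has_fourier_L2_def by auto
  have [measurable]: "u \<in> borel_measurable borel" "uh \<in> borel_measurable borel"
    using u uh2 by (auto simp: square_integrable_def)
  have "AE x in lborel. u x $ k - complex_of_real (1 / (2 * pi) ^ 3) * ft 1 (\<lambda>\<xi>. uh \<xi> $ k) x = 0" for k
  proof (rule AE_zero_of_cbox_integrals)
    fix a b :: "real^3"
    let ?i = "indicator (cbox a b) :: real^3 \<Rightarrow> complex"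
    have fin: "emeasure lborel (cbox a b) < \<infinity>" by (rule emeasure_lborel_cbox_finite)
    have i1: "integrable lborel ?i"
    proof -
      have "integrable lborel (\<lambda>x. complex_of_real (indicator (cbox a b) x))"
        using fin by (intro integrable_of_real integrable_real_indicator) auto
      moreover have "(\<lambda>x. complex_of_real (indicator (cbox a b) x)) = ?i" by (auto simp: indicator_def)
      ultimately show ?thesis by simp
    qed
    have "L2sq lborel ?i = (\<integral>\<^sup>+x. indicator (cbox a b) x \<partial>lborel)"
      unfolding L2sq_def by (intro nn_integral_cong) (auto simp: indicator_def)
    then have i2: "square_integrable lborel ?i" using fin by (simp add: square_integrable_iff_L2sq)
    have comp: "square_integrable lborel (\<lambda>x. P x $ k - p x $ k)" "L2sq lborel (\<lambda>x. P x $ k - p x $ k) \<le> L2sq lborel (\<lambda>x. P x - p x)"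
      if "square_integrable lborel (\<lambda>x. P x - p x)" for P p :: "real^3 \<Rightarrow> complex^4"
      using square_integrable_component[OF that, of k] L2sq_component_le[of lborel "\<lambda>x. P x - p x" k] by auto
    have lim: "(\<lambda>n. L2sq lborel (\<lambda>x. P n x $ k - p x $ k)) \<longlonglongrightarrow> 0" if "converges_L2 lborel P p"
      for P :: "nat \<Rightarrow> real^3 \<Rightarrow> complex^4" and p
      by (rule tendsto_sandwich[OF _ _ tendsto_const converges_L2_L2sq[OF that]])
         (use that comp(2) in \<open>auto simp: converges_L2_def\<close>)
    have l1: "(\<lambda>n. \<integral>x. A n x $ k * ?i x \<partial>lborel) \<longlonglongrightarrow> (\<integral>x. u x $ k * ?i x \<partial>lborel)"
      by (rule L2_pairing_tendsto[OF square_integrable_component[OF u] i2 comp(1) lim[OF cA(1)]])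
         (use cA in \<open>auto simp: converges_L2_def\<close>)
    have "(\<lambda>n. \<integral>x. fourier_integral (A n) x $ k * ft 1 ?i x \<partial>lborel) \<longlonglongrightarrow> (\<integral>x. uh x $ k * ft 1 ?i x \<partial>lborel)"
      by (rule L2_pairing_tendsto[OF square_integrable_component[OF uh2] box_formula(2)[OF i1 ] comp(1) lim[OF cA(2)]])
         (use cA i2 in \<open>auto simp: converges_L2_def square_integrable_iff_L2sq\<close>)
    moreover have "(\<integral>x. fourier_integral (A n) x $ k * ft 1 ?i x \<partial>lborel)
       = complex_of_real ((2 * pi) ^ 3) * (\<integral>x. A n x $ k * ?i x \<partial>lborel)" for n
    proof -
      have "L2sq lborel (\<lambda>x. A n x $ k) < \<infinity>"
        using square_integrable_component[OF A(2)] by (auto simp: square_integrable_iff_L2sq)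
      from box_formula(1)[OF integrable_vec_nth[OF A(1)] this, of a b] show ?thesis
        by (simp add: fourier_integral_osc osc_component[OF A(1)])
    qed
    ultimately have "(\<lambda>n. complex_of_real ((2 * pi) ^ 3) * (\<integral>x. A n x $ k * ?i x \<partial>lborel)) \<longlonglongrightarrow> (\<integral>x. uh x $ k * ft 1 ?i x \<partial>lborel)"
      by simp
    moreover have "(\<lambda>n. complex_of_real ((2 * pi) ^ 3) * (\<integral>x. A n x $ k * ?i x \<partial>lborel))
      \<longlonglongrightarrow> complex_of_real ((2 * pi) ^ 3) * (\<integral>x. u x $ k * ?i x \<partial>lborel)"
      by (intro tendsto_intros l1)
    ultimately have e1: "complex_of_real ((2 * pi) ^ 3) * (\<integral>x. u x $ k * ?i x \<partial>lborel) = (\<integral>x. uh x $ k * ft 1 ?i x \<partial>lborel)"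
      using LIMSEQ_unique by blast
    \<comment> \<open>The transform moves from the box to \<open>uh\<close>; this is where
      integrability of \<open>uh\<close> enters.\<close>
    also have "\<dots> = (\<integral>x. ft 1 (\<lambda>\<xi>. uh \<xi> $ k) x * ?i x \<partial>lborel)"
      by (rule ft_mult[OF integrable_vec_nth[OF uh] i1, symmetric])
    finally have e: "(\<integral>x. u x $ k * ?i x \<partial>lborel)
       = complex_of_real (1 / (2 * pi) ^ 3) * (\<integral>x. ft 1 (\<lambda>\<xi>. uh \<xi> $ k) x * ?i x \<partial>lborel)"
      by (simp add: field_simps)
    have I1: "integrable lborel (\<lambda>x. u x $ k * ?i x)"
      by (rule square_integrable_mult[OF square_integrable_component[OF u] i2])
    have I2: "integrable lborel (\<lambda>x. ft 1 (\<lambda>\<xi>. uh \<xi> $ k) x * ?i x)"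
      by (rule integrable_mult_bounded[OF i1 _ ft_bound]) measurable
    then have I3: "integrable lborel (\<lambda>x. complex_of_real (1 / (2 * pi) ^ 3) * (ft 1 (\<lambda>\<xi>. uh \<xi> $ k) x * ?i x))"
      by (rule integrable_mult_right)
    have d: "(u x $ k - complex_of_real (1 / (2 * pi) ^ 3) * ft 1 (\<lambda>\<xi>. uh \<xi> $ k) x) * ?i x
      = u x $ k * ?i x - complex_of_real (1 / (2 * pi) ^ 3) * (ft 1 (\<lambda>\<xi>. uh \<xi> $ k) x * ?i x)" for x
      by (simp add: algebra_simps)
    show "integrable lborel (\<lambda>x. (u x $ k - complex_of_real (1 / (2 * pi) ^ 3) * ft 1 (\<lambda>\<xi>. uh \<xi> $ k) x) * ?i x)"
      unfolding d by (rule Bochner_Integration.integrable_diff[OF I1 I3])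
    show "(\<integral>x. (u x $ k - complex_of_real (1 / (2 * pi) ^ 3) * ft 1 (\<lambda>\<xi>. uh \<xi> $ k) x) * ?i x \<partial>lborel) = 0"
      unfolding d Bochner_Integration.integral_diff[OF I1 I3] e integral_mult_right_zero by simp
  qed measurable
  moreover have "((1 / (2 * pi) ^ 3) *\<^sub>R osc 1 uh x) $ k = complex_of_real (1 / (2 * pi) ^ 3) * ft 1 (\<lambda>\<xi>. uh \<xi> $ k) x" for x k
    by (simp only: vector_scaleR_component osc_component[OF uh] scaleR_conv_of_real[where 'a = complex])
  ultimately have "AE x in lborel. \<forall>k. u x $ k = ((1 / (2 * pi) ^ 3) *\<^sub>R osc 1 uh x) $ k"
    unfolding AE_all_countable by simp
  then show ?thesis by (simp add: vec_eq_iff)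
qed

section \<open>Algebra of the Dirac symbol\<close>

lemma vector_4' [simp]:
  "(vector [x, y, z, w] :: 'a::zero^4) $ 1 = x"
  "(vector [x, y, z, w] :: 'a::zero^4) $ 2 = y"
  "(vector [x, y, z, w] :: 'a::zero^4) $ 3 = z"
  "(vector [x, y, z, w] :: 'a::zero^4) $ 4 = w"
  unfolding vector_def by simp_all

lemmas scaleR_conv_complex = scaleR_conv_of_real[where 'a = complex]

lemma matrix_vector_scaleR: "(A::complex^4^4) *v (c *\<^sub>R v) = c *\<^sub>R (A *v v)"
  "(c *\<^sub>R (A::complex^4^4)) *v v = c *\<^sub>R (A *v v)"
  by (simp_all add: vec_eq_iff matrix_vector_mult_def scaleR_sum_right)

text \<open>From here on the symbol is an operator on vectors: \<open>dsym 0 \<xi>\<close> is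
  \<alpha>\<cdot>\<xi> and \<open>dsym 1 0\<close> is \<beta>.\<close>

definition dsym :: "real \<Rightarrow> real^3 \<Rightarrow> complex^4 \<Rightarrow> complex^4" where
  "dsym m \<xi> v = dirac_symbol m \<xi> *v v"

lemma dirac_alpha_entries:
  "dirac_alpha j = block_matrix 0 (pauli j) (pauli j) 0"
  unfolding dirac_alpha_def gamma0_def gamma_space_def block_matrix_def matrix_matrix_mult_def vec_eq_iff
  by (simp add: forall_4 sum_4 mat_def)

lemma dsym_components:
  "dsym m \<xi> v $ 1 = m * v $ 1 + \<xi> $ 3 * v $ 3 + (\<xi> $ 1 - \<i> * \<xi> $ 2) * v $ 4"
  "dsym m \<xi> v $ 2 = m * v $ 2 + (\<xi> $ 1 + \<i> * \<xi> $ 2) * v $ 3 - \<xi> $ 3 * v $ 4"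
  "dsym m \<xi> v $ 3 = \<xi> $ 3 * v $ 1 + (\<xi> $ 1 - \<i> * \<xi> $ 2) * v $ 2 - m * v $ 3"
  "dsym m \<xi> v $ 4 = (\<xi> $ 1 + \<i> * \<xi> $ 2) * v $ 1 - \<xi> $ 3 * v $ 2 - m * v $ 4"
  unfolding dsym_def dirac_symbol_def alpha_dot_def sum_3 dirac_alpha_entries dirac_beta_def gamma0_def
    block_matrix_def pauli_def matrix_vector_mult_def
  by (simp_all add: sum_4 mat_def scaleR_conv_complex algebra_simps vector_scaleR_component[where 'a = complex])

lemma dsym_linear: "linear (dsym m \<xi>)"
  unfolding dsym_def by (intro linearI) (simp_all add: matrix_vector_right_distrib matrix_vector_scaleR)

lemma dsym_add: "dsym m \<xi> (v + w) = dsym m \<xi> v + dsym m \<xi> w"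
  and dsym_diff: "dsym m \<xi> (v - w) = dsym m \<xi> v - dsym m \<xi> w"
  and dsym_scaleR: "dsym m \<xi> (c *\<^sub>R v) = c *\<^sub>R dsym m \<xi> v"
  and dsym_zero [simp]: "dsym m \<xi> 0 = 0"
  using dsym_linear[of m \<xi>] by (auto simp: linear_add linear_diff linear_scale linear_neg linear_0)

lemma dsym_smult: "dsym m \<xi> (c *s v) = c *s dsym m \<xi> v"
  by (simp add: vec_eq_iff forall_4 dsym_components algebra_simps)

lemma dsym_symbol_add: "dsym (m + m') (\<xi> + \<xi>') v = dsym m \<xi> v + dsym m' \<xi>' v"
  and dsym_symbol_scale: "dsym (c * m) (c *\<^sub>R \<xi>) v = c *\<^sub>R dsym m \<xi> v"
  by (simp_all add: vec_eq_iff forall_4 dsym_components algebra_simps scaleR_conv_complex)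

lemma dsym_split: "dsym m \<xi> v = dsym 0 \<xi> v + m *\<^sub>R dsym 1 0 v"
  using dsym_symbol_add[of 0 m \<xi> 0 v] dsym_symbol_scale[of m 1 0 v] by simp

lemma dsym0_scale: "dsym 0 (c *\<^sub>R \<xi>) v = c *\<^sub>R dsym 0 \<xi> v"
  using dsym_symbol_scale[of c 0 \<xi> v] by simp

lemma dsym0_uminus: "dsym 0 (- \<xi>) v = - dsym 0 \<xi> v"
  using dsym0_scale[of "-1" \<xi> v] by simp

lemma norm_sq_3: "(norm (\<xi>::real^3))\<^sup>2 = (\<xi> $ 1)\<^sup>2 + (\<xi> $ 2)\<^sup>2 + (\<xi> $ 3)\<^sup>2"
  by (simp add: norm_vec_def L2_set_def sum_nonneg sum_3)

lemma complex_i_square: "\<i> * (\<i> * z) = - z"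
  by (metis mult.assoc i_squared mult_minus1)

text \<open>The Clifford relations: the four Dirac matrices square to the identity and anticommute,
  so the mixed terms cancel. The explicit components make this a computation.\<close>

lemma dsym_dsym: "dsym m \<xi> (dsym m \<xi> v) = (m\<^sup>2 + (norm \<xi>)\<^sup>2) *\<^sub>R v"
  unfolding norm_sq_3
  by (simp add: vec_eq_iff forall_4 dsym_components scaleR_conv_complex algebra_simps power2_eq_square complex_i_square)

lemma inner_complex4: "inner (v::complex^4) w = Re (herm v w)"
  unfolding inner_vec_def herm_def by (simp add: inner_complex_def)

lemma herm_dsym: "herm (dsym m \<xi> v) w = herm v (dsym m \<xi> w)"
  by (simp add: herm_def sum_4 dsym_components algebra_simps)

lemma herm_smult_right: "herm v (c *s w) = c * herm v w"
  and herm_smult_left: "herm (c *s v) w = cnj c * herm v w"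
  and herm_add_left: "herm (v + v') w = herm v w + herm v' w"
  and herm_scaleR_right: "herm v (r *\<^sub>R w) = r *\<^sub>R herm v w"
  and herm_scaleR_left: "herm (r *\<^sub>R v) w = r *\<^sub>R herm v w"
  and herm_commute: "herm w v = cnj (herm v w)"
  by (simp_all add: herm_def sum_4 algebra_simps scaleR_conv_complex)

lemma inner_dsym: "inner (dsym m \<xi> v) w = inner v (dsym m \<xi> w)"
  by (simp add: inner_complex4 herm_dsym)

lemma norm_dsym: "norm (dsym m \<xi> v) = sqrt (m\<^sup>2 + (norm \<xi>)\<^sup>2) * norm v"
proof -
  have "(norm (dsym m \<xi> v))\<^sup>2 = (m\<^sup>2 + (norm \<xi>)\<^sup>2) * (norm v)\<^sup>2"
    unfolding power2_norm_eq_inner inner_dsym dsym_dsym by simp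
  then have "norm (dsym m \<xi> v) = sqrt ((m\<^sup>2 + (norm \<xi>)\<^sup>2) * (norm v)\<^sup>2)"
    by (metis norm_ge_zero real_sqrt_unique)
  then show ?thesis by (simp add: real_sqrt_mult)
qed

lemma herm_cauchy_schwarz: "norm (herm v w) \<le> norm v * norm w"
proof -
  have "norm (herm v w) \<le> (\<Sum>k\<in>UNIV. norm (v $ k) * norm (w $ k))"
    unfolding herm_def by (intro sum_norm_le) (simp add: norm_mult)
  also have "\<dots> \<le> norm v * norm w"
    unfolding norm_vec_def using L2_set_mult_ineq[of "\<lambda>k. norm (v $ k)" "\<lambda>k. norm (w $ k)" UNIV] by simp
  finally show ?thesis .
qed

section \<open>The evolution at a fixed frequency\<close>

text \<open>The factor i makes this operator skew-adjoint for the real inner product, and the Dirac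
  equation at frequency \<xi> becomes the real linear equation
  \<open>v' = - gen m \<xi> v\<close>.\<close>

definition gen :: "real \<Rightarrow> real^3 \<Rightarrow> complex^4 \<Rightarrow> complex^4" where
  "gen m \<xi> v = \<i> *s dsym m \<xi> v"

definition freq :: "real \<Rightarrow> real^3 \<Rightarrow> real" where
  "freq m \<xi> = sqrt (m\<^sup>2 + (norm \<xi>)\<^sup>2)"

text \<open>This is exp(-itH) in closed form, since H squares to
  \<open>(freq m \<xi>)\<^sup>2\<close>. At \<open>freq m \<xi> = 0\<close> the quotient is 0 by
  convention, and \<open>gen m \<xi>\<close> vanishes there as well.\<close>

definition evol :: "real \<Rightarrow> real \<Rightarrow> real^3 \<Rightarrow> complex^4 \<Rightarrow> complex^4" where
  "evol m t \<xi> v = cos (t * freq m \<xi>) *\<^sub>R v - (sin (t * freq m \<xi>) / freq m \<xi>) *\<^sub>R gen m \<xi> v"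

lemma smult_scaleR: "c *s (r *\<^sub>R v) = r *\<^sub>R (c *s (v::complex^4))"
  by (simp add: vec_eq_iff scaleR_conv_complex)

lemma smult_add: "c *s (v + w) = c *s v + c *s (w::complex^4)"
  and smult_diff: "c *s (v - w) = c *s v - c *s (w::complex^4)"
  by (simp_all add: vec_eq_iff algebra_simps)

lemma gen_gen: "gen m \<xi> (gen m \<xi> v) = - ((freq m \<xi>)\<^sup>2 *\<^sub>R v)"
proof -
  have "\<i> *s (\<i> *s u) = - u" for u :: "complex^4" by (simp add: vec_eq_iff complex_i_square)
  then show ?thesis by (simp add: gen_def dsym_smult dsym_dsym freq_def)
qed

lemma gen_linear: "linear (gen m \<xi>)"
  unfolding gen_def by (intro linearI) (simp_all add: dsym_add dsym_scaleR smult_add smult_scaleR)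

lemma gen_add: "gen m \<xi> (v + w) = gen m \<xi> v + gen m \<xi> w"
  and gen_diff: "gen m \<xi> (v - w) = gen m \<xi> v - gen m \<xi> w"
  and gen_scaleR: "gen m \<xi> (c *\<^sub>R v) = c *\<^sub>R gen m \<xi> v"
  and gen_zero [simp]: "gen m \<xi> 0 = 0"
  using gen_linear[of m \<xi>] by (auto simp: linear_add linear_diff linear_scale linear_0)

lemma gen_smult: "gen m \<xi> (c *s v) = c *s gen m \<xi> v"
  by (simp add: gen_def dsym_smult mult.commute)

lemma inner_gen: "inner (gen m \<xi> v) w = - inner v (gen m \<xi> w)"
  by (simp add: inner_complex4 gen_def herm_smult_left herm_smult_right herm_dsym)

lemma norm_gen: "norm (gen m \<xi> v) = freq m \<xi> * norm v"
  by (simp add: gen_def norm_vector_smult norm_dsym freq_def)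

lemma freq_zero_gen: "freq m \<xi> = 0 \<Longrightarrow> gen m \<xi> v = 0"
  using norm_gen[of m \<xi> v] by simp

lemma evol_0 [simp]: "evol m 0 \<xi> v = v"
  by (simp add: evol_def)

lemma evol_zero [simp]: "evol m t \<xi> 0 = 0"
  by (simp add: evol_def)

lemma evol_smult: "evol m t \<xi> (c *s v) = c *s evol m t \<xi> v"
  by (simp add: evol_def gen_smult smult_diff smult_scaleR)

lemma gen_evol: "gen m \<xi> (evol m t \<xi> v) = cos (t * freq m \<xi>) *\<^sub>R gen m \<xi> v + (sin (t * freq m \<xi>) * freq m \<xi>) *\<^sub>R v"
  by (simp add: evol_def gen_diff gen_scaleR gen_gen power2_eq_square)

lemma evol_has_derivative:
  "((\<lambda>t. evol m t \<xi> v) has_vector_derivative - gen m \<xi> (evol m t \<xi> v)) (at t within S)"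
proof -
  have "((\<lambda>t. evol m t \<xi> v) has_vector_derivative
     (- sin (t * freq m \<xi>) * freq m \<xi>) *\<^sub>R v - (cos (t * freq m \<xi>) * freq m \<xi> / freq m \<xi>) *\<^sub>R gen m \<xi> v) (at t within S)"
  proof -
    have "((\<lambda>t. cos (t * freq m \<xi>)) has_real_derivative - sin (t * freq m \<xi>) * freq m \<xi>) (at t within S)"
      by (auto intro!: derivative_eq_intros)
    moreover have "((\<lambda>t. sin (t * freq m \<xi>) / freq m \<xi>) has_real_derivative cos (t * freq m \<xi>) * freq m \<xi> / freq m \<xi>) (at t within S)"
      by (rule DERIV_cdivide) (auto intro!: derivative_eq_intros)
    ultimately show ?thesis unfolding evol_def
      by (intro has_vector_derivative_diff)
         (use has_vector_derivative_scaleR[OF _ has_vector_derivative_const] in \<open>force\<close>)+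
  qed
  moreover have "(- sin (t * freq m \<xi>) * freq m \<xi>) *\<^sub>R v - (cos (t * freq m \<xi>) * freq m \<xi> / freq m \<xi>) *\<^sub>R gen m \<xi> v
      = - gen m \<xi> (evol m t \<xi> v)"
    unfolding gen_evol by (cases "freq m \<xi> = 0") (simp_all add: freq_zero_gen)
  ultimately show ?thesis by simp
qed

text \<open>Skew-adjointness of the generator makes the time derivative of the squared norm
  vanish.\<close>

lemma norm_evol [simp]: "norm (evol m t \<xi> v) = norm v"
proof -
  have "((\<lambda>t. inner (evol m t \<xi> v) (evol m t \<xi> v)) has_real_derivative 0) (at t)" for t
  proof -
    have "((\<lambda>t. inner (evol m t \<xi> v) (evol m t \<xi> v)) has_vector_derivative
       inner (evol m t \<xi> v) (- gen m \<xi> (evol m t \<xi> v)) + inner (- gen m \<xi> (evol m t \<xi> v)) (evol m t \<xi> v)) (at t)"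
      by (rule bounded_bilinear.has_vector_derivative[OF bounded_bilinear_inner evol_has_derivative evol_has_derivative])
    moreover have "inner (evol m t \<xi> v) (- gen m \<xi> (evol m t \<xi> v)) + inner (- gen m \<xi> (evol m t \<xi> v)) (evol m t \<xi> v) = 0"
      by (simp add: inner_gen)
    ultimately show ?thesis by (simp add: has_real_derivative_iff_has_vector_derivative)
  qed
  then have "inner (evol m t \<xi> v) (evol m t \<xi> v) = inner (evol m 0 \<xi> v) (evol m 0 \<xi> v)"
    using DERIV_isconst_all[of "\<lambda>t. inner (evol m t \<xi> v) (evol m t \<xi> v)"] by blast
  then show ?thesis by (simp add: norm_eq_sqrt_inner)
qed

lemma evol_inverse: "evol m t \<xi> (evol m (- t) \<xi> v) = v"
proof -
  have c: "(cos a)\<^sup>2 + (sin a)\<^sup>2 = 1" for a :: real by simp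
  show ?thesis
  proof (cases "freq m \<xi> = 0")
    case True
    then show ?thesis by (simp add: evol_def freq_zero_gen)
  next
    case False
    have id: "c *\<^sub>R (c *\<^sub>R v + (s / r) *\<^sub>R g) - (s / r) *\<^sub>R (c *\<^sub>R g - (s * r) *\<^sub>R v) = (c\<^sup>2 + s\<^sup>2) *\<^sub>R v"
      if "r \<noteq> 0" for c s r and g :: "complex^4"
      using that by (simp add: algebra_simps power2_eq_square)
    have "evol m t \<xi> (evol m (- t) \<xi> v) = cos (t * freq m \<xi>) *\<^sub>R evol m (- t) \<xi> v
       - (sin (t * freq m \<xi>) / freq m \<xi>) *\<^sub>R gen m \<xi> (evol m (- t) \<xi> v)"
      by (simp add: evol_def)
    also have "\<dots> = ((cos (t * freq m \<xi>))\<^sup>2 + (sin (t * freq m \<xi>))\<^sup>2) *\<^sub>R v"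
      unfolding gen_evol
      using id[OF False, of "cos (t * freq m \<xi>)" "sin (t * freq m \<xi>)" "gen m \<xi> v"] by (simp add: evol_def)
    finally show ?thesis unfolding c by simp
  qed
qed

lemma matrix_mul_scaleR: "(A::complex^4^4) ** (c *\<^sub>R B) = c *\<^sub>R (A ** B)"
  "(c *\<^sub>R (A::complex^4^4)) ** B = c *\<^sub>R (A ** B)"
  by (simp_all add: vec_eq_iff matrix_matrix_mult_def scaleR_sum_right)

text \<open>\<open>B\<close> squares to \<open>- ?r\<^sup>2\<close> times the identity, so the
  powers in the exponential series alternate between multiples of the identity and of
  \<open>B\<close>, with the coefficients of the cosine and the sine series.\<close>

theorem propagator_symbol_evol: "propagator_symbol m t \<xi> *v v = evol m t \<xi> v"
proof -
  let ?r = "freq m \<xi>"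
  define B where "B = cscale_matrix (- \<i>) (dirac_symbol m \<xi>)"
  have Bv: "B *v u = - gen m \<xi> u" for u
    unfolding B_def gen_def dsym_def cscale_matrix_def
    by (simp add: vec_eq_iff matrix_vector_mult_def map_matrix_def sum_4 algebra_simps)
  have BB: "B ** B = - (?r\<^sup>2 *\<^sub>R mat 1)"
    unfolding matrix_eq matrix_vector_mul_assoc[symmetric] Bv
    by (simp add: linear_neg[OF gen_linear] gen_gen matrix_vector_mult_def mat_def vec_eq_iff sum_4 forall_4 scaleR_conv_complex)
  have A: "cscale_matrix (- \<i> * of_real t) (dirac_symbol m \<xi>) = t *\<^sub>R B"
    unfolding B_def cscale_matrix_def by (simp add: vec_eq_iff map_matrix_def scaleR_conv_complex mult_ac)
  \<comment> \<open>The parity built into \<open>cos_coeff\<close> and \<open>sin_coeff\<close>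
    leaves at most one of the two summands. For \<open>?r = 0\<close> the second one vanishes by the
    convention for division, in accordance with \<open>B = 0\<close>.\<close>
  let ?p = "\<lambda>n. (cos_coeff n * (t * ?r) ^ n) *\<^sub>R (mat 1 :: complex^4^4) + (sin_coeff n * (t * ?r) ^ n / ?r) *\<^sub>R B"
  have B0: "B = 0" if "?r = 0"
    unfolding matrix_eq Bv using freq_zero_gen[OF that] by simp
  have step: "(1 / fact n) *\<^sub>R (((**) (t *\<^sub>R B) ^^ n) (mat 1)) = ?p n" for n
  proof (induction n)
    case 0
    then show ?case by (simp add: cos_coeff_def sin_coeff_def)
  next
    case (Suc n)
    have "(1 / fact (Suc n)) *\<^sub>R (((**) (t *\<^sub>R B) ^^ Suc n) (mat 1))
       = (t / real (Suc n)) *\<^sub>R (B ** ((1 / fact n) *\<^sub>R (((**) (t *\<^sub>R B) ^^ n) (mat 1))))"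
      by (simp add: matrix_mul_scaleR del: of_nat_Suc)
    also have "\<dots> = (t / real (Suc n)) *\<^sub>R (B ** ?p n)" unfolding Suc.IH ..
    also have "\<dots> = (t / real (Suc n)) *\<^sub>R ((cos_coeff n * (t * ?r) ^ n) *\<^sub>R B - (sin_coeff n * (t * ?r) ^ n / ?r * ?r\<^sup>2) *\<^sub>R mat 1)"
      by (simp add: matrix_add_ldistrib matrix_mul_scaleR BB)
    also have "\<dots> = ?p (Suc n)"
    proof (cases "?r = 0")
      case True
      then show ?thesis by (simp add: B0)
    next
      case False
      then show ?thesis
        by (simp add: cos_coeff_Suc sin_coeff_Suc algebra_simps power2_eq_square del: of_nat_Suc)
    qed
    finally show ?case .
  qed
  have "(\<lambda>n. ?p n) sums (cos (t * ?r) *\<^sub>R mat 1 + (sin (t * ?r) / ?r) *\<^sub>R B)"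
    by (intro sums_add sums_scaleR_left sums_divide)
       (use cos_converges[of "t * ?r"] sin_converges[of "t * ?r"] in simp_all)
  then have "matrix_exp (t *\<^sub>R B) = cos (t * ?r) *\<^sub>R mat 1 + (sin (t * ?r) / ?r) *\<^sub>R B"
    unfolding matrix_exp_def step by (rule sums_unique[symmetric])
  then have "propagator_symbol m t \<xi> = cos (t * ?r) *\<^sub>R mat 1 + (sin (t * ?r) / ?r) *\<^sub>R B"
    unfolding propagator_symbol_def A .
  then show ?thesis
    by (simp add: matrix_vector_mult_add_rdistrib matrix_vector_scaleR Bv evol_def)
qed

section \<open>Spectral projections and the anticommutation condition\<close>

text \<open>For nonzero \<eta> this is the projection \<Pi>_-(\<eta>) onto the eigenspace of
  \<open>dsym 0 \<eta>\<close> with eigenvalue \<open>- norm \<eta>\<close>; the complementary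
  projection \<Pi>_+(\<eta>) is \<open>hproj (- \<eta>)\<close>.\<close>

definition hproj :: "real^3 \<Rightarrow> complex^4 \<Rightarrow> complex^4" where
  "hproj \<eta> v = (1/2) *\<^sub>R (v - (1 / norm \<eta>) *\<^sub>R dsym 0 \<eta> v)"

lemma hproj_sum: "hproj \<eta> v + hproj (- \<eta>) v = v"
  by (simp add: hproj_def dsym0_uminus algebra_simps flip: scaleR_add_left)

text \<open>The right side is the density of the conserved current through the null planes on which
  \<open>x \<bullet> \<eta> - t * norm \<eta>\<close> is constant. This identity is the reason why
  the flux controls the part \<open>hproj \<eta>\<close> of the wave.\<close>

lemma hproj_norm:
  assumes "\<eta> \<noteq> 0"
  shows "2 * norm \<eta> * (norm (hproj \<eta> v))\<^sup>2 = norm \<eta> * (norm v)\<^sup>2 - inner v (dsym 0 \<eta> v)"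
proof -
  have "(norm (hproj \<eta> v))\<^sup>2 = 1/4 * ((norm v)\<^sup>2 - 2 * (1 / norm \<eta>) * inner v (dsym 0 \<eta> v)
      + (1 / norm \<eta>)\<^sup>2 * (norm (dsym 0 \<eta> v))\<^sup>2)"
    unfolding hproj_def power2_norm_eq_inner
    by (simp add: inner_diff_left inner_diff_right inner_commute[of "dsym 0 \<eta> v" v] power2_eq_square algebra_simps)
  also have "(norm (dsym 0 \<eta> v))\<^sup>2 = (norm \<eta>)\<^sup>2 * (norm v)\<^sup>2"
    by (simp add: norm_dsym power_mult_distrib)
  finally show ?thesis using assms by (simp add: field_simps power2_eq_square)
qed

lemma herm_hproj: "herm (hproj \<eta> v) w = herm v (hproj \<eta> w)"
proof -
  have "herm (v - u) w = herm v w - herm u w" "herm v (w - u) = herm v w - herm v u" for u v w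
    by (simp_all add: herm_def sum_subtractf algebra_simps)
  then show ?thesis
    by (simp add: hproj_def herm_scaleR_left herm_scaleR_right herm_dsym)
qed

lemma hproj_dsym:
  assumes "\<eta> \<noteq> 0"
  shows "dsym 0 \<eta> (hproj \<eta> v) = - (norm \<eta> *\<^sub>R hproj \<eta> v)"
  using assms by (simp add: hproj_def dsym_scaleR dsym_diff dsym_dsym algebra_simps power2_eq_square)

lemma cis_smult_real: "cis a *s v = cos a *\<^sub>R v + sin a *\<^sub>R (\<i> *s (v::complex^4))"
  by (simp add: vec_eq_iff scaleR_conv_complex cis.ctr complex_eq_iff)

text \<open>On each eigenspace the massless evolution is a pure phase. The projections depend on the
  direction of \<eta> but not on \<open>l\<close>, so they stay fixed when \<open>l\<close> is
  integrated along a ray.\<close>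

lemma evol_massless:
  assumes "\<eta> \<noteq> 0" "l > 0"
  shows "evol 0 t (l *\<^sub>R \<eta>) v = cis (- l * t * norm \<eta>) *s hproj (- \<eta>) v + cis (l * t * norm \<eta>) *s hproj \<eta> v"
proof -
  have f: "freq 0 (l *\<^sub>R \<eta>) = l * norm \<eta>" using assms by (simp add: freq_def)
  have g: "gen 0 (l *\<^sub>R \<eta>) u = l *\<^sub>R (\<i> *s dsym 0 \<eta> u)" for u
    unfolding gen_def dsym0_scale smult_scaleR ..
  have h: "dsym 0 \<eta> v = norm \<eta> *\<^sub>R hproj (- \<eta>) v - norm \<eta> *\<^sub>R hproj \<eta> v"
    using hproj_dsym[of "- \<eta>" v] hproj_dsym[of \<eta> v] assms
    by (subst hproj_sum[of \<eta> v, symmetric]) (simp add: dsym_add dsym0_uminus)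
  have "evol 0 t (l *\<^sub>R \<eta>) v = cos (t * (l * norm \<eta>)) *\<^sub>R (hproj \<eta> v + hproj (- \<eta>) v)
      - (sin (t * (l * norm \<eta>))) *\<^sub>R (\<i> *s (hproj (- \<eta>) v - hproj \<eta> v))"
    unfolding evol_def f g h hproj_sum using assms
    by (simp add: smult_diff smult_scaleR algebra_simps)
  also have "\<dots> = cis (- l * t * norm \<eta>) *s hproj (- \<eta>) v + cis (l * t * norm \<eta>) *s hproj \<eta> v"
    unfolding cis_smult_real by (simp add: smult_diff algebra_simps)
  finally show ?thesis .
qed

text \<open>The condition is given on the unit sphere; homogeneity of the symbol extends it to every
  \<eta>.\<close>

lemma anticommutes_dsym:
  assumes "anticommutes_alpha \<Gamma>"
  shows "\<Gamma> *v dsym 0 \<eta> v = - dsym 0 \<eta> (\<Gamma> *v v)"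
proof (cases "\<eta> = 0")
  case True
  then show ?thesis using dsym0_scale[of 0 0] by simp
next
  case False
  define \<omega> where "\<omega> = \<eta> /\<^sub>R norm \<eta>"
  have d: "dsym 0 \<omega> v = alpha_dot \<omega> *v v" for v
    by (simp add: dsym_def dirac_symbol_def)
  have "\<omega> \<in> sphere 0 1" using False by (simp add: \<omega>_def)
  with assms have "(\<Gamma> ** alpha_dot \<omega> + alpha_dot \<omega> ** \<Gamma>) *v v = 0 *v v"
    by (simp add: anticommutes_alpha_def)
  then have "\<Gamma> *v dsym 0 \<omega> v + dsym 0 \<omega> (\<Gamma> *v v) = 0"
    by (simp add: matrix_vector_mult_add_rdistrib matrix_vector_mul_assoc d)
  then have *: "\<Gamma> *v dsym 0 \<omega> v = - dsym 0 \<omega> (\<Gamma> *v v)" by (simp add: eq_neg_iff_add_eq_0)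
  have "\<eta> = norm \<eta> *\<^sub>R \<omega>" using False by (simp add: \<omega>_def)
  then show ?thesis
    using * by (metis dsym0_scale matrix_vector_scaleR scaleR_minus_right)
qed

lemma anticommutes_hproj:
  assumes "anticommutes_alpha \<Gamma>"
  shows "\<Gamma> *v hproj \<eta> v = hproj (- \<eta>) (\<Gamma> *v v)"
  unfolding hproj_def
  by (simp add: matrix_vector_scaleR matrix_vector_mult_diff_distrib anticommutes_dsym[OF assms] dsym0_uminus)

text \<open>The null structure in the form in which it is used: \<Gamma> turns a projection into the
  opposite one, and self-adjointness moves that one to the second slot.\<close>

lemma bilin_hproj:
  assumes "anticommutes_alpha \<Gamma>"
  shows "bilin \<Gamma> (hproj \<eta> v) w = herm (\<Gamma> *v v) (hproj (- \<eta>) w)"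
  unfolding bilin_def anticommutes_hproj[OF assms] herm_hproj ..

text \<open>The conjugate transpose. Moving \<Gamma> to the other slot allows either wave to be the
  one that is split into rays.\<close>

definition cadj :: "complex^4^4 \<Rightarrow> complex^4^4" where
  "cadj A = (\<chi> i j. cnj (A $ j $ i))"

lemma herm_cadj: "herm (A *v v) w = herm v (cadj A *v w)"
proof -
  have "herm (A *v v) w = (\<Sum>k\<in>UNIV. \<Sum>j\<in>UNIV. cnj (A $ k $ j) * cnj (v $ j) * w $ k)"
    unfolding herm_def matrix_vector_mult_def by (simp add: sum_distrib_right)
  also have "\<dots> = (\<Sum>j\<in>UNIV. \<Sum>k\<in>UNIV. cnj (A $ k $ j) * cnj (v $ j) * w $ k)"
    by (rule sum.swap)
  also have "\<dots> = herm v (cadj A *v w)"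
    unfolding herm_def matrix_vector_mult_def cadj_def by (simp add: sum_distrib_left mult_ac)
  finally show ?thesis .
qed

lemma herm_eqI:
  assumes "\<And>v. herm v a = herm v b" shows "a = b"
proof -
  have "a $ k = b $ k" for k
  proof -
    have "herm (axis k 1) u = u $ k" for u
      unfolding herm_def axis_def by (subst sum.remove[of _ k]) (auto intro!: sum.neutral)
    then show ?thesis using assms[of "axis k 1"] by simp
  qed
  then show ?thesis by (simp add: vec_eq_iff)
qed

text \<open>The operators \<open>dsym 0 \<omega>\<close> are self-adjoint, so taking adjoints
  preserves the anticommutation relation.\<close>

lemma anticommutes_cadj:
  assumes "anticommutes_alpha \<Gamma>" shows "anticommutes_alpha (cadj \<Gamma>)"
  unfolding anticommutes_alpha_def
proof
  fix \<omega> :: "real^3" assume "\<omega> \<in> sphere 0 1"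
  have d: "dsym 0 \<omega> v = alpha_dot \<omega> *v v" for v
    by (simp add: dsym_def dirac_symbol_def)
  have "cadj \<Gamma> *v dsym 0 \<omega> v = - dsym 0 \<omega> (cadj \<Gamma> *v v)" for v
  proof (rule herm_eqI)
    fix u
    have n: "herm (- a) b = - herm a b" "herm a (- b) = - herm a b" for a b
      by (simp_all add: herm_def sum_negf)
    have "herm u (cadj \<Gamma> *v dsym 0 \<omega> v) = herm (dsym 0 \<omega> (\<Gamma> *v u)) v"
      by (simp add: herm_cadj[symmetric] herm_dsym)
    also have "\<dots> = - herm (\<Gamma> *v dsym 0 \<omega> u) v"
      by (simp add: anticommutes_dsym[OF assms] n)
    also have "\<dots> = herm u (- dsym 0 \<omega> (cadj \<Gamma> *v v))"
      by (simp add: herm_cadj herm_dsym n)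
    finally show "herm u (cadj \<Gamma> *v dsym 0 \<omega> v) = herm u (- dsym 0 \<omega> (cadj \<Gamma> *v v))" .
  qed
  then show "cadj \<Gamma> ** alpha_dot \<omega> + alpha_dot \<omega> ** cadj \<Gamma> = 0"
    unfolding matrix_eq d by (simp add: matrix_vector_mult_add_rdistrib matrix_vector_mul_assoc[symmetric])
qed

lemma norm_bilin_cadj: "norm (bilin \<Gamma> v w) = norm (bilin (cadj \<Gamma>) w v)"
  unfolding bilin_def herm_cadj[of \<Gamma>] by (subst herm_commute) simp

section \<open>Free waves with compact frequency support\<close>

lemma continuous_integral_param:
  fixes f :: "real \<Rightarrow> 'a \<Rightarrow> 'b::{banach,second_countable_topology}"
  assumes m: "\<And>s. f s \<in> borel_measurable M" and c: "\<And>x. continuous_on UNIV (\<lambda>s. f s x)"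
    and b: "\<And>s x. norm (f s x) \<le> g x" and g: "integrable M g"
  shows "continuous_on UNIV (\<lambda>s. \<integral>x. f s x \<partial>M)"
proof (subst continuous_on_sequentially, intro ballI allI impI, elim conjE)
  fix u :: "nat \<Rightarrow> real" and s assume "u \<longlonglongrightarrow> s"
  then have "(\<lambda>n. f (u n) x) \<longlonglongrightarrow> f s x" for x
    by (rule continuous_on_tendsto_compose[OF c]) auto
  then have "(\<lambda>n. \<integral>x. f (u n) x \<partial>M) \<longlonglongrightarrow> (\<integral>x. f s x \<partial>M)"
    by (intro integral_dominated_convergence[where w = g]) (auto intro: m b g)
  then show "((\<lambda>s. \<integral>x. f s x \<partial>M) \<circ> u) \<longlonglongrightarrow> (\<integral>x. f s x \<partial>M)" by (simp add: o_def)
qed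

text \<open>By the mean value inequality the bound \<open>g\<close> on the derivatives also
  dominates the difference quotients, and dominated convergence along sequences gives the
  derivative.\<close>

lemma has_vector_derivative_integral_param:
  fixes f :: "real \<Rightarrow> 'a \<Rightarrow> 'b::{banach,second_countable_topology}"
  assumes f: "\<And>s. integrable M (f s)" and f': "\<And>s. f' s \<in> borel_measurable M"
    and d: "\<And>s x. ((\<lambda>s. f s x) has_vector_derivative f' s x) (at s)"
    and b: "\<And>s x. norm (f' s x) \<le> g x" and g: "integrable M g"
  shows "((\<lambda>s. \<integral>x. f s x \<partial>M) has_vector_derivative (\<integral>x. f' s x \<partial>M)) (at s)"
proof -
  have quot: "norm ((1 / h) *\<^sub>R d - e) = norm (d - h *\<^sub>R e) / norm h" if "h \<noteq> 0" for h :: real and d e :: 'b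
  proof -
      have "(1 / h) *\<^sub>R d - e = (1 / h) *\<^sub>R (d - h *\<^sub>R e)" using that by (simp add: scaleR_diff_right)
      then show ?thesis by simp
  qed
  have lip: "norm (f (s + h) x - f s x) \<le> \<bar>h\<bar> * g x" for h x
  proof -
    have "norm (f (s + h) x - f s x) \<le> g x * norm ((s + h) - s)"
    proof (rule differentiable_bound[where S = UNIV and f = "\<lambda>s. f s x" and f' = "\<lambda>s h. h *\<^sub>R f' s x" and B = "g x"])
      show "((\<lambda>s. f s x) has_derivative (\<lambda>h. h *\<^sub>R f' r x)) (at r within UNIV)" for r
        using d[of x r] by (simp add: has_vector_derivative_def)
      show "onorm (\<lambda>h. h *\<^sub>R f' r x) \<le> g x" for r
        by (rule onorm_le) (use b[of r x] in \<open>auto simp: mult.commute[of "g x"] intro!: mult_left_mono\<close>)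
    qed auto
    then show ?thesis by (simp add: mult.commute)
  qed
  have "((\<lambda>h. (1 / h) *\<^sub>R ((\<integral>x. f (s + h) x \<partial>M) - (\<integral>x. f s x \<partial>M))) \<longlongrightarrow> (\<integral>x. f' s x \<partial>M)) (at 0)"
  proof (subst tendsto_at_iff_sequentially, intro allI impI)
    fix u :: "nat \<Rightarrow> real" assume u0: "\<forall>i. u i \<in> UNIV - {0}" and u: "u \<longlonglongrightarrow> 0"
    have "(\<lambda>n. \<integral>x. (1 / u n) *\<^sub>R (f (s + u n) x - f s x) \<partial>M) \<longlonglongrightarrow> (\<integral>x. f' s x \<partial>M)"
    proof (rule integral_dominated_convergence[where w = g])
      show "AE x in M. (\<lambda>n. (1 / u n) *\<^sub>R (f (s + u n) x - f s x)) \<longlonglongrightarrow> f' s x"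
      proof (intro AE_I2)
        fix x
        have "((\<lambda>h. (1 / h) *\<^sub>R (f (s + h) x - f s x)) \<longlongrightarrow> f' s x) (at 0)"
          using d[of x s] unfolding has_vector_derivative_def has_derivative_at
        proof -
          assume "bounded_linear (\<lambda>h. h *\<^sub>R f' s x) \<and> ((\<lambda>h. norm (f (s + h) x - f s x - h *\<^sub>R f' s x) / norm h) \<longlongrightarrow> 0) (at 0)"
          then have "((\<lambda>h. norm ((1 / h) *\<^sub>R (f (s + h) x - f s x) - f' s x)) \<longlongrightarrow> 0) (at 0)"
          proof (elim conjE Lim_transform_eventually)
            show "\<forall>\<^sub>F h in at 0. norm (f (s + h) x - f s x - h *\<^sub>R f' s x) / norm h = norm ((1 / h) *\<^sub>R (f (s + h) x - f s x) - f' s x)"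
              unfolding eventually_at_filter by (intro always_eventually allI impI quot[symmetric])
          qed
          then show ?thesis by (subst Lim_null, rule tendsto_norm_zero_cancel)
        qed
        then show "(\<lambda>n. (1 / u n) *\<^sub>R (f (s + u n) x - f s x)) \<longlonglongrightarrow> f' s x"
          using u0 u unfolding tendsto_at_iff_sequentially comp_def by blast
      qed
      show "AE x in M. norm ((1 / u n) *\<^sub>R (f (s + u n) x - f s x)) \<le> g x" for n
      proof (intro AE_I2)
        fix x
        have "norm ((1 / u n) *\<^sub>R (f (s + u n) x - f s x)) = (1 / \<bar>u n\<bar>) * norm (f (s + u n) x - f s x)"
          by simp
        also have "\<dots> \<le> (1 / \<bar>u n\<bar>) * (\<bar>u n\<bar> * g x)" by (intro mult_left_mono lip) auto
        also have "\<dots> = g x" using u0 by simp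
        finally show "norm ((1 / u n) *\<^sub>R (f (s + u n) x - f s x)) \<le> g x" .
      qed
      show "(\<lambda>x. (1 / u n) *\<^sub>R (f (s + u n) x - f s x)) \<in> borel_measurable M" for n
        using f by auto
    qed (auto intro: f' g)
    then show "((\<lambda>h. (1 / h) *\<^sub>R ((\<integral>x. f (s + h) x \<partial>M) - (\<integral>x. f s x \<partial>M))) \<circ> u) \<longlonglongrightarrow> (\<integral>x. f' s x \<partial>M)"
      by (simp add: o_def f)
  qed
  then have lim: "((\<lambda>h. norm ((1 / h) *\<^sub>R ((\<integral>x. f (s + h) x \<partial>M) - (\<integral>x. f s x \<partial>M)) - (\<integral>x. f' s x \<partial>M))) \<longlongrightarrow> 0) (at 0)"
    by (intro tendsto_norm_zero) (simp add: Lim_null[symmetric])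
  show ?thesis
    unfolding has_vector_derivative_def has_derivative_at
  proof (intro conjI bounded_linear_scaleR_left Lim_transform_eventually[OF lim])
    show "\<forall>\<^sub>F h in at 0. norm ((1 / h) *\<^sub>R ((\<integral>x. f (s + h) x \<partial>M) - (\<integral>x. f s x \<partial>M)) - (\<integral>x. f' s x \<partial>M)) =
         norm ((\<integral>x. f (s + h) x \<partial>M) - (\<integral>x. f s x \<partial>M) - h *\<^sub>R (\<integral>x. f' s x \<partial>M)) / norm h"
      by (auto simp: eventually_at_filter quot)
  qed
qed

text \<open>Averaging over the translates \<open>x + s *\<^sub>R e\<close> with \<open>s\<close> in
  {0..1} and integrating in \<open>s\<close> first turns the integral of \<open>f'\<close> into that
  of \<open>f (x + e) - f x\<close>, which is 0 by translation invariance. Integrability thus takes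
  the place of decay at infinity and of boundary terms.\<close>

lemma integral_directional_derivative_zero:
  fixes f f' :: "'a::euclidean_space \<Rightarrow> real"
  assumes f: "integrable lborel f" and f': "integrable lborel f'"
    and d: "\<And>x s. ((\<lambda>s. f (x + s *\<^sub>R e)) has_real_derivative f' (x + s *\<^sub>R e)) (at s)"
    and c: "\<And>x. continuous_on UNIV (\<lambda>s. f' (x + s *\<^sub>R e))"
  shows "(\<integral>x. f' x \<partial>lborel) = 0"
proof -
  have [measurable]: "f \<in> borel_measurable borel" "f' \<in> borel_measurable borel" using f f' by auto
  let ?F = "\<lambda>x s. indicator {0..1} s * f' (x + s *\<^sub>R e)"
  have tr: "(\<integral>x. g (x + s *\<^sub>R e) \<partial>lborel) = (\<integral>x. g x \<partial>lborel)" "integrable lborel (\<lambda>x. g (x + s *\<^sub>R e))"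
    if "integrable lborel g" for g :: "'a \<Rightarrow> real" and s
    using lborel_integral_translate[of g "s *\<^sub>R e"] that by (auto simp: add.commute)
  have int: "integrable (lborel \<Otimes>\<^sub>M lborel) (\<lambda>(s, x). ?F x s)"
  proof (rule lborel_pair.Fubini_integrable)
    show "(\<lambda>(s, x). ?F x s) \<in> borel_measurable (lborel \<Otimes>\<^sub>M lborel)" by measurable
    have "(\<integral>x. norm (case (s, x) of (s, x) \<Rightarrow> ?F x s) \<partial>lborel) = indicator {0..1} s * (\<integral>x. norm (f' x) \<partial>lborel)" for s
      using tr(1)[of "\<lambda>x. norm (f' x)" s] f' by (simp add: abs_mult)
    then show "integrable lborel (\<lambda>s. \<integral>x. norm (case (s, x) of (s, x) \<Rightarrow> ?F x s) \<partial>lborel)"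
      by (auto intro!: integrable_mult_left integrable_real_indicator)
    show "AE s in lborel. integrable lborel (\<lambda>x. case (s, x) of (s, x) \<Rightarrow> ?F x s)"
      using tr(2)[OF f'] by auto
  qed
  have "(\<integral>s. \<integral>x. ?F x s \<partial>lborel \<partial>lborel) = (\<integral>s. indicator {0..1::real} s * (\<integral>x. f' x \<partial>lborel) \<partial>lborel)"
    by (simp only: integral_mult_right_zero tr(1)[OF f'])
  also have "\<dots> = (\<integral>s. indicator {0..1::real} s \<partial>lborel) * (\<integral>x. f' x \<partial>lborel)"
    by (rule integral_mult_left_zero)
  also have "\<dots> = (\<integral>x. f' x \<partial>lborel)"
  proof -
    have "measure lborel {0..1::real} = 1" by (subst measure_lborel_Icc) auto
    then show ?thesis by simp
  qed
  finally have 1: "(\<integral>x. f' x \<partial>lborel) = (\<integral>s. \<integral>x. ?F x s \<partial>lborel \<partial>lborel)" ..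
  also have "\<dots> = (\<integral>x. \<integral>s. ?F x s \<partial>lborel \<partial>lborel)"
    using lborel_pair.Fubini_integral[of "\<lambda>s x. ?F x s"] int by simp
  also have "\<dots> = (\<integral>x. f (x + 1 *\<^sub>R e) - f x \<partial>lborel)"
  proof (intro Bochner_Integration.integral_cong refl)
    fix x
    have "(\<integral>s. f' (x + s *\<^sub>R e) * indicator {0..1} s \<partial>lborel) = f (x + 1 *\<^sub>R e) - f (x + 0 *\<^sub>R e)"
      by (rule integral_FTC_Icc_real[where F = "\<lambda>s. f (x + s *\<^sub>R e)"])
         (use d c in \<open>auto simp: continuous_on_eq_continuous_at\<close>)
    then show "(\<integral>s. ?F x s \<partial>lborel) = f (x + 1 *\<^sub>R e) - f x" by (simp add: mult.commute)
  qed
  also have "\<dots> = 0"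
    using tr[OF f, of 1] f by simp
  finally show ?thesis .
qed

text \<open>The witness is the integral of \<open>w\<close> over the half line up to
  \<open>s\<close>. Its sign and its upper bound are what the flux argument uses at the two ends of
  the time interval.\<close>

lemma exists_antiderivative:
  fixes w :: "real \<Rightarrow> real"
  assumes c: "continuous_on UNIV w" and w: "integrable lborel w" and nn: "\<And>s. 0 \<le> w s"
  obtains W where "\<And>s. (W has_real_derivative w s) (at s)" "\<And>s. 0 \<le> W s" "\<And>s. W s \<le> (\<integral>s. w s \<partial>lborel)"
proof
  let ?W = "\<lambda>s. \<integral>u. indicator {..s} u * w u \<partial>lborel"
  have i: "integrable lborel (\<lambda>u. indicator A u * w u)" if "A \<in> sets borel" for A
    using integrable_mult_indicator[OF _ w, of A] that by simp
  show "0 \<le> ?W s" for s by (intro Bochner_Integration.integral_nonneg) (simp add: nn)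
  show "?W s \<le> (\<integral>s. w s \<partial>lborel)" for s
    by (rule Bochner_Integration.integral_mono[OF i w]) (auto simp: indicator_def nn)
  show "(?W has_real_derivative w s) (at s)" for s
  proof -
    \<comment> \<open>Near \<open>s\<close> the half-line integral is a constant plus an integral
      over a compact interval, to which the fundamental theorem of calculus applies.\<close>
    have eqW: "?W r = ?W (s - 1) + integral {s - 1..r} w" if "r \<in> {s-1..s+1}" for r
    proof -
      have "?W r = (\<integral>u. indicator {..s-1} u * w u + indicator {s-1<..r} u * w u \<partial>lborel)"
        using that by (intro Bochner_Integration.integral_cong refl) (auto simp: indicator_def)
      also have "\<dots> = ?W (s - 1) + (\<integral>u. indicator {s-1<..r} u * w u \<partial>lborel)"
        by (rule Bochner_Integration.integral_add) (auto intro: i)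
      also have "(\<integral>u. indicator {s-1<..r} u * w u \<partial>lborel) = (\<integral>u. indicator {s-1..r} u * w u \<partial>lborel)"
        using AE_lborel_singleton[of "s-1"] w by (intro integral_cong_AE) (auto simp: indicator_def elim!: eventually_mono)
      also have "\<dots> = integral {s-1..r} w"
        using set_borel_integral_eq_integral(2)[of "{s-1..r}" w] i[of "{s-1..r}"]
        by (simp add: set_lebesgue_integral_def set_integrable_def)
      finally show ?thesis .
    qed
    have der: "((\<lambda>r. ?W (s - 1) + integral {s - 1..r} w) has_real_derivative w s) (at s)"
    proof -
      have "((\<lambda>r. integral {s - 1..r} w) has_real_derivative w s) (at s within {s-1..s+1})"
        by (rule integral_has_real_derivative) (auto intro: continuous_on_subset[OF c])
      then have "((\<lambda>r. integral {s - 1..r} w) has_real_derivative w s) (at s)"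
        using at_within_interior[of s "{s-1..s+1}"] by simp
      from DERIV_add[OF DERIV_const this] show ?thesis by simp
    qed
    show ?thesis
    proof (rule has_field_derivative_transform_within_open[OF der, where S = "{s-1<..<s+1}"])
      show "?W (s - 1) + integral {s - 1..r} w = ?W r" if "r \<in> {s-1<..<s+1}" for r
        by (rule eqW[symmetric]) (use that in simp)
    qed auto
  qed
qed

text \<open>Splitting into constant matrices with scalar coefficients gives joint measurability in
  the frequency and, later, the partial derivatives in the Dirac equation.\<close>

lemma dsym_decomp: "dsym m \<xi> v = (\<Sum>k\<in>UNIV. (\<xi> $ k) *\<^sub>R dsym 0 (axis k 1) v) + m *\<^sub>R dsym 1 0 v"
  by (simp add: vec_eq_iff forall_4 dsym_components sum_3 scaleR_conv_complex axis_def algebra_simps)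

lemma bounded_linear_dsym: "bounded_linear (dsym m \<xi>)"
  using dsym_linear linear_conv_bounded_linear by blast

lemma borel_measurable_dsym [measurable (raw)]:
  assumes [measurable]: "g \<in> borel_measurable M" "v \<in> borel_measurable M"
  shows "(\<lambda>p. dsym m (g p) (v p)) \<in> borel_measurable M"
proof -
  have [measurable]: "dsym m \<xi> \<in> borel_measurable borel" for m \<xi>
    by (intro borel_measurable_continuous_onI linear_continuous_on bounded_linear_dsym)
  have [measurable]: "(\<lambda>p. g p $ k) \<in> borel_measurable M" for k
  proof -
    have "continuous_on UNIV (\<lambda>x::real^3. x $ k)" by (intro continuous_intros)
    from measurable_compose[OF assms(1) borel_measurable_continuous_onI[OF this]] show ?thesis .
  qed
  show ?thesis by (subst dsym_decomp) measurable
qed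

lemma borel_measurable_gen [measurable (raw)]:
  assumes [measurable]: "g \<in> borel_measurable M" "v \<in> borel_measurable M"
  shows "(\<lambda>p. gen m (g p) (v p)) \<in> borel_measurable M"
  unfolding gen_def by measurable

lemma borel_measurable_evol [measurable (raw)]:
  assumes [measurable]: "f \<in> borel_measurable M" "g \<in> borel_measurable M" "v \<in> borel_measurable M"
  shows "(\<lambda>p. evol m (f p) (g p) (v p)) \<in> borel_measurable M"
  unfolding evol_def freq_def by measurable

section \<open>Square-integrable profiles in a frequency ball and their waves\<close>

text \<open>Bounded support makes a profile integrable, so that its wave is defined at every point,
  and it keeps the class stable under multiplication by \<xi>, that is, under differentiation of the
  wave.\<close>

definition band :: "real \<Rightarrow> (real^3 \<Rightarrow> complex^4) \<Rightarrow> bool" where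
  "band b h \<longleftrightarrow> h \<in> borel_measurable borel \<and> L2sq lborel h < \<infinity> \<and> (\<forall>\<xi>. b < norm \<xi> \<longrightarrow> h \<xi> = 0)"

lemma band_measurable: "band b h \<Longrightarrow> h \<in> borel_measurable borel"
  by (simp add: band_def)

lemma band_bound:
  assumes h: "band b h" and [measurable]: "g \<in> borel_measurable borel"
    and le: "\<And>\<xi>. norm \<xi> \<le> b \<Longrightarrow> norm (g \<xi>) \<le> c * norm (h \<xi>)" and z: "\<And>\<xi>. h \<xi> = 0 \<Longrightarrow> g \<xi> = 0" and c: "0 \<le> c"
  shows "band b g" and "L2sq lborel g \<le> ennreal (c\<^sup>2) * L2sq lborel h"
proof -
  have [measurable]: "h \<in> borel_measurable borel" using h by (rule band_measurable)
  have "norm (g \<xi>) \<le> c * norm (h \<xi>)" for \<xi>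
    using h le[of \<xi>] z[of \<xi>] by (cases "norm \<xi> \<le> b") (auto simp: band_def)
  then have "(norm (g \<xi>))\<^sup>2 \<le> c\<^sup>2 * (norm (h \<xi>))\<^sup>2" for \<xi>
    by (metis norm_ge_zero power_mono power_mult_distrib)
  then have "ennreal ((norm (g \<xi>))\<^sup>2) \<le> ennreal (c\<^sup>2) * ennreal ((norm (h \<xi>))\<^sup>2)" for \<xi>
    by (metis ennreal_leI ennreal_mult zero_le_power2)
  then show *: "L2sq lborel g \<le> ennreal (c\<^sup>2) * L2sq lborel h"
    unfolding L2sq_def by (subst nn_integral_cmult[symmetric]) (auto intro!: nn_integral_mono)
  have "ennreal (c\<^sup>2) * L2sq lborel h < \<infinity>" using h by (simp add: band_def ennreal_mult_less_top)
  with * show "band b g" using h z by (auto simp: band_def intro: le_less_trans)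
qed

text \<open>This cube encloses the ball of radius \<open>b\<close>; its volume is the origin of the
  factor \<open>8 * b ^ 3\<close> in the later constants.\<close>

lemma emeasure_cube:
  assumes b: "0 \<le> b"
  shows "emeasure lborel (cbox (- b *\<^sub>R One) (b *\<^sub>R One :: real^3)) = ennreal (8 * b ^ 3)"
proof -
  have "(\<Prod>i\<in>Basis. (b *\<^sub>R One - - b *\<^sub>R One :: real^3) \<bullet> i) = (\<Prod>i\<in>(Basis :: (real^3) set). 2 * b)"
  proof (intro prod.cong refl)
    fix i :: "real^3" assume "i \<in> Basis"
    then have "One \<bullet> i = 1" by simp
    then show "(b *\<^sub>R One - - b *\<^sub>R One) \<bullet> i = 2 * b"
      unfolding inner_diff_left inner_scaleR_left by simp
  qed
  also have "\<dots> = 8 * b ^ 3" by (simp add: power_mult_distrib)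
  finally show ?thesis
    using b by (subst emeasure_lborel_cbox) auto
qed

lemma norm_outside_cube:
  assumes "\<xi> \<notin> cbox (- b *\<^sub>R One) (b *\<^sub>R One :: real^3)" shows "b < norm \<xi>"
proof -
  obtain i where "i \<in> Basis" "\<not> \<bar>\<xi> \<bullet> i\<bar> \<le> b"
    using assms by (auto simp: mem_box abs_le_iff)
  then show ?thesis using Basis_le_norm[of i \<xi>] by linarith
qed

text \<open>Cauchy--Schwarz against the indicator of the enclosing cube.\<close>

lemma band_L1:
  assumes h: "band b h" and b: "0 \<le> b"
  shows "integrable lborel h" and "(\<integral>\<xi>. norm (h \<xi>) \<partial>lborel) \<le> sqrt (8 * b ^ 3) * L2_norm lborel h"
proof -
  have [measurable]: "h \<in> borel_measurable borel" using h by (rule band_measurable)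
  define Q where "Q = cbox (- b *\<^sub>R One) (b *\<^sub>R One :: real^3)"
  have hq: "h \<xi> = indicator Q \<xi> *\<^sub>R h \<xi>" for \<xi>
  proof (cases "\<xi> \<in> Q")
    case False
    then have "b < norm \<xi>" unfolding Q_def by (rule norm_outside_cube)
    then show ?thesis using h by (simp add: band_def)
  qed simp
  have hn: "norm (h \<xi>) = norm (indicator Q \<xi> :: real) * norm (h \<xi>)" for \<xi>
    by (subst hq) simp
  have eQ: "emeasure lborel Q = ennreal (8 * b ^ 3)" unfolding Q_def by (rule emeasure_cube[OF b])
  have Q2: "L2sq lborel (indicator Q :: real^3 \<Rightarrow> real) = ennreal (8 * b ^ 3)"
  proof -
    have "L2sq lborel (indicator Q :: real^3 \<Rightarrow> real) = (\<integral>\<^sup>+x. indicator Q x \<partial>lborel)"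
      unfolding L2sq_def by (intro nn_integral_cong) (auto simp: indicator_def)
    then show ?thesis using eQ by (simp add: Q_def)
  qed
  have sQ: "square_integrable lborel (indicator Q :: real^3 \<Rightarrow> real)"
    unfolding square_integrable_iff_L2sq Q2 by (simp add: Q_def)
  have sh: "square_integrable lborel h" using h by (simp add: band_def square_integrable_iff_L2sq)
  have LQ: "L2_norm lborel (indicator Q :: real^3 \<Rightarrow> real) = sqrt (8 * b ^ 3)"
    using square_integrable_L2sq[OF sQ] b unfolding Q2
    by (metis L2_norm_nonneg ennreal_inj mult_nonneg_nonneg real_sqrt_unique zero_le_numeral zero_le_power zero_le_power2)
  show "integrable lborel h"
  proof (rule Bochner_Integration.integrable_bound[OF square_integrable_mult_norm[OF sQ sh]])
    show "AE x in lborel. norm (h x) \<le> norm (norm (indicator Q x :: real) * norm (h x))"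
    proof (intro AE_I2)
      fix x show "norm (h x) \<le> norm (norm (indicator Q x :: real) * norm (h x))"
        unfolding hn[of x, symmetric] by simp
    qed
  qed simp
  show "(\<integral>\<xi>. norm (h \<xi>) \<partial>lborel) \<le> sqrt (8 * b ^ 3) * L2_norm lborel h"
    using L2_cauchy_schwarz[OF sQ sh] unfolding LQ hn[symmetric] .
qed

text \<open>The factor \<open>1 / (2 * pi) ^ 3\<close> of Fourier inversion is left out;
  \<open>dirac_component_wave\<close> restores it.\<close>

definition wave :: "real \<Rightarrow> (real^3 \<Rightarrow> complex^4) \<Rightarrow> real \<Rightarrow> real^3 \<Rightarrow> complex^4" where
  "wave m h t x = osc 1 (\<lambda>\<xi>. evol m t \<xi> (h \<xi>)) x"

lemma wave_measurable [measurable (raw)]: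
  assumes [measurable]: "h \<in> borel_measurable borel" "f \<in> borel_measurable M" "g \<in> borel_measurable M"
  shows "(\<lambda>p. wave m h (f p) (g p)) \<in> borel_measurable M"
  unfolding wave_def osc_def by measurable

lemma band_evol:
  assumes "band b h" shows "band b (\<lambda>\<xi>. evol m t \<xi> (h \<xi>))"
  using assms unfolding band_def L2sq_def by auto

lemma wave_L2sq_le:
  assumes h: "band b h" and b: "0 \<le> b"
  shows "L2sq lborel (wave m h t) \<le> ennreal ((2 * pi) ^ 3) * L2sq lborel h"
proof -
  have "L2sq lborel (wave m h t) = L2sq lborel (osc 1 (\<lambda>\<xi>. evol m t \<xi> (h \<xi>)))" by (simp add: wave_def L2sq_def)
  also have "\<dots> \<le> ennreal ((2 * pi) ^ DIM(real^3)) * L2sq lborel (\<lambda>\<xi>. evol m t \<xi> (h \<xi>))"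
    by (intro osc_bessel band_L1[OF band_evol[OF h] b]) simp
  also have "\<dots> = ennreal ((2 * pi) ^ 3) * L2sq lborel h" by (simp add: L2sq_def)
  finally show ?thesis .
qed

text \<open>Bernstein's inequality: the evolution preserves the modulus of the profile, whose L1
  norm is bounded by \<open>band_L1\<close>.\<close>

lemma wave_norm_le:
  assumes h: "band b h" and b: "0 \<le> b"
  shows "norm (wave m h t x) \<le> sqrt (8 * b ^ 3) * L2_norm lborel h"
proof -
  have "norm (wave m h t x) \<le> (\<integral>\<xi>. norm (cis (1 * (x \<bullet> \<xi>)) *s evol m t \<xi> (h \<xi>)) \<partial>lborel)"
    unfolding wave_def osc_def by (rule integral_norm_bound)
  also have "\<dots> = (\<integral>\<xi>. norm (h \<xi>) \<partial>lborel)" by (simp add: norm_vector_smult)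
  also have "\<dots> \<le> sqrt (8 * b ^ 3) * L2_norm lborel h" by (rule band_L1[OF h b])
  finally show ?thesis .
qed

lemma evol_gen: "evol m t \<xi> (gen m \<xi> v) = gen m \<xi> (evol m t \<xi> v)"
  by (simp add: evol_def gen_diff gen_scaleR)

lemma freq_mono: "norm \<xi> \<le> b \<Longrightarrow> freq m \<xi> \<le> sqrt (m\<^sup>2 + b\<^sup>2)"
  unfolding freq_def by (intro real_sqrt_le_mono add_left_mono power_mono) auto

lemma band_gen: "band b h \<Longrightarrow> band b (\<lambda>\<xi>. - gen m \<xi> (h \<xi>))"
  by (rule band_bound(1)[where h = h and c = "sqrt (m\<^sup>2 + b\<^sup>2)"])
     (auto simp: norm_gen intro!: mult_right_mono freq_mono borel_measurable_uminus borel_measurable_gen intro: band_measurable)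

lemma band_diff: 
  assumes "band b h" shows "band b (\<lambda>\<xi>. (\<i> * of_real (e \<bullet> \<xi>)) *s h \<xi>)"
proof (rule band_bound(1)[OF assms])
  show "norm ((\<i> * of_real (e \<bullet> \<xi>)) *s h \<xi>) \<le> (norm e * \<bar>b\<bar>) * norm (h \<xi>)" if "norm \<xi> \<le> b" for \<xi>
  proof -
    have "\<bar>e \<bullet> \<xi>\<bar> \<le> norm e * norm \<xi>" by (rule Cauchy_Schwarz_ineq2)
    also have "\<dots> \<le> norm e * \<bar>b\<bar>" using that by (intro mult_left_mono) auto
    finally show ?thesis by (auto simp: norm_vector_smult norm_mult intro!: mult_right_mono)
  qed
next
  have [measurable]: "h \<in> borel_measurable borel" using assms by (rule band_measurable)
  show "(\<lambda>\<xi>. (\<i> * of_real (e \<bullet> \<xi>)) *s h \<xi>) \<in> borel_measurable borel" by measurable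
qed auto

lemma integrable_wave:
  assumes h: "band b h" and b: "0 \<le> b"
  shows "integrable lborel (\<lambda>\<xi>. cis (x \<bullet> \<xi>) *s evol m t \<xi> (h \<xi>))"
  by (intro integrable_cis_smult band_L1[OF band_evol[OF h] b]) measurable

lemma wave_has_derivative_time:
  assumes h: "band b h" and b: "0 \<le> b"
  shows "((\<lambda>t. wave m h t x) has_vector_derivative wave m (\<lambda>\<xi>. - gen m \<xi> (h \<xi>)) t x) (at t)"
  unfolding wave_def osc_def
proof (rule has_vector_derivative_integral_param)
  have [measurable]: "h \<in> borel_measurable borel" using h by (rule band_measurable)
  show "integrable lborel (\<lambda>\<xi>. norm (- gen m \<xi> (h \<xi>)))"
    using band_L1(1)[OF band_gen[OF h] b] by (rule integrable_norm)
  show "integrable lborel (\<lambda>\<xi>. cis (1 * (x \<bullet> \<xi>)) *s evol m s \<xi> (h \<xi>))" for s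
    using integrable_wave[OF h b] by simp
  show "((\<lambda>s. cis (1 * (x \<bullet> \<xi>)) *s evol m s \<xi> (h \<xi>)) has_vector_derivative
         cis (1 * (x \<bullet> \<xi>)) *s evol m s \<xi> (- gen m \<xi> (h \<xi>))) (at s)" for s \<xi>
    using bounded_linear.has_vector_derivative[OF bounded_linear_smult_right evol_has_derivative[of m \<xi> "h \<xi>" s UNIV]]
    by (simp add: evol_gen[symmetric] evol_smult[of _ _ _ "- 1", simplified])
  show "(\<lambda>\<xi>. cis (1 * (x \<bullet> \<xi>)) *s evol m s \<xi> (- gen m \<xi> (h \<xi>))) \<in> borel_measurable lborel" for s
    by measurable
qed (auto simp: norm_vector_smult)

lemma cis_has_vector_derivative:
  "((\<lambda>s. cis (a + s * c)) has_vector_derivative c *\<^sub>R (\<i> * cis (a + s * c))) (at s)"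
proof -
  have "((\<lambda>z. exp (\<i> * (of_real a + z * of_real c))) has_field_derivative
      exp (\<i> * (of_real a + of_real s * of_real c)) * (\<i> * of_real c)) (at (of_real s))"
    by (auto intro!: derivative_eq_intros)
  from has_vector_derivative_real_field[OF this] show ?thesis
    by (simp add: cis_conv_exp scaleR_conv_of_real mult_ac)
qed

lemma wave_has_derivative_space:
  assumes h: "band b h" and b: "0 \<le> b"
  shows "((\<lambda>s. wave m h t (x + s *\<^sub>R e)) has_vector_derivative wave m (\<lambda>\<xi>. (\<i> * of_real (e \<bullet> \<xi>)) *s h \<xi>) t (x + s *\<^sub>R e)) (at s)"
  unfolding wave_def osc_def
proof (rule has_vector_derivative_integral_param)
  have [measurable]: "h \<in> borel_measurable borel" using h by (rule band_measurable)
  show "integrable lborel (\<lambda>\<xi>. norm ((\<i> * of_real (e \<bullet> \<xi>)) *s h \<xi>))"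
    using band_L1(1)[OF band_diff[OF h] b] by (rule integrable_norm)
  show "integrable lborel (\<lambda>\<xi>. cis (1 * ((x + s *\<^sub>R e) \<bullet> \<xi>)) *s evol m t \<xi> (h \<xi>))" for s
    using integrable_wave[OF h b] by simp
  show "((\<lambda>s. cis (1 * ((x + s *\<^sub>R e) \<bullet> \<xi>)) *s evol m t \<xi> (h \<xi>)) has_vector_derivative
         cis (1 * ((x + s *\<^sub>R e) \<bullet> \<xi>)) *s evol m t \<xi> ((\<i> * of_real (e \<bullet> \<xi>)) *s h \<xi>)) (at s)" for s \<xi>
  proof -
    have "((\<lambda>s. cis (1 * ((x + s *\<^sub>R e) \<bullet> \<xi>))) has_vector_derivative
        (e \<bullet> \<xi>) *\<^sub>R (\<i> * cis (1 * ((x + s *\<^sub>R e) \<bullet> \<xi>)))) (at s)"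
      using cis_has_vector_derivative[of "x \<bullet> \<xi>" "e \<bullet> \<xi>" s] by (simp add: inner_add_left)
    from bounded_linear.has_vector_derivative[OF bounded_bilinear.bounded_linear_left[OF bounded_bilinear_smult] this, of "evol m t \<xi> (h \<xi>)"]
    show ?thesis
      by (simp add: evol_smult vec_eq_iff scaleR_conv_complex mult_ac)
  qed
  show "(\<lambda>\<xi>. cis (1 * ((x + s *\<^sub>R e) \<bullet> \<xi>)) *s evol m t \<xi> ((\<i> * of_real (e \<bullet> \<xi>)) *s h \<xi>)) \<in> borel_measurable lborel" for s
    by measurable
qed (auto simp: norm_vector_smult norm_mult)

section \<open>Energy flux through null planes\<close>

lemma band_square_integrable: "band b h \<Longrightarrow> square_integrable lborel h"
  by (simp add: band_def square_integrable_iff_L2sq)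

lemma wave_square_integrable:
  assumes "band b h" "0 \<le> b" shows "square_integrable lborel (wave m h t)"
proof -
  have [measurable]: "h \<in> borel_measurable borel" using assms by (auto intro: band_measurable)
  have "L2sq lborel (wave m h t) < \<infinity>"
    using wave_L2sq_le[OF assms, of m t] assms
    by (auto simp: band_def ennreal_mult_less_top intro: le_less_trans)
  then show ?thesis by (simp add: square_integrable_iff_L2sq)
qed

lemma wave_L2_le:
  assumes "band b h" "0 \<le> b"
  shows "L2_norm lborel (wave m h t) \<le> sqrt ((2 * pi) ^ 3) * L2_norm lborel h"
proof -
  have "ennreal ((L2_norm lborel (wave m h t))\<^sup>2) \<le> ennreal ((2 * pi) ^ 3 * (L2_norm lborel h)\<^sup>2)"
    using wave_L2sq_le[OF assms, of m t] square_integrable_L2sq[OF wave_square_integrable[OF assms]]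
      square_integrable_L2sq[OF band_square_integrable[OF assms(1)]] by (simp add: ennreal_mult)
  then have "(L2_norm lborel (wave m h t))\<^sup>2 \<le> (2 * pi) ^ 3 * (L2_norm lborel h)\<^sup>2"
    by (subst (asm) ennreal_le_iff) auto
  then have "sqrt ((L2_norm lborel (wave m h t))\<^sup>2) \<le> sqrt ((2 * pi) ^ 3 * (L2_norm lborel h)\<^sup>2)"
    by (rule real_sqrt_le_mono)
  then show ?thesis by (simp add: L2_norm_nonneg real_sqrt_mult)
qed

text \<open>This covers all terms of the flux identity: the components of the current directly, and
  plain inner products through two factors \<open>dsym 1 0\<close>, since \<beta> squares to the
  identity.\<close>

lemma bounded_mult_inner_integrable:
  fixes u v :: "'a \<Rightarrow> complex^4"
  assumes u: "square_integrable M u" and v: "square_integrable M v"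
    and [measurable]: "a \<in> borel_measurable M" and a: "\<And>x. \<bar>a x\<bar> \<le> c"
  shows "integrable M (\<lambda>x. a x * (u x \<bullet> dsym n \<zeta> (v x)))"
    and "(\<integral>x. \<bar>a x * (u x \<bullet> dsym n \<zeta> (v x))\<bar> \<partial>M) \<le> c * sqrt (n\<^sup>2 + (norm \<zeta>)\<^sup>2) * (L2_norm M u * L2_norm M v)"
proof -
  have [measurable]: "u \<in> borel_measurable M" "v \<in> borel_measurable M"
    using u v by (auto simp: square_integrable_def)
  have c: "0 \<le> c" using a by (meson abs_ge_zero order_trans)
  have le: "\<bar>a x * (u x \<bullet> dsym n \<zeta> (v x))\<bar> \<le> c * sqrt (n\<^sup>2 + (norm \<zeta>)\<^sup>2) * (norm (u x) * norm (v x))" for x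
  proof -
    have "\<bar>u x \<bullet> dsym n \<zeta> (v x)\<bar> \<le> norm (u x) * norm (dsym n \<zeta> (v x))" by (rule Cauchy_Schwarz_ineq2)
    then have "\<bar>a x\<bar> * \<bar>u x \<bullet> dsym n \<zeta> (v x)\<bar> \<le> c * (norm (u x) * norm (dsym n \<zeta> (v x)))"
      using a c by (intro mult_mono) auto
    then show ?thesis by (simp add: abs_mult norm_dsym mult_ac)
  qed
  have I: "integrable M (\<lambda>x. c * sqrt (n\<^sup>2 + (norm \<zeta>)\<^sup>2) * (norm (u x) * norm (v x)))"
    by (intro integrable_mult_right square_integrable_mult_norm u v)
  show *: "integrable M (\<lambda>x. a x * (u x \<bullet> dsym n \<zeta> (v x)))"
    by (rule Bochner_Integration.integrable_bound[OF I])
       (use le c in \<open>auto intro!: order_trans[OF le] simp: abs_mult\<close>)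
  have "(\<integral>x. \<bar>a x * (u x \<bullet> dsym n \<zeta> (v x))\<bar> \<partial>M) \<le> (\<integral>x. c * sqrt (n\<^sup>2 + (norm \<zeta>)\<^sup>2) * (norm (u x) * norm (v x)) \<partial>M)"
    by (rule Bochner_Integration.integral_mono[OF integrable_abs[OF *] I le])
  also have "\<dots> = c * sqrt (n\<^sup>2 + (norm \<zeta>)\<^sup>2) * (\<integral>x. norm (u x) * norm (v x) \<partial>M)"
    by (rule integral_mult_right_zero)
  also have "\<dots> \<le> c * sqrt (n\<^sup>2 + (norm \<zeta>)\<^sup>2) * (L2_norm M u * L2_norm M v)"
    using c by (intro mult_left_mono L2_cauchy_schwarz u v) auto
  finally show "(\<integral>x. \<bar>a x * (u x \<bullet> dsym n \<zeta> (v x))\<bar> \<partial>M) \<le> c * sqrt (n\<^sup>2 + (norm \<zeta>)\<^sup>2) * (L2_norm M u * L2_norm M v)" .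
qed

lemma osc_linear_image:
  assumes f: "integrable lborel f" and L: "bounded_linear L" and s: "\<And>c v. L (c *s v) = c *s L (v::complex^4)"
  shows "L (osc s' f x) = osc s' (\<lambda>\<xi>. L (f \<xi>) :: complex^4) (x::real^3)"
  unfolding osc_def
  by (subst integral_bounded_linear[OF L, symmetric]) (auto intro!: integrable_cis_smult f simp: s)

lemma wave_linear_image:
  assumes h: "band b h" and b: "0 \<le> b"
  shows "dsym 0 \<zeta> (wave m h t x) = osc 1 (\<lambda>\<xi>. dsym 0 \<zeta> (evol m t \<xi> (h \<xi>))) x"
    and "\<i> *s dsym 1 0 (wave m h t x) = osc 1 (\<lambda>\<xi>. \<i> *s dsym 1 0 (evol m t \<xi> (h \<xi>))) x"
proof -
  note i = band_L1(1)[OF band_evol[OF h] b, of m t]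
  show "dsym 0 \<zeta> (wave m h t x) = osc 1 (\<lambda>\<xi>. dsym 0 \<zeta> (evol m t \<xi> (h \<xi>))) x"
    unfolding wave_def by (rule osc_linear_image[OF i bounded_linear_dsym dsym_smult])
  show "\<i> *s dsym 1 0 (wave m h t x) = osc 1 (\<lambda>\<xi>. \<i> *s dsym 1 0 (evol m t \<xi> (h \<xi>))) x"
    unfolding wave_def
    by (rule osc_linear_image[OF i bounded_linear_compose[OF bounded_linear_smult_right bounded_linear_dsym]])
       (simp add: dsym_smult mult.commute)
qed

text \<open>The Dirac equation in physical space; the multiplier
  \<open>\<i> * of_real (axis k 1 \<bullet> \<xi>)\<close> is the partial derivative in direction
  \<open>axis k 1\<close>.\<close>

lemma wave_equation:
  assumes h: "band b h" and b: "0 \<le> b"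
  shows "wave m (\<lambda>\<xi>. - gen m \<xi> (h \<xi>)) t x
    = - (\<Sum>k\<in>UNIV. dsym 0 (axis k 1) (wave m (\<lambda>\<xi>. (\<i> * of_real (axis k 1 \<bullet> \<xi>)) *s h \<xi>) t x))
      - m *\<^sub>R (\<i> *s dsym 1 0 (wave m h t x))"
proof -
  have d: "band b (\<lambda>\<xi>. (\<i> * of_real (axis k 1 \<bullet> \<xi>)) *s h \<xi>)" for k :: 3 by (rule band_diff[OF h])
  let ?e = "\<lambda>\<xi>. evol m t \<xi> (h \<xi>)"
  have dk: "dsym 0 (axis k 1) (evol m t \<xi> ((\<i> * of_real (axis k 1 \<bullet> \<xi>)) *s h \<xi>))
     = \<i> *s ((\<xi> $ k) *\<^sub>R dsym 0 (axis k 1) (?e \<xi>))" for k :: 3 and \<xi>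
    by (simp add: evol_smult dsym_smult inner_axis' vec_eq_iff scaleR_conv_complex)
  have i1: "integrable lborel (\<lambda>\<xi>. dsym 0 (axis k 1) (evol m t \<xi> ((\<i> * of_real (axis k 1 \<bullet> \<xi>)) *s h \<xi>)))" for k :: 3
    by (rule integrable_bounded_linear[OF bounded_linear_dsym band_L1(1)[OF band_evol[OF d] b]])
  have i2: "integrable lborel (\<lambda>\<xi>. \<i> *s dsym 1 0 (?e \<xi>))"
    by (rule integrable_bounded_linear[OF bounded_linear_compose[OF bounded_linear_smult_right bounded_linear_dsym] band_L1(1)[OF band_evol[OF h] b]])
  have i3: "integrable lborel (\<lambda>\<xi>. evol m t \<xi> (- gen m \<xi> (h \<xi>)))"
    by (rule band_L1(1)[OF band_evol[OF band_gen[OF h]] b])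
  have e: "evol m t \<xi> (- gen m \<xi> (h \<xi>)) =
      - (\<Sum>k\<in>UNIV. dsym 0 (axis k 1) (evol m t \<xi> ((\<i> * of_real (axis k 1 \<bullet> \<xi>)) *s h \<xi>)))
      - m *\<^sub>R (\<i> *s dsym 1 0 (?e \<xi>))" for \<xi>
  proof -
    have "evol m t \<xi> (- gen m \<xi> (h \<xi>)) = - gen m \<xi> (?e \<xi>)"
      using evol_smult[of m t \<xi> "- 1" "gen m \<xi> (h \<xi>)"] by (simp add: evol_gen)
    also have "\<dots> = - (\<i> *s (\<Sum>k\<in>UNIV. (\<xi> $ k) *\<^sub>R dsym 0 (axis k 1) (?e \<xi>))) - m *\<^sub>R (\<i> *s dsym 1 0 (?e \<xi>))"
      unfolding gen_def by (subst dsym_decomp) (simp add: smult_add smult_scaleR)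
    also have "\<i> *s (\<Sum>k\<in>UNIV. (\<xi> $ k) *\<^sub>R dsym 0 (axis k 1) (?e \<xi>))
       = (\<Sum>k\<in>UNIV. \<i> *s ((\<xi> $ k) *\<^sub>R dsym 0 (axis k 1) (?e \<xi>)))"
      by (simp add: sum_3 smult_add)
    finally show ?thesis unfolding dk .
  qed
  let ?c = "\<lambda>\<xi>. cis (1 * (x \<bullet> \<xi>))"
  have c: "integrable lborel (\<lambda>\<xi>. ?c \<xi> *s f \<xi>)" if "integrable lborel f" for f :: "real^3 \<Rightarrow> complex^4"
    using that by (rule integrable_cis_smult) measurable
  have "wave m (\<lambda>\<xi>. - gen m \<xi> (h \<xi>)) t x = (\<integral>\<xi>. - (\<Sum>k\<in>UNIV. ?c \<xi> *s dsym 0 (axis k 1) (evol m t \<xi> ((\<i> * of_real (axis k 1 \<bullet> \<xi>)) *s h \<xi>)))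
      - m *\<^sub>R (?c \<xi> *s (\<i> *s dsym 1 0 (?e \<xi>))) \<partial>lborel)"
    unfolding wave_def osc_def e
    by (intro Bochner_Integration.integral_cong refl) (simp add: sum_3 vec_eq_iff algebra_simps scaleR_conv_complex)
  also have "\<dots> = - (\<Sum>k\<in>UNIV. \<integral>\<xi>. ?c \<xi> *s dsym 0 (axis k 1) (evol m t \<xi> ((\<i> * of_real (axis k 1 \<bullet> \<xi>)) *s h \<xi>)) \<partial>lborel)
      - m *\<^sub>R (\<integral>\<xi>. ?c \<xi> *s (\<i> *s dsym 1 0 (?e \<xi>)) \<partial>lborel)"
    using c[OF i1] c[OF i2] by (simp add: Bochner_Integration.integral_sum)
  finally show ?thesis
    unfolding wave_linear_image[OF d b] wave_linear_image(2)[OF h b] osc_def .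
qed

lemma has_vector_derivative_continuous_on_UNIV:
  assumes "\<And>s. (f has_vector_derivative f' s) (at s)"
  shows "continuous_on UNIV f"
  using assms by (meson continuous_at_imp_continuous_on has_vector_derivative_continuous)

text \<open>The conserved current is multiplied by \<open>W\<close> of the null variable, where
  \<open>W\<close> is a bounded nonnegative antiderivative of \<open>w\<close>. The only new term is
  \<open>w\<close> times the flux density, identified by \<open>hproj_norm\<close>. Integration over
  space-time removes the spatial divergence and leaves the weighted masses at the two end
  times.\<close>

theorem null_flux:
  assumes h: "band b h" and b: "0 \<le> b" and \<eta>: "\<eta> \<noteq> 0" and t12: "t1 \<le> t2"
    and wc: "continuous_on UNIV w" and wi: "integrable lborel w" and w0: "\<And>s. 0 \<le> w s" and wb: "\<And>s. w s \<le> wm"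
  shows "(\<integral>\<^sup>+t. indicator {t1..t2} t * (\<integral>\<^sup>+x. ennreal (2 * norm \<eta> * (w (x \<bullet> \<eta> - t * norm \<eta>) * (norm (hproj \<eta> (wave m h t x)))\<^sup>2)) \<partial>lborel) \<partial>lborel)
     \<le> ennreal (\<integral>s. w s \<partial>lborel) * L2sq lborel (wave m h t1)"
proof -
  obtain W where W: "\<And>s. (W has_real_derivative w s) (at s)" and W0: "\<And>s. 0 \<le> W s" and W1: "\<And>s. W s \<le> (\<integral>s. w s \<partial>lborel)"
    using exists_antiderivative[OF wc wi w0] by metis
  define C where "C = (\<integral>s. w s \<partial>lborel)"
  have Wc: "continuous_on UNIV W" using W by (meson DERIV_isCont continuous_at_imp_continuous_on)
  have [measurable]: "W \<in> borel_measurable borel" "w \<in> borel_measurable borel"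
    using Wc wc by (auto intro: borel_measurable_continuous_onI)
  have [measurable]: "h \<in> borel_measurable borel" using h by (rule band_measurable)
  define \<Psi> where "\<Psi> = wave m h"
  define P where "P = wave m (\<lambda>\<xi>. - gen m \<xi> (h \<xi>))"
  define D where "D k = wave m (\<lambda>\<xi>. (\<i> * of_real (axis k 1 \<bullet> \<xi>)) *s h \<xi>)" for k :: 3
  define \<theta> where "\<theta> t x = x \<bullet> \<eta> - t * norm \<eta>" for t :: real and x :: "real^3"
  have Dband: "band b (\<lambda>\<xi>. (\<i> * of_real (axis k 1 \<bullet> \<xi>)) *s h \<xi>)" for k :: 3 by (rule band_diff[OF h])
  have [measurable]: "f \<in> borel_measurable N \<Longrightarrow> g \<in> borel_measurable N \<Longrightarrow> (\<lambda>p. \<Psi> (f p) (g p)) \<in> borel_measurable N"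
     "f \<in> borel_measurable N \<Longrightarrow> g \<in> borel_measurable N \<Longrightarrow> (\<lambda>p. P (f p) (g p)) \<in> borel_measurable N"
     "f \<in> borel_measurable N \<Longrightarrow> g \<in> borel_measurable N \<Longrightarrow> (\<lambda>p. D k (f p) (g p)) \<in> borel_measurable N" for f g k and N :: "'z measure"
    unfolding \<Psi>_def P_def D_def
    by (auto intro!: wave_measurable band_measurable[OF h] band_measurable[OF band_gen[OF h]] band_measurable[OF Dband])
  have d\<Psi>t: "((\<lambda>t. \<Psi> t x) has_vector_derivative P t x) (at t)" for t x
    unfolding \<Psi>_def P_def by (rule wave_has_derivative_time[OF h b])
  have dPt: "continuous_on UNIV (\<lambda>t. P t x)" for x
    unfolding P_def by (rule has_vector_derivative_continuous_on_UNIV[OF wave_has_derivative_time[OF band_gen[OF h] b]])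
  have d\<Psi>tc: "continuous_on UNIV (\<lambda>t. \<Psi> t x)" for x
    using d\<Psi>t by (rule has_vector_derivative_continuous_on_UNIV)
  have d\<Psi>x: "((\<lambda>s. \<Psi> t (x + s *\<^sub>R axis k 1)) has_vector_derivative D k t (x + s *\<^sub>R axis k 1)) (at s)" for k t x s
    unfolding \<Psi>_def D_def by (rule wave_has_derivative_space[OF h b])
  have d\<Psi>xc: "continuous_on UNIV (\<lambda>s. \<Psi> t (x + s *\<^sub>R axis k 1))" for t x and k :: 3
    using d\<Psi>x by (rule has_vector_derivative_continuous_on_UNIV)
  have dDx: "continuous_on UNIV (\<lambda>s. D k t (x + s *\<^sub>R axis k 1))" for k t x
    unfolding D_def by (rule has_vector_derivative_continuous_on_UNIV[OF wave_has_derivative_space[OF Dband b]])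
  have s\<Psi>: "square_integrable lborel (\<Psi> t)" for t unfolding \<Psi>_def by (rule wave_square_integrable[OF h b])
  have sP: "square_integrable lborel (P t)" for t unfolding P_def by (rule wave_square_integrable[OF band_gen[OF h] b])
  have sD: "square_integrable lborel (D k t)" for k t unfolding D_def by (rule wave_square_integrable[OF Dband b])
  \<comment> \<open>\<beta> squares to the identity; in this form plain inner products fit
    \<open>bounded_mult_inner_integrable\<close>.\<close>
  have id: "v \<bullet> u = v \<bullet> dsym 1 0 (dsym 1 0 u)" for v u by (simp add: dsym_dsym)

  \<comment> \<open>\<open>J\<close> and \<open>K k\<close> are the weighted density and current;
    the primed functions are their derivatives in \<open>t\<close> and in direction
    \<open>axis k 1\<close>.\<close>
  define J where "J t x = W (\<theta> t x) * (\<Psi> t x \<bullet> \<Psi> t x)" for t x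
  define J' where "J' t x = - (norm \<eta> * w (\<theta> t x)) * (\<Psi> t x \<bullet> \<Psi> t x) + W (\<theta> t x) * (2 * (\<Psi> t x \<bullet> P t x))" for t x
  define K where "K k t x = W (\<theta> t x) * (\<Psi> t x \<bullet> dsym 0 (axis k 1) (\<Psi> t x))" for k :: 3 and t x
  define K' where "K' k t x = (\<eta> $ k * w (\<theta> t x)) * (\<Psi> t x \<bullet> dsym 0 (axis k 1) (\<Psi> t x))
      + W (\<theta> t x) * (2 * (\<Psi> t x \<bullet> dsym 0 (axis k 1) (D k t x)))" for k :: 3 and t x

  have dJ: "((\<lambda>t. J t x) has_real_derivative J' t x) (at t)" for t x
  proof -
    have "((\<lambda>t. \<theta> t x) has_real_derivative - norm \<eta>) (at t)"
      unfolding \<theta>_def by (auto intro!: derivative_eq_intros)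
    then have 1: "((\<lambda>t. W (\<theta> t x)) has_real_derivative w (\<theta> t x) * - norm \<eta>) (at t)"
      by (rule DERIV_chain2[OF W])
    have 2: "((\<lambda>t. \<Psi> t x \<bullet> \<Psi> t x) has_real_derivative \<Psi> t x \<bullet> P t x + P t x \<bullet> \<Psi> t x) (at t)"
      unfolding has_real_derivative_iff_has_vector_derivative
      by (rule bounded_bilinear.has_vector_derivative[OF bounded_bilinear_inner d\<Psi>t d\<Psi>t])
    from DERIV_mult[OF 1 2] show ?thesis
      unfolding J_def J'_def by (simp add: inner_commute algebra_simps)
  qed
  have dK: "((\<lambda>s. K k t (x + s *\<^sub>R axis k 1)) has_real_derivative K' k t (x + s *\<^sub>R axis k 1)) (at s)" for k t x s
  proof -
    have "((\<lambda>s. \<theta> t (x + s *\<^sub>R axis k 1)) has_real_derivative \<eta> $ k) (at s)"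
      unfolding \<theta>_def by (auto intro!: derivative_eq_intros simp: inner_add_left inner_axis')
    then have 1: "((\<lambda>s. W (\<theta> t (x + s *\<^sub>R axis k 1))) has_real_derivative w (\<theta> t (x + s *\<^sub>R axis k 1)) * \<eta> $ k) (at s)"
      by (rule DERIV_chain2[OF W])
    have 2: "((\<lambda>s. \<Psi> t (x + s *\<^sub>R axis k 1) \<bullet> dsym 0 (axis k 1) (\<Psi> t (x + s *\<^sub>R axis k 1))) has_real_derivative
        \<Psi> t (x + s *\<^sub>R axis k 1) \<bullet> dsym 0 (axis k 1) (D k t (x + s *\<^sub>R axis k 1))
        + D k t (x + s *\<^sub>R axis k 1) \<bullet> dsym 0 (axis k 1) (\<Psi> t (x + s *\<^sub>R axis k 1))) (at s)"
      unfolding has_real_derivative_iff_has_vector_derivative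
      by (rule bounded_bilinear.has_vector_derivative[OF bounded_bilinear_inner d\<Psi>x
             bounded_linear.has_vector_derivative[OF bounded_linear_dsym d\<Psi>x]])
    have 3: "D k t y \<bullet> dsym 0 (axis k 1) (\<Psi> t y) = \<Psi> t y \<bullet> dsym 0 (axis k 1) (D k t y)" for y
      by (metis inner_commute inner_dsym)
    from DERIV_mult[OF 1 2] show ?thesis
      unfolding K_def K'_def 3 by (simp add: algebra_simps)
  qed
  have div: "J' t x + (\<Sum>k\<in>UNIV. K' k t x) = - (2 * norm \<eta> * (w (\<theta> t x) * (norm (hproj \<eta> (\<Psi> t x)))\<^sup>2))" for t x
  proof -
    \<comment> \<open>The mass term is skew-adjoint and drops out of the real inner product, so the
      current is conserved for every \<open>m\<close>.\<close>
    have b0: "\<Psi> t x \<bullet> (\<i> *s dsym 1 0 (\<Psi> t x)) = 0"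
      using inner_gen[of 1 0 "\<Psi> t x" "\<Psi> t x"] by (simp add: gen_def inner_commute)
    have "P t x = - (\<Sum>k\<in>UNIV. dsym 0 (axis k 1) (D k t x)) - m *\<^sub>R (\<i> *s dsym 1 0 (\<Psi> t x))"
      unfolding P_def D_def \<Psi>_def by (rule wave_equation[OF h b])
    then have p: "\<Psi> t x \<bullet> P t x = - (\<Sum>k\<in>UNIV. \<Psi> t x \<bullet> dsym 0 (axis k 1) (D k t x))"
      by (simp add: inner_diff_right b0 inner_sum_right)
    have "dsym 0 \<eta> (\<Psi> t x) = (\<Sum>k\<in>UNIV. (\<eta> $ k) *\<^sub>R dsym 0 (axis k 1) (\<Psi> t x))"
      by (subst dsym_decomp) simp
    then have q: "\<Psi> t x \<bullet> dsym 0 \<eta> (\<Psi> t x) = (\<Sum>k\<in>UNIV. \<eta> $ k * (\<Psi> t x \<bullet> dsym 0 (axis k 1) (\<Psi> t x)))"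
      by (simp add: inner_sum_right)
    have "2 * norm \<eta> * (norm (hproj \<eta> (\<Psi> t x)))\<^sup>2 = norm \<eta> * (\<Psi> t x \<bullet> \<Psi> t x) - (\<Sum>k\<in>UNIV. \<eta> $ k * (\<Psi> t x \<bullet> dsym 0 (axis k 1) (\<Psi> t x)))"
      using hproj_norm[OF \<eta>, of "\<Psi> t x"] by (simp only: q power2_norm_eq_inner)
    then have "2 * norm \<eta> * (w (\<theta> t x) * (norm (hproj \<eta> (\<Psi> t x)))\<^sup>2)
       = w (\<theta> t x) * (norm \<eta> * (\<Psi> t x \<bullet> \<Psi> t x) - (\<Sum>k\<in>UNIV. \<eta> $ k * (\<Psi> t x \<bullet> dsym 0 (axis k 1) (\<Psi> t x))))"
      by (simp only: mult_ac)
    then show ?thesis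
      unfolding J'_def K'_def p by (simp add: sum_3 algebra_simps)
  qed

  have Wabs: "\<bar>W s\<bar> \<le> C" for s using W0[of s] W1[of s] by (simp add: C_def)
  have wabs: "\<bar>w s\<bar> \<le> wm" for s using w0[of s] wb[of s] by simp
  have [measurable]: "(\<lambda>x. \<theta> (f x) (g x)) \<in> borel_measurable N" if [measurable]: "f \<in> borel_measurable N" "g \<in> borel_measurable N" for N :: "'z measure" and f g
    unfolding \<theta>_def by measurable
  have sB: "square_integrable lborel (\<lambda>x. dsym 1 0 (\<Psi> t x))" "square_integrable lborel (\<lambda>x. dsym 1 0 (P t x))" for t
    using s\<Psi>[of t] sP[of t] by (simp_all add: square_integrable_iff_L2sq L2sq_def norm_dsym)
  have LB: "L2_norm lborel (\<lambda>x. dsym 1 0 (u x)) = L2_norm lborel u" for u :: "real^3 \<Rightarrow> complex^4"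
    by (simp add: L2_norm_def norm_dsym)
  have IJ: "integrable lborel (J t)" for t
    unfolding J_def id[of _ "\<Psi> _ _"]
    by (rule bounded_mult_inner_integrable(1)[OF s\<Psi> sB(1) _ Wabs]) measurable
  have IK: "integrable lborel (K k t)" for k t
    unfolding K_def by (rule bounded_mult_inner_integrable(1)[OF s\<Psi> s\<Psi> _ Wabs]) measurable
  have IK': "integrable lborel (K' k t)" for k t
  proof -
    have 1: "\<bar>\<eta> $ k * w (\<theta> t x)\<bar> \<le> \<bar>\<eta> $ k\<bar> * wm" for x
      unfolding abs_mult by (intro mult_left_mono wabs) simp
    have 2: "\<bar>W (\<theta> t x) * 2\<bar> \<le> C * 2" for x using Wabs by (simp add: abs_mult)
    show ?thesis
      unfolding K'_def mult.assoc[of "W _" 2, symmetric]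
      by (intro Bochner_Integration.integrable_add bounded_mult_inner_integrable(1)[OF s\<Psi> s\<Psi> _ 1] bounded_mult_inner_integrable(1)[OF s\<Psi> sD _ 2]) measurable
  qed
  \<comment> \<open>A bound for the L1 norm of \<open>J' t\<close> that does not depend on
    \<open>t\<close>. It makes the integral of \<open>J'\<close> over the time slab absolutely
    convergent, as Fubini requires.\<close>
  define B where "B = norm \<eta> * wm * (sqrt ((2 * pi) ^ 3) * L2_norm lborel h)\<^sup>2
     + C * 2 * (sqrt ((2 * pi) ^ 3) * L2_norm lborel h * (sqrt ((2 * pi) ^ 3) * L2_norm lborel (\<lambda>\<xi>. - gen m \<xi> (h \<xi>))))"
  have IJ': "integrable lborel (J' t)" and BJ': "(\<integral>x. \<bar>J' t x\<bar> \<partial>lborel) \<le> B" for t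
  proof -
    have 1: "\<bar>- (norm \<eta> * w (\<theta> t x))\<bar> \<le> norm \<eta> * wm" for x
      unfolding abs_mult abs_minus_cancel by (simp add: mult_left_mono wabs)
    have 2: "\<bar>W (\<theta> t x) * 2\<bar> \<le> C * 2" for x using Wabs by (simp add: abs_mult)
    have wm0: "0 \<le> wm" using wabs[of 0] by linarith
    have C0: "0 \<le> C" using Wabs[of 0] by linarith
    have one: "sqrt (1\<^sup>2 + (norm (0::real^3))\<^sup>2) = 1" by simp
    have A1: "L2_norm lborel (\<Psi> t) * L2_norm lborel (\<Psi> t) \<le> (sqrt ((2 * pi) ^ 3) * L2_norm lborel h)\<^sup>2"
      unfolding \<Psi>_def power2_eq_square
      by (intro mult_mono wave_L2_le[OF h b] mult_nonneg_nonneg L2_norm_nonneg real_sqrt_ge_zero) auto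
    have A2: "L2_norm lborel (\<Psi> t) * L2_norm lborel (P t) \<le> sqrt ((2 * pi) ^ 3) * L2_norm lborel h * (sqrt ((2 * pi) ^ 3) * L2_norm lborel (\<lambda>\<xi>. - gen m \<xi> (h \<xi>)))"
      unfolding \<Psi>_def P_def
      by (intro mult_mono wave_L2_le[OF h b] wave_L2_le[OF band_gen[OF h] b] mult_nonneg_nonneg L2_norm_nonneg real_sqrt_ge_zero) auto
    let ?a = "\<lambda>x. - (norm \<eta> * w (\<theta> t x)) * (\<Psi> t x \<bullet> dsym 1 0 (dsym 1 0 (\<Psi> t x)))"
    let ?b = "\<lambda>x. W (\<theta> t x) * 2 * (\<Psi> t x \<bullet> dsym 1 0 (dsym 1 0 (P t x)))"
    have eq: "J' t x = ?a x + ?b x" for x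
      unfolding J'_def id[symmetric] by simp
    have A: "integrable lborel ?a" by (rule bounded_mult_inner_integrable(1)[OF s\<Psi> sB(1) _ 1]) measurable
    have Bb: "integrable lborel ?b" by (rule bounded_mult_inner_integrable(1)[OF s\<Psi> sB(2) _ 2]) measurable
    show I: "integrable lborel (J' t)" unfolding eq[abs_def] by (rule Bochner_Integration.integrable_add[OF A Bb])
    have "(\<integral>x. \<bar>J' t x\<bar> \<partial>lborel) \<le> (\<integral>x. \<bar>?a x\<bar> + \<bar>?b x\<bar> \<partial>lborel)"
      by (rule Bochner_Integration.integral_mono[OF integrable_abs[OF I] Bochner_Integration.integrable_add[OF integrable_abs[OF A] integrable_abs[OF Bb]]])
         (simp only: eq abs_triangle_ineq)
    also have "\<dots> = (\<integral>x. \<bar>?a x\<bar> \<partial>lborel) + (\<integral>x. \<bar>?b x\<bar> \<partial>lborel)"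
      by (rule Bochner_Integration.integral_add[OF integrable_abs[OF A] integrable_abs[OF Bb]])
    also have "(\<integral>x. \<bar>?a x\<bar> \<partial>lborel) \<le> norm \<eta> * wm * sqrt (1\<^sup>2 + (norm (0::real^3))\<^sup>2) * (L2_norm lborel (\<Psi> t) * L2_norm lborel (\<lambda>x. dsym 1 0 (\<Psi> t x)))"
      by (rule bounded_mult_inner_integrable(2)[OF s\<Psi> sB(1) _ 1]) measurable
    also have "(\<integral>x. \<bar>?b x\<bar> \<partial>lborel) \<le> C * 2 * sqrt (1\<^sup>2 + (norm (0::real^3))\<^sup>2) * (L2_norm lborel (\<Psi> t) * L2_norm lborel (\<lambda>x. dsym 1 0 (P t x)))"
      by (rule bounded_mult_inner_integrable(2)[OF s\<Psi> sB(2) _ 2]) measurable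
    also have "norm \<eta> * wm * sqrt (1\<^sup>2 + (norm (0::real^3))\<^sup>2) * (L2_norm lborel (\<Psi> t) * L2_norm lborel (\<lambda>x. dsym 1 0 (\<Psi> t x)))
        \<le> norm \<eta> * wm * (sqrt ((2 * pi) ^ 3) * L2_norm lborel h)\<^sup>2"
      unfolding LB one mult_1_right by (intro mult_left_mono A1) (use wm0 in auto)
    also have "C * 2 * sqrt (1\<^sup>2 + (norm (0::real^3))\<^sup>2) * (L2_norm lborel (\<Psi> t) * L2_norm lborel (\<lambda>x. dsym 1 0 (P t x)))
        \<le> C * 2 * (sqrt ((2 * pi) ^ 3) * L2_norm lborel h * (sqrt ((2 * pi) ^ 3) * L2_norm lborel (\<lambda>\<xi>. - gen m \<xi> (h \<xi>))))"
      unfolding LB one mult_1_right by (intro mult_left_mono A2) (use C0 in auto)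
    finally show "(\<integral>x. \<bar>J' t x\<bar> \<partial>lborel) \<le> B" unfolding B_def by simp
  qed
  have [measurable]: "(\<lambda>p. J' (f p) (g p)) \<in> borel_measurable N" if [measurable]: "f \<in> borel_measurable N" "g \<in> borel_measurable N" for N :: "'z measure" and f g
    unfolding J'_def by measurable
  let ?i = "\<lambda>t. indicator {t1..t2} t :: real"
  have II: "integrable (lborel \<Otimes>\<^sub>M lborel) (\<lambda>(t, x). ?i t * J' t x)"
  proof (rule lborel_pair.Fubini_integrable)
    show "(\<lambda>(t, x). ?i t * J' t x) \<in> borel_measurable (lborel \<Otimes>\<^sub>M lborel)" by measurable
    show "AE t in lborel. integrable lborel (\<lambda>x. case (t, x) of (t, x) \<Rightarrow> ?i t * J' t x)" using IJ' by auto
    have Bi: "integrable lborel (\<lambda>t. ?i t * B)"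
      using t12 by (auto intro!: integrable_mult_left integrable_real_indicator simp: emeasure_lborel_Icc_eq)
    have "\<bar>?i t * (\<integral>x. \<bar>J' t x\<bar> \<partial>lborel)\<bar> \<le> ?i t * B" for t using BJ'[of t] by (auto simp: indicator_def)
    then have "integrable lborel (\<lambda>t. ?i t * (\<integral>x. \<bar>J' t x\<bar> \<partial>lborel))"
      by (intro Bochner_Integration.integrable_bound[OF Bi]) (auto intro!: AE_I2 order_trans[OF _ abs_ge_self])
    then show "integrable lborel (\<lambda>t. \<integral>x. norm (case (t, x) of (t, x) \<Rightarrow> ?i t * J' t x) \<partial>lborel)"
      by (simp add: abs_mult)
  qed
  have inner_t: "(\<integral>t. ?i t * J' t x \<partial>lborel) = J t2 x - J t1 x" for x
  proof -
    have "isCont (\<lambda>t. J' t x) t" for t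
    proof -
      have "continuous_on UNIV (\<lambda>t. J' t x)"
        unfolding J'_def \<theta>_def
        by (intro continuous_intros d\<Psi>tc dPt continuous_on_compose2[OF Wc] continuous_on_compose2[OF wc]) auto
      then show ?thesis by (simp add: continuous_on_eq_continuous_at)
    qed
    from integral_FTC_Icc_real[OF t12 dJ this] show ?thesis by (simp add: mult.commute)
  qed
  have zero: "(\<integral>x. K' k t x \<partial>lborel) = 0" for k t
  proof (rule integral_directional_derivative_zero[OF IK IK' dK])
    show "continuous_on UNIV (\<lambda>s. K' k t (x + s *\<^sub>R axis k 1))" for x
      unfolding K'_def \<theta>_def
      by (intro continuous_intros d\<Psi>xc dDx continuous_on_compose2[OF Wc] continuous_on_compose2[OF wc]
            bounded_linear.continuous_on[OF bounded_linear_dsym]) auto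
  qed
  \<comment> \<open>The divergence terms integrate to 0, so the flux at time \<open>t\<close> equals
    the rate at which the weighted mass decreases.\<close>
  have pos: "(\<integral>\<^sup>+x. ennreal (2 * norm \<eta> * (w (\<theta> t x) * (norm (hproj \<eta> (\<Psi> t x)))\<^sup>2)) \<partial>lborel) = ennreal (- (\<integral>x. J' t x \<partial>lborel))" 
    and pos0: "0 \<le> - (\<integral>x. J' t x \<partial>lborel)" for t
  proof -
    have eq: "2 * norm \<eta> * (w (\<theta> t x) * (norm (hproj \<eta> (\<Psi> t x)))\<^sup>2) = - (J' t x + (\<Sum>k\<in>UNIV. K' k t x))" for x
      unfolding div by simp
    have i: "integrable lborel (\<lambda>x. 2 * norm \<eta> * (w (\<theta> t x) * (norm (hproj \<eta> (\<Psi> t x)))\<^sup>2))"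
      unfolding eq by (intro integrable_minus Bochner_Integration.integrable_add Bochner_Integration.integrable_sum IJ' IK')
    have v: "(\<integral>x. 2 * norm \<eta> * (w (\<theta> t x) * (norm (hproj \<eta> (\<Psi> t x)))\<^sup>2) \<partial>lborel) = - (\<integral>x. J' t x \<partial>lborel)"
      unfolding eq using IJ'[of t] IK' zero
      by (simp add: Bochner_Integration.integral_add Bochner_Integration.integral_sum Bochner_Integration.integrable_sum)
    show "(\<integral>\<^sup>+x. ennreal (2 * norm \<eta> * (w (\<theta> t x) * (norm (hproj \<eta> (\<Psi> t x)))\<^sup>2)) \<partial>lborel) = ennreal (- (\<integral>x. J' t x \<partial>lborel))"
      unfolding v[symmetric] by (intro nn_integral_eq_integral i AE_I2) (simp add: w0)
    show "0 \<le> - (\<integral>x. J' t x \<partial>lborel)"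
      unfolding v[symmetric] by (intro Bochner_Integration.integral_nonneg) (simp add: w0)
  qed
  have It: "integrable lborel (\<lambda>t. ?i t * (\<integral>x. J' t x \<partial>lborel))"
    using lborel_pair.integrable_fst'[OF II] by simp
  have swap: "(\<integral>t. ?i t * (\<integral>x. J' t x \<partial>lborel) \<partial>lborel) = (\<integral>x. J t2 x \<partial>lborel) - (\<integral>x. J t1 x \<partial>lborel)"
  proof -
    have "(\<integral>t. ?i t * (\<integral>x. J' t x \<partial>lborel) \<partial>lborel) = (\<integral>t. \<integral>x. ?i t * J' t x \<partial>lborel \<partial>lborel)" by simp
    also have "\<dots> = (\<integral>x. \<integral>t. ?i t * J' t x \<partial>lborel \<partial>lborel)"
      by (rule lborel_pair.Fubini_integral[OF II, symmetric])
    also have "\<dots> = (\<integral>x. J t2 x - J t1 x \<partial>lborel)" unfolding inner_t ..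
    finally show ?thesis by (simp add: IJ)
  qed
  have "(\<integral>\<^sup>+t. indicator {t1..t2} t * (\<integral>\<^sup>+x. ennreal (2 * norm \<eta> * (w (x \<bullet> \<eta> - t * norm \<eta>) * (norm (hproj \<eta> (wave m h t x)))\<^sup>2)) \<partial>lborel) \<partial>lborel)
     = (\<integral>\<^sup>+t. ennreal (- (?i t * (\<integral>x. J' t x \<partial>lborel))) \<partial>lborel)"
    using pos unfolding \<theta>_def \<Psi>_def by (intro nn_integral_cong) (auto simp: indicator_def)
  also have "\<dots> = ennreal (\<integral>t. - (?i t * (\<integral>x. J' t x \<partial>lborel)) \<partial>lborel)"
    using It pos0 by (intro nn_integral_eq_integral integrable_minus AE_I2) (auto simp: indicator_def)
  also have "\<dots> = ennreal ((\<integral>x. J t1 x \<partial>lborel) - (\<integral>x. J t2 x \<partial>lborel))"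
    using swap by simp
  \<comment> \<open>\<open>W\<close> is nonnegative, so the weighted mass at the final time can be
    discarded.\<close>
  also have "\<dots> \<le> ennreal (\<integral>x. J t1 x \<partial>lborel)"
    by (intro ennreal_leI) (auto simp: J_def W0 intro!: Bochner_Integration.integral_nonneg)
  also have "\<dots> = (\<integral>\<^sup>+x. ennreal (J t1 x) \<partial>lborel)"
    by (intro nn_integral_eq_integral[symmetric] IJ AE_I2) (simp add: J_def W0)
  also have "\<dots> \<le> (\<integral>\<^sup>+x. ennreal C * ennreal ((norm (\<Psi> t1 x))\<^sup>2) \<partial>lborel)"
  proof (intro nn_integral_mono)
    fix x
    have "J t1 x \<le> C * (norm (\<Psi> t1 x))\<^sup>2"
      unfolding J_def power2_norm_eq_inner using Wabs[of "\<theta> t1 x"] by (intro mult_right_mono) auto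
    then show "ennreal (J t1 x) \<le> ennreal C * ennreal ((norm (\<Psi> t1 x))\<^sup>2)"
      by (metis ennreal_leI ennreal_mult'' zero_le_power2)
  qed
  also have "\<dots> = ennreal C * L2sq lborel (wave m h t1)"
    unfolding L2sq_def \<Psi>_def by (rule nn_integral_cmult) measurable
  finally show ?thesis unfolding C_def .
qed

section \<open>Superposition of waves along rays\<close>

text \<open>The factor \<open>l ^ 3\<close> is the Jacobian of \<xi> = l \<eta> in three dimensions;
  the interval {1..2} has length one, so averaging over \<open>l\<close> is a plain
  integral.\<close>

definition ray :: "(real^3 \<Rightarrow> complex^4) \<Rightarrow> real^3 \<Rightarrow> real \<Rightarrow> complex^4" where
  "ray g \<eta> l = (indicator {1..2} l * l ^ 3) *\<^sub>R g (l *\<^sub>R \<eta>)"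

definition rayint :: "(real^3 \<Rightarrow> complex^4) \<Rightarrow> real \<Rightarrow> real^3 \<Rightarrow> real^3 \<Rightarrow> complex^4" where
  "rayint g t x \<eta> = (\<integral>l. cis (x \<bullet> (l *\<^sub>R \<eta>)) *s evol 0 t (l *\<^sub>R \<eta>) (ray g \<eta> l) \<partial>lborel)"

lemma ray_measurable [measurable (raw)]:
  assumes [measurable]: "g \<in> borel_measurable borel" "f \<in> borel_measurable N" "k \<in> borel_measurable N"
  shows "(\<lambda>p. ray g (f p) (k p)) \<in> borel_measurable N"
  unfolding ray_def by measurable

lemma rayint_measurable [measurable (raw)]:
  assumes [measurable]: "g \<in> borel_measurable borel" "f \<in> borel_measurable N" "k \<in> borel_measurable N" "j \<in> borel_measurable N"
  shows "(\<lambda>p. rayint g (f p) (k p) (j p)) \<in> borel_measurable N"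
  unfolding rayint_def by measurable

text \<open>For each \<open>l\<close> in {1..2} the substitution \<xi> = l \<eta> reproduces the
  whole wave. Averaging over \<open>l\<close> and exchanging the two integrals collects the
  frequencies lying on one ray.\<close>

lemma wave_average:
  assumes g: "band b g" and b: "0 \<le> b"
  shows "integrable lborel (rayint g t x)" and "wave 0 g t x = (\<integral>\<eta>. rayint g t x \<eta> \<partial>lborel)"
proof -
  have [measurable]: "g \<in> borel_measurable borel" using g by (rule band_measurable)
  note gi = band_L1(1)[OF g b]
  define F where "F \<xi> = cis (x \<bullet> \<xi>) *s evol 0 t \<xi> (g \<xi>)" for \<xi>
  have [measurable]: "F \<in> borel_measurable borel" unfolding F_def by measurable
  have Fi: "integrable lborel F" unfolding F_def by (rule integrable_wave[OF g b])
  have wF: "wave 0 g t x = (\<integral>\<xi>. F \<xi> \<partial>lborel)" by (simp add: wave_def osc_def F_def)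
  let ?c = "\<lambda>l::real. indicator {1..2} l * l ^ 3"
  have scale: "evol 0 t \<xi> (c *\<^sub>R v) = c *\<^sub>R evol 0 t \<xi> v" for \<xi> c v
    by (simp add: evol_def gen_scaleR algebra_simps)
  have eq: "cis (x \<bullet> (l *\<^sub>R \<eta>)) *s evol 0 t (l *\<^sub>R \<eta>) (ray g \<eta> l) = ?c l *\<^sub>R F (l *\<^sub>R \<eta>)" for l \<eta>
    unfolding ray_def F_def scale smult_scaleR ..
  have Fl: "?c l *\<^sub>R (\<integral>\<eta>. F (l *\<^sub>R \<eta>) \<partial>lborel) = indicator {1..2} l *\<^sub>R (\<integral>\<xi>. F \<xi> \<partial>lborel)" for l
    by (cases "l \<in> {1..2}") (simp_all add: lborel_integral_scale[of F l])
  have Fil: "integrable lborel (\<lambda>\<eta>. ?c l *\<^sub>R F (l *\<^sub>R \<eta>))" for l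
    by (cases "l \<in> {1..2}") (use Fi lborel_integrable_scale[of F l] in \<open>auto simp: indicator_def\<close>)
  have nFl: "?c l * (\<integral>\<eta>. norm (F (l *\<^sub>R \<eta>)) \<partial>lborel) = indicator {1..2} l * (\<integral>\<xi>. norm (F \<xi>) \<partial>lborel)" for l
    by (cases "l \<in> {1..2}") (simp_all add: lborel_integral_scale[of "\<lambda>\<xi>. norm (F \<xi>)" l])
  have int: "integrable (lborel \<Otimes>\<^sub>M lborel) (\<lambda>(l, \<eta>). ?c l *\<^sub>R F (l *\<^sub>R \<eta>))"
  proof (rule lborel_pair.Fubini_integrable)
    show "(\<lambda>(l, \<eta>). ?c l *\<^sub>R F (l *\<^sub>R \<eta>)) \<in> borel_measurable (lborel \<Otimes>\<^sub>M lborel)" by measurable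
    show "AE l in lborel. integrable lborel (\<lambda>\<eta>. case (l, \<eta>) of (l, \<eta>) \<Rightarrow> ?c l *\<^sub>R F (l *\<^sub>R \<eta>))"
      using Fil by simp
    have "(\<integral>\<eta>. norm (case (l, \<eta>) of (l, \<eta>) \<Rightarrow> ?c l *\<^sub>R F (l *\<^sub>R \<eta>)) \<partial>lborel) = indicator {1..2} l * (\<integral>\<xi>. norm (F \<xi>) \<partial>lborel)" for l
      unfolding nFl[symmetric] by (auto simp: indicator_def abs_mult)
    then show "integrable lborel (\<lambda>l. \<integral>\<eta>. norm (case (l, \<eta>) of (l, \<eta>) \<Rightarrow> ?c l *\<^sub>R F (l *\<^sub>R \<eta>)) \<partial>lborel)"
      by (auto intro!: integrable_mult_left integrable_real_indicator)
  qed
  have int': "integrable (lborel \<Otimes>\<^sub>M lborel) (\<lambda>(\<eta>, l). ?c l *\<^sub>R F (l *\<^sub>R \<eta>))"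
    using lborel_pair.integrable_product_swap[OF int] by simp
  show "integrable lborel (rayint g t x)"
  proof -
    have "rayint g t x = (\<lambda>\<eta>. \<integral>l. ?c l *\<^sub>R F (l *\<^sub>R \<eta>) \<partial>lborel)"
      by (rule ext) (simp only: rayint_def eq)
    then show ?thesis using lborel_pair.integrable_fst'[OF int'] by simp
  qed
  have "(\<integral>\<eta>. rayint g t x \<eta> \<partial>lborel) = (\<integral>\<eta>. \<integral>l. ?c l *\<^sub>R F (l *\<^sub>R \<eta>) \<partial>lborel \<partial>lborel)"
    unfolding rayint_def eq ..
  also have "\<dots> = (\<integral>l. \<integral>\<eta>. ?c l *\<^sub>R F (l *\<^sub>R \<eta>) \<partial>lborel \<partial>lborel)"
    by (rule lborel_pair.Fubini_integral[OF int])
  also have "\<dots> = (\<integral>l. indicator {1..2::real} l *\<^sub>R (\<integral>\<xi>. F \<xi> \<partial>lborel) \<partial>lborel)"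
    by (simp add: Fl)
  also have "\<dots> = wave 0 g t x"
  proof -
    have "measure lborel {1..2::real} = 1" by (subst measure_lborel_Icc) auto
    then show ?thesis by (simp add: wF)
  qed
  finally show "wave 0 g t x = (\<integral>\<eta>. rayint g t x \<eta> \<partial>lborel)" ..
qed

lemma hproj_linear: "bounded_linear (hproj \<eta>)"
proof -
  have "linear (hproj \<eta>)"
    by (intro linearI) (simp_all add: hproj_def dsym_add dsym_scaleR algebra_simps)
  then show ?thesis using linear_conv_bounded_linear by blast
qed

lemma hproj_zero: "hproj \<eta> 0 = 0"
  and hproj_smult: "hproj \<eta> (c *s v) = c *s hproj \<eta> v"
  by (simp_all add: hproj_def dsym_add dsym_scaleR dsym_smult smult_diff smult_scaleR algebra_simps)

text \<open>The projections are constant along a ray, so the integral over \<open>l\<close> falls on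
  the phases alone and yields one function of each null variable.\<close>

lemma rayint_null:
  assumes i: "integrable lborel (ray g \<eta>)" and \<eta>: "\<eta> \<noteq> 0"
  shows "rayint g t x \<eta> = hproj (- \<eta>) (osc 1 (ray g \<eta>) (x \<bullet> \<eta> - t * norm \<eta>))
       + hproj \<eta> (osc 1 (ray g \<eta>) (x \<bullet> \<eta> + t * norm \<eta>))"
proof -
  have i': "integrable lborel (\<lambda>l. cis (1 * (s \<bullet> l)) *s ray g \<eta> l)" for s :: real
    by (rule integrable_cis_smult[OF i]) measurable
  have h: "hproj \<zeta> (osc 1 (ray g \<eta>) s) = (\<integral>l. hproj \<zeta> (cis (1 * (s \<bullet> l)) *s ray g \<eta> l) \<partial>lborel)" for \<zeta> s
    unfolding osc_def by (rule integral_bounded_linear[OF hproj_linear i', symmetric])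
  have ih: "integrable lborel (\<lambda>l. hproj \<zeta> (cis (1 * (s \<bullet> l)) *s ray g \<eta> l))" for \<zeta> and s :: real
    by (rule integrable_bounded_linear[OF hproj_linear i'])
  have eq: "cis (x \<bullet> (l *\<^sub>R \<eta>)) *s evol 0 t (l *\<^sub>R \<eta>) (ray g \<eta> l)
     = hproj (- \<eta>) (cis (1 * ((x \<bullet> \<eta> - t * norm \<eta>) \<bullet> l)) *s ray g \<eta> l)
       + hproj \<eta> (cis (1 * ((x \<bullet> \<eta> + t * norm \<eta>) \<bullet> l)) *s ray g \<eta> l)" for l
  proof (cases "l \<in> {1..2}")
    case False
    then show ?thesis by (simp add: ray_def hproj_zero)
  next
    case True
    then have l: "l > 0" by auto
    have m: "a *s (b *s v) = (a * b) *s v" for a b and v :: "complex^4" by (simp add: vec_eq_iff)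
    show ?thesis
      unfolding evol_massless[OF \<eta> l] smult_add m cis_mult hproj_smult
      by (simp add: algebra_simps)
  qed
  show ?thesis
    unfolding rayint_def eq h by (rule Bochner_Integration.integral_add[OF ih ih])
qed

text \<open>Dilation factors lie between 1 and 2: the lower frequency bound is halved and the upper
  one is kept.\<close>

lemma rayint_zero:
  assumes "\<And>\<xi>. norm \<xi> < a \<or> b < norm \<xi> \<Longrightarrow> g \<xi> = 0" "norm \<eta> < a / 2 \<or> b < norm \<eta>" "0 < a" "0 \<le> b"
  shows "rayint g t x \<eta> = 0"
proof -
  have "ray g \<eta> l = 0" for l
  proof (cases "l \<in> {1..2}")
    case True
    have "norm (l *\<^sub>R \<eta>) < a \<or> b < norm (l *\<^sub>R \<eta>)"
      using assms(2)
    proof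
      assume "norm \<eta> < a / 2"
      have "norm (l *\<^sub>R \<eta>) \<le> 2 * norm \<eta>" using True by (auto intro: mult_right_mono)
      then show ?thesis using \<open>norm \<eta> < a / 2\<close> by linarith
    next
      assume "b < norm \<eta>"
      have "1 * norm \<eta> \<le> norm (l *\<^sub>R \<eta>)" using True by (auto simp: mult_le_cancel_right1)
      then show ?thesis using \<open>b < norm \<eta>\<close> by linarith
    qed
    then show ?thesis using assms(1) by (simp add: ray_def)
  qed (simp add: ray_def)
  then show ?thesis by (simp add: rayint_def)
qed

text \<open>Of the squared Jacobian \<open>l ^ 6\<close> the substitution \<xi> = l \<eta> absorbs
  \<open>l ^ 3\<close>; what remains is at most 8 on {1..2}.\<close>

lemma ray_L2sq_integral:
  assumes [measurable]: "g \<in> borel_measurable borel"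
  shows "(\<integral>\<^sup>+\<eta>. L2sq lborel (ray g \<eta>) \<partial>lborel) \<le> 8 * L2sq lborel g"
proof -
  have "(\<integral>\<^sup>+\<eta>. L2sq lborel (ray g \<eta>) \<partial>lborel) = (\<integral>\<^sup>+\<eta>. \<integral>\<^sup>+l. ennreal ((norm (ray g \<eta> l))\<^sup>2) \<partial>lborel \<partial>lborel)"
    by (simp add: L2sq_def)
  also have "\<dots> = (\<integral>\<^sup>+l. \<integral>\<^sup>+\<eta>. ennreal ((norm (ray g \<eta> l))\<^sup>2) \<partial>lborel \<partial>lborel)"
    by (rule lborel_pair.Fubini') measurable
  also have "\<dots> \<le> (\<integral>\<^sup>+l. 8 * L2sq lborel g * indicator {1..2::real} l \<partial>lborel)"
  proof (intro nn_integral_mono)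
    fix l :: real
    show "(\<integral>\<^sup>+\<eta>. ennreal ((norm (ray g \<eta> l))\<^sup>2) \<partial>lborel) \<le> 8 * L2sq lborel g * indicator {1..2} l"
    proof (cases "l \<in> {1..2}")
      case False
      then show ?thesis by (simp add: ray_def)
    next
      case True
      then have l: "l \<noteq> 0" "0 \<le> l" by auto
      have "(\<integral>\<^sup>+\<eta>. ennreal ((norm (ray g \<eta> l))\<^sup>2) \<partial>lborel) = (\<integral>\<^sup>+\<eta>. ennreal (l ^ 3) * (ennreal (l ^ 3) * ennreal ((norm (g (l *\<^sub>R \<eta>)))\<^sup>2)) \<partial>lborel)"
        using True l by (intro nn_integral_cong) (simp add: ray_def ennreal_mult[symmetric] power_mult_distrib power2_eq_square[of "l ^ 3"] mult.assoc)
      also have "\<dots> = ennreal (l ^ 3) * (ennreal (l ^ 3) * (\<integral>\<^sup>+\<eta>. ennreal ((norm (g (l *\<^sub>R \<eta>)))\<^sup>2) \<partial>lborel))"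
        by (simp add: nn_integral_cmult)
      also have "ennreal (l ^ 3) * (\<integral>\<^sup>+\<eta>. ennreal ((norm (g (l *\<^sub>R \<eta>)))\<^sup>2) \<partial>lborel) = L2sq lborel g"
        unfolding L2sq_def using nn_integral_lborel_scale[of "\<lambda>\<xi>. ennreal ((norm (g \<xi>))\<^sup>2)" l] l by simp
      also have "ennreal (l ^ 3) * L2sq lborel g \<le> 8 * L2sq lborel g"
      proof (rule mult_right_mono)
        have "l ^ 3 \<le> 2 ^ 3" using True by (intro power_mono) auto
        then have "ennreal (l ^ 3) \<le> ennreal 8" by (intro ennreal_leI) simp
        then show "ennreal (l ^ 3) \<le> 8" by simp
      qed simp
      finally show ?thesis using True by simp
    qed
  qed
  also have "\<dots> = 8 * L2sq lborel g" by (simp add: nn_integral_cmult_indicator)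
  finally show ?thesis .
qed

text \<open>A ray lives on an interval of length one, so Cauchy--Schwarz against its indicator
  applies.\<close>

lemma ray_integrable:
  assumes [measurable]: "g \<in> borel_measurable borel" and fin: "L2sq lborel (ray g \<eta>) < \<infinity>"
  shows "integrable lborel (ray g \<eta>)"
proof -
  have i: "square_integrable lborel (indicator {1..2::real} :: real \<Rightarrow> real)"
  proof -
    have "L2sq lborel (indicator {1..2::real} :: real \<Rightarrow> real) = (\<integral>\<^sup>+x. indicator {1..2::real} x \<partial>lborel)"
      unfolding L2sq_def by (intro nn_integral_cong) (auto simp: indicator_def)
    then show ?thesis by (simp add: square_integrable_iff_L2sq)
  qed
  have r: "square_integrable lborel (ray g \<eta>)" using fin by (simp add: square_integrable_iff_L2sq)
  show ?thesis
    by (rule Bochner_Integration.integrable_bound[OF square_integrable_mult_norm[OF i r]])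
       (auto simp: ray_def indicator_def)
qed

lemma bilin_linear: "bounded_linear (\<lambda>v. bilin \<Gamma> v w)"
proof -
  have "linear (\<lambda>v. bilin \<Gamma> v w)"
    by (intro linearI) (simp_all add: bilin_def matrix_vector_right_distrib matrix_vector_scaleR herm_add_left herm_scaleR_left)
  then show ?thesis using linear_conv_bounded_linear by blast
qed

lemma bilin_add: "bilin \<Gamma> (v + v') w = bilin \<Gamma> v w + bilin \<Gamma> v' w"
  by (simp add: bilin_def matrix_vector_right_distrib herm_add_left)

lemma borel_measurable_matrix_vector [measurable (raw)]:
  assumes "f \<in> borel_measurable M" shows "(\<lambda>x. (A::complex^4^4) *v f x) \<in> borel_measurable M"
proof -
  have "linear ((*v) A)" by (intro linearI) (simp_all add: matrix_vector_right_distrib matrix_vector_scaleR)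
  then have "continuous_on UNIV ((*v) A)" by (intro linear_continuous_on) (simp add: linear_conv_bounded_linear)
  from measurable_compose[OF assms borel_measurable_continuous_onI[OF this]] show ?thesis .
qed

lemma borel_measurable_herm [measurable (raw)]:
  assumes [measurable]: "f \<in> borel_measurable M" "g \<in> borel_measurable M"
  shows "(\<lambda>x. herm (f x) (g x)) \<in> borel_measurable M"
proof -
  have [measurable]: "cnj \<in> borel_measurable borel" by (intro borel_measurable_continuous_onI continuous_intros)
  show ?thesis unfolding herm_def by measurable
qed

lemma borel_measurable_bilin [measurable (raw)]:
  assumes [measurable]: "f \<in> borel_measurable M" "g \<in> borel_measurable M"
  shows "(\<lambda>x. bilin A (f x) (g x)) \<in> borel_measurable M"
  unfolding bilin_def by measurable

text \<open>Each half of \<open>rayint_null\<close> carries a projection, which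
  \<open>bilin_hproj\<close> turns into the opposite projection of the other wave. That is the part
  which \<open>null_flux\<close> controls for the null variable of this half. In the constant, 2
  \<pi> is the Bessel constant in one dimension, taken once for each half; the 2 from squaring a sum
  cancels the 2 in \<open>null_flux\<close>, whose factor \<open>norm \<eta>\<close> ends up in the
  denominator.\<close>

lemma rayint_flux:
  assumes an: "anticommutes_alpha \<Gamma>" and M: "\<And>v. norm (\<Gamma> *v v) \<le> M * norm v"
    and g: "g \<in> borel_measurable borel" and fin: "L2sq lborel (ray g \<eta>) < \<infinity>" and \<eta>: "\<eta> \<noteq> 0"
    and h: "band b h" and b: "0 \<le> b" and t12: "t1 \<le> t2"
  shows "(\<integral>\<^sup>+t. indicator {t1..t2} t * (\<integral>\<^sup>+x. ennreal ((norm (bilin \<Gamma> (rayint g t x \<eta>) (wave m h t x)))\<^sup>2) \<partial>lborel) \<partial>lborel)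
    \<le> ennreal (4 * pi * M\<^sup>2 / norm \<eta>) * L2sq lborel (ray g \<eta>) * L2sq lborel (wave m h t1)"
proof -
  note [measurable] = g band_measurable[OF h]
  note i = ray_integrable[OF g fin]
  define G where "G = osc 1 (ray g \<eta>)"
  \<comment> \<open>The squared modulus of the transformed ray serves as the weight;
    \<open>osc_bessel\<close> in one dimension bounds its integral by the squared L2 norm of the
    ray.\<close>
  define w where "w s = (norm (G s))\<^sup>2" for s
  have Gc: "continuous_on UNIV G"
    unfolding G_def osc_def
    by (rule continuous_integral_param[where g = "\<lambda>l. norm (ray g \<eta> l)"])
       (auto simp: norm_vector_smult intro!: continuous_intros bounded_bilinear.continuous_on[OF bounded_bilinear_smult] integrable_norm i)
  have [measurable]: "G \<in> borel_measurable borel" using Gc by (rule borel_measurable_continuous_onI)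
  have wc: "continuous_on UNIV w" unfolding w_def by (intro continuous_intros Gc)
  have [measurable]: "w \<in> borel_measurable borel" using wc by (rule borel_measurable_continuous_onI)
  have w0: "0 \<le> w s" for s by (simp add: w_def)
  have wb: "w s \<le> (\<integral>l. norm (ray g \<eta> l) \<partial>lborel)\<^sup>2" for s
  proof -
    have "norm (G s) \<le> (\<integral>l. norm (cis (1 * (s \<bullet> l)) *s ray g \<eta> l) \<partial>lborel)"
      unfolding G_def osc_def by (rule integral_norm_bound)
    then show ?thesis unfolding w_def by (intro power_mono) (simp_all add: norm_vector_smult)
  qed
  have Lw: "(\<integral>\<^sup>+s. ennreal (w s) \<partial>lborel) \<le> ennreal (2 * pi) * L2sq lborel (ray g \<eta>)"
    using osc_bessel[OF i, of 1] by (simp add: L2sq_def w_def G_def)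
  then have wfin: "(\<integral>\<^sup>+s. ennreal (w s) \<partial>lborel) < \<infinity>"
    using fin by (auto simp: ennreal_mult_less_top intro: le_less_trans)
  have wi: "integrable lborel w"
    using wfin w0 by (auto simp: integrable_iff_bounded)
  have Iw: "ennreal (\<integral>s. w s \<partial>lborel) \<le> ennreal (2 * pi) * L2sq lborel (ray g \<eta>)"
    using Lw nn_integral_eq_integral[OF wi] w0 by simp
  \<comment> \<open>The other half depends on \<open>x \<bullet> \<eta> + t * norm \<eta>\<close>,
    the negative of the null variable belonging to \<open>- \<eta>\<close>. Reflecting the weight
    brings it under the same flux bound.\<close>
  let ?w' = "\<lambda>s. w (- s)"
  have wi': "integrable lborel ?w'" and wI': "(\<integral>s. w (- s) \<partial>lborel) = (\<integral>s. w s \<partial>lborel)"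
    using lborel_integrable_scale[of w "- 1"] lborel_integral_scale[of w "- 1"] wi by simp_all
  have wc': "continuous_on UNIV ?w'" by (intro continuous_on_compose2[OF wc] continuous_intros) auto
  let ?E = "\<lambda>\<zeta> v t. \<integral>\<^sup>+x. ennreal (2 * norm \<zeta> * (v (x \<bullet> \<zeta> - t * norm \<zeta>) * (norm (hproj \<zeta> (wave m h t x)))\<^sup>2)) \<partial>lborel"
  let ?R = "ennreal (2 * pi) * L2sq lborel (ray g \<eta>) * L2sq lborel (wave m h t1)"
  have f1: "(\<integral>\<^sup>+t. indicator {t1..t2} t * ?E \<eta> w t \<partial>lborel) \<le> ?R"
    by (rule order_trans[OF null_flux[OF h b \<eta> t12 wc wi w0 wb]]) (intro mult_right_mono Iw, simp)
  have f2: "(\<integral>\<^sup>+t. indicator {t1..t2} t * ?E (- \<eta>) ?w' t \<partial>lborel) \<le> ?R"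
    by (rule order_trans[OF null_flux[OF h b _ t12 wc' wi' w0 wb]]) (use \<eta> Iw in \<open>auto simp: wI' intro!: mult_right_mono\<close>)
  have pt: "ennreal ((norm (bilin \<Gamma> (rayint g t x \<eta>) (wave m h t x)))\<^sup>2)
      \<le> ennreal (M\<^sup>2 / norm \<eta>) * (ennreal (2 * norm \<eta> * (w (x \<bullet> \<eta> - t * norm \<eta>) * (norm (hproj \<eta> (wave m h t x)))\<^sup>2))
        + ennreal (2 * norm (- \<eta>) * (?w' (x \<bullet> (- \<eta>) - t * norm (- \<eta>)) * (norm (hproj (- \<eta>) (wave m h t x)))\<^sup>2)))" for t x
  proof -
    let ?\<Psi> = "wave m h t x"
    let ?a = "G (x \<bullet> \<eta> - t * norm \<eta>)" and ?b = "G (x \<bullet> \<eta> + t * norm \<eta>)"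
    have "bilin \<Gamma> (rayint g t x \<eta>) ?\<Psi> = herm (\<Gamma> *v ?a) (hproj \<eta> ?\<Psi>) + herm (\<Gamma> *v ?b) (hproj (- \<eta>) ?\<Psi>)"
      unfolding rayint_null[OF i \<eta>] bilin_add bilin_hproj[OF an] G_def by simp
    also have "norm \<dots> \<le> norm (herm (\<Gamma> *v ?a) (hproj \<eta> ?\<Psi>)) + norm (herm (\<Gamma> *v ?b) (hproj (- \<eta>) ?\<Psi>))"
      by (rule norm_triangle_ineq)
    also have "\<dots> \<le> M * norm ?a * norm (hproj \<eta> ?\<Psi>) + M * norm ?b * norm (hproj (- \<eta>) ?\<Psi>)"
      by (intro add_mono order_trans[OF herm_cauchy_schwarz] mult_right_mono M) auto
    finally have "(norm (bilin \<Gamma> (rayint g t x \<eta>) ?\<Psi>))\<^sup>2 \<le> (M * norm ?a * norm (hproj \<eta> ?\<Psi>) + M * norm ?b * norm (hproj (- \<eta>) ?\<Psi>))\<^sup>2"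
      by (intro power_mono) auto
    also have "\<dots> \<le> 2 * (M * norm ?a * norm (hproj \<eta> ?\<Psi>))\<^sup>2 + 2 * (M * norm ?b * norm (hproj (- \<eta>) ?\<Psi>))\<^sup>2"
      using sum_squares_bound[of "M * norm ?a * norm (hproj \<eta> ?\<Psi>)" "M * norm ?b * norm (hproj (- \<eta>) ?\<Psi>)"]
      by (simp add: power2_sum)
    also have "\<dots> = M\<^sup>2 / norm \<eta> * (2 * norm \<eta> * (w (x \<bullet> \<eta> - t * norm \<eta>) * (norm (hproj \<eta> ?\<Psi>))\<^sup>2)
        + 2 * norm (- \<eta>) * (?w' (x \<bullet> (- \<eta>) - t * norm (- \<eta>)) * (norm (hproj (- \<eta>) ?\<Psi>))\<^sup>2))"
      using \<eta> by (simp add: w_def power_mult_distrib field_simps)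
    finally have "ennreal ((norm (bilin \<Gamma> (rayint g t x \<eta>) ?\<Psi>))\<^sup>2)
      \<le> ennreal (M\<^sup>2 / norm \<eta> * (2 * norm \<eta> * (w (x \<bullet> \<eta> - t * norm \<eta>) * (norm (hproj \<eta> ?\<Psi>))\<^sup>2)
        + 2 * norm (- \<eta>) * (?w' (x \<bullet> (- \<eta>) - t * norm (- \<eta>)) * (norm (hproj (- \<eta>) ?\<Psi>))\<^sup>2)))"
      by (rule ennreal_leI)
    also have "\<dots> = ennreal (M\<^sup>2 / norm \<eta>) * (ennreal (2 * norm \<eta> * (w (x \<bullet> \<eta> - t * norm \<eta>) * (norm (hproj \<eta> ?\<Psi>))\<^sup>2))
        + ennreal (2 * norm (- \<eta>) * (?w' (x \<bullet> (- \<eta>) - t * norm (- \<eta>)) * (norm (hproj (- \<eta>) ?\<Psi>))\<^sup>2)))"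
      by (subst ennreal_mult', simp, subst ennreal_plus) (auto simp: w0)
    finally show ?thesis .
  qed
  have [measurable]: "hproj \<zeta> \<in> borel_measurable borel" for \<zeta>
    by (intro borel_measurable_continuous_onI linear_continuous_on hproj_linear)
  have "(\<integral>\<^sup>+t. indicator {t1..t2} t * (\<integral>\<^sup>+x. ennreal ((norm (bilin \<Gamma> (rayint g t x \<eta>) (wave m h t x)))\<^sup>2) \<partial>lborel) \<partial>lborel)
     \<le> (\<integral>\<^sup>+t. indicator {t1..t2} t * (\<integral>\<^sup>+x. ennreal (M\<^sup>2 / norm \<eta>) * (ennreal (2 * norm \<eta> * (w (x \<bullet> \<eta> - t * norm \<eta>) * (norm (hproj \<eta> (wave m h t x)))\<^sup>2))
        + ennreal (2 * norm (- \<eta>) * (?w' (x \<bullet> (- \<eta>) - t * norm (- \<eta>)) * (norm (hproj (- \<eta>) (wave m h t x)))\<^sup>2))) \<partial>lborel) \<partial>lborel)"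
    by (intro nn_integral_mono mult_left_mono pt) simp
  also have "\<dots> = (\<integral>\<^sup>+t. ennreal (M\<^sup>2 / norm \<eta>) * (indicator {t1..t2} t * ?E \<eta> w t + indicator {t1..t2} t * ?E (- \<eta>) ?w' t) \<partial>lborel)"
  proof (intro nn_integral_cong)
    fix t
    show "indicator {t1..t2} t * (\<integral>\<^sup>+x. ennreal (M\<^sup>2 / norm \<eta>) * (ennreal (2 * norm \<eta> * (w (x \<bullet> \<eta> - t * norm \<eta>) * (norm (hproj \<eta> (wave m h t x)))\<^sup>2))
        + ennreal (2 * norm (- \<eta>) * (?w' (x \<bullet> (- \<eta>) - t * norm (- \<eta>)) * (norm (hproj (- \<eta>) (wave m h t x)))\<^sup>2))) \<partial>lborel)
      = ennreal (M\<^sup>2 / norm \<eta>) * (indicator {t1..t2} t * ?E \<eta> w t + indicator {t1..t2} t * ?E (- \<eta>) ?w' t)"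
      apply (subst nn_integral_cmult, measurable)
      apply (subst nn_integral_add, measurable)
      apply (simp only: distrib_left mult_ac)
      done
  qed
  also have "\<dots> = ennreal (M\<^sup>2 / norm \<eta>) * ((\<integral>\<^sup>+t. indicator {t1..t2} t * ?E \<eta> w t \<partial>lborel) + (\<integral>\<^sup>+t. indicator {t1..t2} t * ?E (- \<eta>) ?w' t \<partial>lborel))"
    apply (subst nn_integral_cmult, measurable)
    apply (subst nn_integral_add, measurable)
    done
  also have "\<dots> \<le> ennreal (M\<^sup>2 / norm \<eta>) * (?R + ?R)"
    by (intro mult_left_mono add_mono f1 f2) simp
  also have "\<dots> = ennreal (4 * pi * M\<^sup>2 / norm \<eta>) * L2sq lborel (ray g \<eta>) * L2sq lborel (wave m h t1)"
  proof -
    have "ennreal (4 * pi * M\<^sup>2 / norm \<eta>) = ennreal (M\<^sup>2 / norm \<eta>) * (ennreal (2 * pi) + ennreal (2 * pi))"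
      by (subst ennreal_plus[symmetric], simp, simp, subst ennreal_mult[symmetric]) auto
    then show ?thesis by (simp only: distrib_left distrib_right mult_ac)
  qed
  finally show ?thesis .
qed

section \<open>Null form estimates for free waves\<close>

text \<open>The squared space-time norm as an iterated integral with time outside. It depends on the
  two fields only through their values for almost every \<open>x\<close> at each time, which is the
  form in which Dirac components are known.\<close>

definition nullform ::
  "complex^4^4 \<Rightarrow> (real \<Rightarrow> real^3 \<Rightarrow> complex^4) \<Rightarrow> (real \<Rightarrow> real^3 \<Rightarrow> complex^4) \<Rightarrow> real \<Rightarrow> real \<Rightarrow> ennreal" where
  "nullform \<Gamma> u v t1 t2 = (\<integral>\<^sup>+t. indicator {t1..t2} t * (\<integral>\<^sup>+x. ennreal ((norm (bilin \<Gamma> (u t x) (v t x)))\<^sup>2) \<partial>lborel) \<partial>lborel)"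

text \<open>Cauchy--Schwarz in \<eta> over the enclosing cube gives \<open>8 * b ^ 3\<close>,
  \<open>rayint_flux\<close> with \<open>norm \<eta>\<close> at least \<open>a / 2\<close> gives
  \<open>8 * pi * M\<^sup>2 / a\<close>, and \<open>ray_L2sq_integral\<close> gives 8; hence the
  factor 512. For \<open>a\<close> and \<open>b\<close> of size N the quotient
  \<open>b ^ 3 / a\<close> is of size N^2.\<close>

lemma massless_nullform:
  assumes an: "anticommutes_alpha \<Gamma>" and M: "\<And>v. norm (\<Gamma> *v v) \<le> M * norm v"
    and g: "band b g" and low: "\<And>\<xi>. norm \<xi> < a \<Longrightarrow> g \<xi> = 0" and a: "0 < a" and ab: "0 \<le> b"
    and h: "band b' h" and b': "0 \<le> b'" and t12: "t1 \<le> t2"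
  shows "nullform \<Gamma> (wave 0 g) (wave m h) t1 t2 \<le> ennreal (512 * pi * M\<^sup>2 * (b ^ 3 / a)) * L2sq lborel g * L2sq lborel (wave m h t1)"
proof -
  note [measurable] = band_measurable[OF g] band_measurable[OF h]
  define Q where "Q = cbox (- b *\<^sub>R One) (b *\<^sub>R One :: real^3)"
  have [measurable]: "Q \<in> sets borel" by (simp add: Q_def)
  have zero: "rayint g t x \<eta> = 0" if "norm \<eta> < a / 2 \<or> b < norm \<eta>" for t x \<eta>
    by (rule rayint_zero[OF _ that a ab]) (use low g in \<open>auto simp: band_def\<close>)
  let ?f = "\<lambda>t x \<eta>. bilin \<Gamma> (rayint g t x \<eta>) (wave m h t x)"
  have pt: "ennreal ((norm (bilin \<Gamma> (wave 0 g t x) (wave m h t x)))\<^sup>2) \<le> ennreal (8 * b ^ 3) * (\<integral>\<^sup>+\<eta>. ennreal ((norm (?f t x \<eta>))\<^sup>2) \<partial>lborel)" for t x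
  proof -
    have "bilin \<Gamma> (wave 0 g t x) (wave m h t x) = (\<integral>\<eta>. ?f t x \<eta> \<partial>lborel)"
      unfolding wave_average(2)[OF g ab]
      by (rule integral_bounded_linear[OF bilin_linear wave_average(1)[OF g ab], symmetric])
    then have "ennreal (norm (bilin \<Gamma> (wave 0 g t x) (wave m h t x))) \<le> (\<integral>\<^sup>+\<eta>. ennreal (norm (?f t x \<eta>)) \<partial>lborel)"
      using ennreal_norm_integral_le[of lborel "?f t x"] by simp
    also have "\<dots> = (\<integral>\<^sup>+\<eta>. indicator Q \<eta> * ennreal (norm (?f t x \<eta>)) \<partial>lborel)"
    proof (intro nn_integral_cong)
      fix \<eta>
      have "rayint g t x \<eta> = 0" if "\<eta> \<notin> Q" using norm_outside_cube[of \<eta> b] that zero by (simp add: Q_def)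
      then show "ennreal (norm (?f t x \<eta>)) = indicator Q \<eta> * ennreal (norm (?f t x \<eta>))"
        by (cases "\<eta> \<in> Q") (auto simp: bilin_def herm_def)
    qed
    finally have "(ennreal (norm (bilin \<Gamma> (wave 0 g t x) (wave m h t x))))\<^sup>2 \<le> (\<integral>\<^sup>+\<eta>. indicator Q \<eta> * ennreal (norm (?f t x \<eta>)) \<partial>lborel)\<^sup>2"
      by (intro power_mono) auto
    also have "\<dots> \<le> (\<integral>\<^sup>+\<eta>. (indicator Q \<eta>)\<^sup>2 \<partial>lborel) * (\<integral>\<^sup>+\<eta>. (ennreal (norm (?f t x \<eta>)))\<^sup>2 \<partial>lborel)"
      by (rule Cauchy_Schwarz_nn_integral) measurable
    also have "(\<integral>\<^sup>+\<eta>. (indicator Q \<eta>)\<^sup>2 \<partial>lborel) = (\<integral>\<^sup>+\<eta>. indicator Q \<eta> \<partial>lborel)"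
      by (intro nn_integral_cong) (auto simp: indicator_def)
    also have "\<dots> = ennreal (8 * b ^ 3)"
      using emeasure_cube[OF ab] by (simp add: Q_def)
    finally show ?thesis by (simp add: ennreal_power)
  qed
  have swap: "(\<integral>\<^sup>+x. \<integral>\<^sup>+\<eta>. ennreal ((norm (?f t x \<eta>))\<^sup>2) \<partial>lborel \<partial>lborel) = (\<integral>\<^sup>+\<eta>. \<integral>\<^sup>+x. ennreal ((norm (?f t x \<eta>))\<^sup>2) \<partial>lborel \<partial>lborel)" for t
    by (rule lborel_pair.Fubini') measurable
  have "nullform \<Gamma> (wave 0 g) (wave m h) t1 t2 \<le> (\<integral>\<^sup>+t. indicator {t1..t2} t * (\<integral>\<^sup>+x. ennreal (8 * b ^ 3) * (\<integral>\<^sup>+\<eta>. ennreal ((norm (?f t x \<eta>))\<^sup>2) \<partial>lborel) \<partial>lborel) \<partial>lborel)"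
    unfolding nullform_def by (intro nn_integral_mono mult_left_mono pt) simp
  also have "\<dots> = (\<integral>\<^sup>+t. ennreal (8 * b ^ 3) * (\<integral>\<^sup>+\<eta>. indicator {t1..t2} t * (\<integral>\<^sup>+x. ennreal ((norm (?f t x \<eta>))\<^sup>2) \<partial>lborel) \<partial>lborel) \<partial>lborel)"
  proof (intro nn_integral_cong)
    fix t
    show "indicator {t1..t2} t * (\<integral>\<^sup>+x. ennreal (8 * b ^ 3) * (\<integral>\<^sup>+\<eta>. ennreal ((norm (?f t x \<eta>))\<^sup>2) \<partial>lborel) \<partial>lborel)
      = ennreal (8 * b ^ 3) * (\<integral>\<^sup>+\<eta>. indicator {t1..t2} t * (\<integral>\<^sup>+x. ennreal ((norm (?f t x \<eta>))\<^sup>2) \<partial>lborel) \<partial>lborel)"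
      apply (subst nn_integral_cmult, measurable)
      apply (subst swap)
      apply (subst nn_integral_cmult, measurable)
      apply (rule mult.left_commute)
      done
  qed
  also have "\<dots> = ennreal (8 * b ^ 3) * (\<integral>\<^sup>+\<eta>. nullform \<Gamma> (\<lambda>t x. rayint g t x \<eta>) (wave m h) t1 t2 \<partial>lborel)"
  proof -
    have *: "(\<integral>\<^sup>+t. (\<integral>\<^sup>+\<eta>. indicator {t1..t2} t * (\<integral>\<^sup>+x. ennreal ((norm (?f t x \<eta>))\<^sup>2) \<partial>lborel) \<partial>lborel) \<partial>lborel)
       = (\<integral>\<^sup>+\<eta>. (\<integral>\<^sup>+t. indicator {t1..t2} t * (\<integral>\<^sup>+x. ennreal ((norm (?f t x \<eta>))\<^sup>2) \<partial>lborel) \<partial>lborel) \<partial>lborel)"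
      by (rule lborel_pair.Fubini') measurable
    show ?thesis
      unfolding nullform_def *[symmetric] by (rule nn_integral_cmult) measurable
  qed
  also have "\<dots> \<le> ennreal (8 * b ^ 3) * (\<integral>\<^sup>+\<eta>. ennreal (8 * pi * M\<^sup>2 / a) * L2sq lborel (wave m h t1) * L2sq lborel (ray g \<eta>) \<partial>lborel)"
  proof (intro mult_left_mono nn_integral_mono_AE)
    have [measurable]: "(\<lambda>\<eta>. L2sq lborel (ray g \<eta>)) \<in> borel_measurable borel" unfolding L2sq_def by measurable
    have "(\<integral>\<^sup>+\<eta>. L2sq lborel (ray g \<eta>) \<partial>lborel) < \<infinity>"
      using ray_L2sq_integral[OF band_measurable[OF g]] g by (auto simp: band_def ennreal_mult_less_top intro: le_less_trans)
    \<comment> \<open>The flux bound speaks of square-integrable rays; by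
      \<open>ray_L2sq_integral\<close> almost every ray is one.\<close>
    then have "AE \<eta> in lborel. L2sq lborel (ray g \<eta>) \<noteq> \<infinity>"
      by (intro nn_integral_PInf_AE) auto
    then show "AE \<eta> in lborel. nullform \<Gamma> (\<lambda>t x. rayint g t x \<eta>) (wave m h) t1 t2
       \<le> ennreal (8 * pi * M\<^sup>2 / a) * L2sq lborel (wave m h t1) * L2sq lborel (ray g \<eta>)"
    proof eventually_elim
      case (elim \<eta>)
      show ?case
      proof (cases "norm \<eta> < a / 2")
        case True
        then show ?thesis by (simp add: nullform_def zero bilin_def herm_def)
      next
        case False
        then have n0: "\<eta> \<noteq> 0" using a by auto
        have "nullform \<Gamma> (\<lambda>t x. rayint g t x \<eta>) (wave m h) t1 t2
          \<le> ennreal (4 * pi * M\<^sup>2 / norm \<eta>) * L2sq lborel (ray g \<eta>) * L2sq lborel (wave m h t1)"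
          unfolding nullform_def using elim
          by (intro rayint_flux[OF an M band_measurable[OF g] _ n0 h b' t12]) (simp add: less_top)
        also have "\<dots> \<le> ennreal (8 * pi * M\<^sup>2 / a) * L2sq lborel (ray g \<eta>) * L2sq lborel (wave m h t1)"
        proof (intro mult_right_mono ennreal_leI)
          have "4 * pi * M\<^sup>2 / norm \<eta> \<le> 4 * pi * M\<^sup>2 / (a / 2)"
            using n0 False a by (intro divide_left_mono mult_pos_pos) auto
          then show "4 * pi * M\<^sup>2 / norm \<eta> \<le> 8 * pi * M\<^sup>2 / a" by simp
        qed auto
        finally show ?thesis by (simp only: mult_ac)
      qed
    qed
  qed simp
  also have "\<dots> = ennreal (8 * b ^ 3) * (ennreal (8 * pi * M\<^sup>2 / a) * L2sq lborel (wave m h t1) * (\<integral>\<^sup>+\<eta>. L2sq lborel (ray g \<eta>) \<partial>lborel))"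
  proof -
    have "(\<lambda>\<eta>. L2sq lborel (ray g \<eta>)) \<in> borel_measurable lborel" unfolding L2sq_def by measurable
    then show ?thesis by (simp only: nn_integral_cmult)
  qed
  also have "\<dots> \<le> ennreal (8 * b ^ 3) * (ennreal (8 * pi * M\<^sup>2 / a) * L2sq lborel (wave m h t1) * (8 * L2sq lborel g))"
    by (intro mult_left_mono ray_L2sq_integral) auto
  also have "\<dots> = ennreal (512 * pi * M\<^sup>2 * (b ^ 3 / a)) * L2sq lborel g * L2sq lborel (wave m h t1)"
  proof -
    have "ennreal (512 * pi * M\<^sup>2 * (b ^ 3 / a)) = ennreal (8 * b ^ 3) * (ennreal (8 * pi * M\<^sup>2 / a) * ennreal 8)"
      using a ab by (subst ennreal_mult[symmetric], simp, simp, subst ennreal_mult[symmetric]) (auto simp: field_simps)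
    then show ?thesis by (simp add: mult_ac)
  qed
  finally show ?thesis .
qed

section \<open>From the massless to the massive flow\<close>

lemma bounded_linear_evol: "bounded_linear (evol m t \<xi>)"
proof -
  have "linear (evol m t \<xi>)"
    by (intro linearI) (simp_all add: evol_def gen_add gen_scaleR algebra_simps)
  then show ?thesis using linear_conv_bounded_linear by blast
qed

text \<open>The product rule for exp(isH) v(s): the evolution commutes with its generator, so both
  terms fall under a single evolution.\<close>

lemma evol_compose_derivative:
  assumes v: "(v has_vector_derivative v') (at s)"
  shows "((\<lambda>s. evol m (- s) \<xi> (v s)) has_vector_derivative evol m (- s) \<xi> (v' + gen m \<xi> (v s))) (at s)"
proof -
  let ?r = "freq m \<xi>"
  have G: "bounded_linear (gen m \<xi>)" using gen_linear linear_conv_bounded_linear by blast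
  have gv: "((\<lambda>s. gen m \<xi> (v s)) has_vector_derivative gen m \<xi> v') (at s)"
    by (rule bounded_linear.has_vector_derivative[OF G v])
  have c: "((\<lambda>s. cos (- s * ?r)) has_real_derivative sin (- s * ?r) * ?r) (at s)"
    by (auto intro!: derivative_eq_intros)
  have d: "((\<lambda>s. sin (- s * ?r) / ?r) has_real_derivative - (cos (- s * ?r) * ?r) / ?r) (at s)"
    by (rule DERIV_cdivide) (auto intro!: derivative_eq_intros)
  have "((\<lambda>s. evol m (- s) \<xi> (v s)) has_vector_derivative
      (cos (- s * ?r) *\<^sub>R v' + (sin (- s * ?r) * ?r) *\<^sub>R v s)
       - ((sin (- s * ?r) / ?r) *\<^sub>R gen m \<xi> v' + (- (cos (- s * ?r) * ?r) / ?r) *\<^sub>R gen m \<xi> (v s))) (at s)"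
    unfolding evol_def by (intro has_vector_derivative_diff has_vector_derivative_scaleR c d v gv)
  moreover have "(cos (- s * ?r) *\<^sub>R v' + (sin (- s * ?r) * ?r) *\<^sub>R v s)
       - ((sin (- s * ?r) / ?r) *\<^sub>R gen m \<xi> v' + (- (cos (- s * ?r) * ?r) / ?r) *\<^sub>R gen m \<xi> (v s))
     = evol m (- s) \<xi> (v' + gen m \<xi> (v s))"
    by (cases "?r = 0")
       (simp_all add: evol_def gen_add gen_gen freq_zero_gen scaleR_add_right scaleR_diff_right power2_eq_square)
  ultimately show ?thesis by simp
qed

text \<open>Pulling the massive flow back by the massless one leaves a profile whose time derivative is of
  size \<open>m\<close>.\<close>

definition profile :: "real \<Rightarrow> (real^3 \<Rightarrow> complex^4) \<Rightarrow> real \<Rightarrow> real^3 \<Rightarrow> complex^4" where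
  "profile m g s \<xi> = evol 0 (- s) \<xi> (evol m s \<xi> (g \<xi>))"

definition profile_deriv :: "real \<Rightarrow> (real^3 \<Rightarrow> complex^4) \<Rightarrow> real \<Rightarrow> real^3 \<Rightarrow> complex^4" where
  "profile_deriv m g s \<xi> = evol 0 (- s) \<xi> (- m *\<^sub>R (\<i> *s dsym 1 0 (evol m s \<xi> (g \<xi>))))"

text \<open>The massive and the massless generator differ by the mass term alone, so their
  frequency-dependent parts cancel in the derivative.\<close>

lemma profile_has_derivative:
  "((\<lambda>s. profile m g s \<xi>) has_vector_derivative profile_deriv m g s \<xi>) (at s)"
proof -
  have "- gen m \<xi> u + gen 0 \<xi> u = - m *\<^sub>R (\<i> *s dsym 1 0 u)" for u
    unfolding gen_def by (subst dsym_split) (simp add: smult_add smult_scaleR)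
  then show ?thesis
    unfolding profile_def profile_deriv_def
    using evol_compose_derivative[OF evol_has_derivative[of m \<xi> "g \<xi>" s UNIV], of 0 \<xi>] by simp
qed

lemma profile_deriv_continuous: "continuous_on UNIV (\<lambda>s. profile_deriv m g s \<xi>)"
proof -
  have L: "bounded_linear (\<lambda>u. - m *\<^sub>R (\<i> *s dsym 1 0 u))"
    by (intro bounded_linear_compose[OF bounded_linear_scaleR_right] bounded_linear_compose[OF bounded_linear_smult_right] bounded_linear_dsym)
  show ?thesis
    unfolding profile_deriv_def
    by (rule has_vector_derivative_continuous_on_UNIV[OF evol_compose_derivative[OF
          bounded_linear.has_vector_derivative[OF L evol_has_derivative[of _ _ _ _ UNIV]]]])
qed

lemma norm_profile: "norm (profile m g s \<xi>) = norm (g \<xi>)"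
  by (simp add: profile_def)

lemma norm_profile_deriv: "norm (profile_deriv m g s \<xi>) = \<bar>m\<bar> * norm (g \<xi>)"
  by (simp add: profile_deriv_def norm_vector_smult norm_dsym)

lemma profile_measurable [measurable (raw)]:
  assumes [measurable]: "g \<in> borel_measurable borel" "f \<in> borel_measurable N" "k \<in> borel_measurable N"
  shows "(\<lambda>p. profile m g (f p) (k p)) \<in> borel_measurable N"
    and "(\<lambda>p. profile_deriv m g (f p) (k p)) \<in> borel_measurable N"
  unfolding profile_def profile_deriv_def by measurable

lemma wave_profile_measurable [measurable (raw)]:
  assumes [measurable]: "g \<in> borel_measurable borel" "l \<in> borel_measurable N" "f \<in> borel_measurable N" "k \<in> borel_measurable N"
  shows "(\<lambda>p. wave 0 (profile m g (l p)) (f p) (k p)) \<in> borel_measurable N"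
    and "(\<lambda>p. wave 0 (profile_deriv m g (l p)) (f p) (k p)) \<in> borel_measurable N"
  unfolding wave_def osc_def by measurable

lemma evol_profile: "evol 0 t \<xi> (profile m g t \<xi>) = evol m t \<xi> (g \<xi>)"
  unfolding profile_def by (rule evol_inverse)

lemma wave_profile: "wave 0 (profile m g t) t x = wave m g t x"
  by (simp add: wave_def evol_profile)

lemma band_profile:
  assumes g: "band b g"
  shows "band b (profile m g s)" "L2sq lborel (profile m g s) = L2sq lborel g"
    and "band b (profile_deriv m g s)" "L2sq lborel (profile_deriv m g s) \<le> ennreal (m\<^sup>2) * L2sq lborel g"
proof -
  note [measurable] = band_measurable[OF g]
  have [measurable]: "profile m g s \<in> borel_measurable borel" "profile_deriv m g s \<in> borel_measurable borel"
    using profile_measurable[of g "\<lambda>_. s" borel "\<lambda>x. x" m] by auto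
  show "band b (profile m g s)" "L2sq lborel (profile m g s) = L2sq lborel g"
    using g by (auto simp: band_def L2sq_def norm_profile) (metis norm_eq_zero norm_profile)
  have z: "profile_deriv m g s \<xi> = 0" if "g \<xi> = 0" for \<xi>
    using norm_profile_deriv[of m g s \<xi>] that by simp
  note B = band_bound[OF g, of "profile_deriv m g s" "\<bar>m\<bar>"]
  show "band b (profile_deriv m g s)" by (rule B(1)) (auto simp: norm_profile_deriv z)
  have "L2sq lborel (profile_deriv m g s) \<le> ennreal (\<bar>m\<bar>\<^sup>2) * L2sq lborel g"
    by (rule B(2)) (auto simp: norm_profile_deriv z)
  then show "L2sq lborel (profile_deriv m g s) \<le> ennreal (m\<^sup>2) * L2sq lborel g" by simp
qed

text \<open>With the profile frozen at time \<open>s\<close> the first wave is massless and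
  \<open>massless_nullform\<close> applies, while \<open>s = t\<close> recovers the massive wave.
  The fundamental theorem of calculus in \<open>s\<close> starts from the profile frozen at
  \<open>t1\<close>. If B is the massless bound and \<delta> the length of the interval, the result
  is 2B + 2(m\<delta>)^2 B, at most 4B, and 2048 is 4 times 512.\<close>

lemma massive_nullform:
  assumes an: "anticommutes_alpha \<Gamma>" and M: "\<And>v. norm (\<Gamma> *v v) \<le> M * norm v"
    and g: "band b g" and low: "\<And>\<xi>. norm \<xi> < a \<Longrightarrow> g \<xi> = 0" and a: "0 < a" and ab: "0 \<le> b"
    and h: "band b' h" and b': "0 \<le> b'" and t12: "t1 \<le> t2" and m: "0 \<le> m" and short: "m * (t2 - t1) \<le> 1"
  shows "nullform \<Gamma> (wave m g) (wave m h) t1 t2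
     \<le> ennreal (2048 * pi * M\<^sup>2 * (b ^ 3 / a)) * L2sq lborel g * L2sq lborel (wave m h t1)"
proof -
  note [measurable] = band_measurable[OF g] band_measurable[OF h]
  define \<Psi> where "\<Psi> = wave m h"
  define \<delta> where "\<delta> = t2 - t1"
  define A where "A = ennreal (512 * pi * M\<^sup>2 * (b ^ 3 / a))"
  have \<delta>0: "0 \<le> \<delta>" using t12 by (simp add: \<delta>_def)
  have [measurable]: "f \<in> borel_measurable N \<Longrightarrow> k \<in> borel_measurable N \<Longrightarrow> (\<lambda>p. \<Psi> (f p) (k p)) \<in> borel_measurable N" for f k and N :: "'z measure"
    unfolding \<Psi>_def by measurable
  let ?q = "\<lambda>t x s. bilin \<Gamma> (wave 0 (profile m g s) t x) (\<Psi> t x)"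
  let ?q' = "\<lambda>t x s. bilin \<Gamma> (wave 0 (profile_deriv m g s) t x) (\<Psi> t x)"
  have gi: "integrable lborel (\<lambda>\<xi>. \<bar>m\<bar> * norm (g \<xi>))" using band_L1(1)[OF g ab] by auto
  have dE: "((\<lambda>s. evol 0 t \<xi> (profile m g s \<xi>)) has_vector_derivative evol 0 t \<xi> (profile_deriv m g s \<xi>)) (at s)" for t \<xi> s
    by (rule bounded_linear.has_vector_derivative[OF bounded_linear_evol profile_has_derivative])
  have dw: "((\<lambda>s. wave 0 (profile m g s) t x) has_vector_derivative wave 0 (profile_deriv m g s) t x) (at s)" for t x s
    unfolding wave_def osc_def
  proof (rule has_vector_derivative_integral_param[OF _ _ _ _ gi])
    show "integrable lborel (\<lambda>\<xi>. cis (1 * (x \<bullet> \<xi>)) *s evol 0 t \<xi> (profile m g s \<xi>))" for s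
      using integrable_wave[OF band_profile(1)[OF g] ab, of x 0 t] by simp
    show "((\<lambda>s. cis (1 * (x \<bullet> \<xi>)) *s evol 0 t \<xi> (profile m g s \<xi>)) has_vector_derivative
        cis (1 * (x \<bullet> \<xi>)) *s evol 0 t \<xi> (profile_deriv m g s \<xi>)) (at s)" for s \<xi>
      by (rule bounded_linear.has_vector_derivative[OF bounded_linear_smult_right dE])
    show "(\<lambda>\<xi>. cis (1 * (x \<bullet> \<xi>)) *s evol 0 t \<xi> (profile_deriv m g s \<xi>)) \<in> borel_measurable lborel" for s
      by measurable
  qed (simp add: norm_vector_smult norm_profile_deriv)
  have dq: "((\<lambda>s. ?q t x s) has_vector_derivative ?q' t x s) (at s)" for t x s
    by (rule bounded_linear.has_vector_derivative[OF bilin_linear dw])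
  have cw: "continuous_on UNIV (\<lambda>s. wave 0 (profile_deriv m g s) t x)" for t x
    unfolding wave_def osc_def
  proof (rule continuous_integral_param[OF _ _ _ gi])
    show "(\<lambda>\<xi>. cis (1 * (x \<bullet> \<xi>)) *s evol 0 t \<xi> (profile_deriv m g s \<xi>)) \<in> borel_measurable lborel" for s
      by measurable
    show "continuous_on UNIV (\<lambda>s. cis (1 * (x \<bullet> \<xi>)) *s evol 0 t \<xi> (profile_deriv m g s \<xi>))" for \<xi>
      unfolding evol_def
      by (intro bounded_linear.continuous_on[OF bounded_linear_smult_right] continuous_intros profile_deriv_continuous
            bounded_linear.continuous_on[OF gen_linear[unfolded linear_conv_bounded_linear]])
  qed (simp add: norm_vector_smult norm_profile_deriv)
  have cq': "continuous_on UNIV (\<lambda>s. ?q' t x s)" for t x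
    by (rule bounded_linear.continuous_on[OF bilin_linear cw])
  let ?S = "\<lambda>t x. \<integral>\<^sup>+s. indicator {t1..t2} s * ennreal ((norm (?q' t x s))\<^sup>2) \<partial>lborel"
  have pt: "ennreal ((norm (bilin \<Gamma> (wave m g t x) (\<Psi> t x)))\<^sup>2) \<le> 2 * ennreal ((norm (?q t x t1))\<^sup>2) + 2 * (ennreal \<delta> * ?S t x)"
    if t: "t \<in> {t1..t2}" for t x
  proof -
    have "?q t x t - ?q t x t1 = (\<integral>s. indicator {t1..t} s *\<^sub>R ?q' t x s \<partial>lborel)"
      by (rule integral_FTC_Icc[symmetric])
         (use t in \<open>auto intro!: has_vector_derivative_at_within[OF dq] continuous_on_subset[OF cq']\<close>)
    then have "ennreal (norm (?q t x t - ?q t x t1)) \<le> (\<integral>\<^sup>+s. ennreal (norm (indicator {t1..t} s *\<^sub>R ?q' t x s)) \<partial>lborel)"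
      by (simp only: ennreal_norm_integral_le)
    \<comment> \<open>Enlarging the range of \<open>s\<close> from {t1..t} to {t1..t2} decouples it
      from \<open>t\<close>, so that later the integral over \<open>t\<close> can be taken for fixed
      \<open>s\<close>.\<close>
    also have "\<dots> \<le> (\<integral>\<^sup>+s. indicator {t1..t2} s * (indicator {t1..t2} s * ennreal (norm (?q' t x s))) \<partial>lborel)"
      using t by (intro nn_integral_mono) (auto simp: indicator_def)
    finally have "(ennreal (norm (?q t x t - ?q t x t1)))\<^sup>2 \<le> (\<integral>\<^sup>+s. indicator {t1..t2} s * (indicator {t1..t2} s * ennreal (norm (?q' t x s))) \<partial>lborel)\<^sup>2"
      by (intro power_mono) auto
    also have "\<dots> \<le> (\<integral>\<^sup>+s. (indicator {t1..t2} s)\<^sup>2 \<partial>lborel) * (\<integral>\<^sup>+s. (indicator {t1..t2} s * ennreal (norm (?q' t x s)))\<^sup>2 \<partial>lborel)"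
      by (rule Cauchy_Schwarz_nn_integral) measurable
    also have "(\<integral>\<^sup>+s. (indicator {t1..t2} s)\<^sup>2 \<partial>lborel) = (\<integral>\<^sup>+s. indicator {t1..t2} s \<partial>lborel)"
      by (intro nn_integral_cong) (auto simp: indicator_def)
    also have "\<dots> = ennreal \<delta>" using t12 by (simp add: \<delta>_def)
    also have "(\<integral>\<^sup>+s. (indicator {t1..t2} s * ennreal (norm (?q' t x s)))\<^sup>2 \<partial>lborel) = ?S t x"
      by (intro nn_integral_cong) (auto simp: indicator_def ennreal_power)
    finally have D: "ennreal ((norm (?q t x t - ?q t x t1))\<^sup>2) \<le> ennreal \<delta> * ?S t x"
      by (simp add: ennreal_power)
    have "(norm (?q t x t))\<^sup>2 \<le> (norm (?q t x t1) + norm (?q t x t - ?q t x t1))\<^sup>2"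
      using norm_triangle_sub[of "?q t x t" "?q t x t1"] by (intro power_mono) auto
    also have "\<dots> \<le> 2 * (norm (?q t x t1))\<^sup>2 + 2 * (norm (?q t x t - ?q t x t1))\<^sup>2"
      using sum_squares_bound[of "norm (?q t x t1)" "norm (?q t x t - ?q t x t1)"] by (simp add: power2_sum)
    finally have "ennreal ((norm (?q t x t))\<^sup>2) \<le> ennreal (2 * (norm (?q t x t1))\<^sup>2 + 2 * (norm (?q t x t - ?q t x t1))\<^sup>2)"
      by (rule ennreal_leI)
    also have "\<dots> = 2 * ennreal ((norm (?q t x t1))\<^sup>2) + 2 * ennreal ((norm (?q t x t - ?q t x t1))\<^sup>2)"
      by (subst ennreal_plus) (auto simp: ennreal_mult)
    also have "\<dots> \<le> 2 * ennreal ((norm (?q t x t1))\<^sup>2) + 2 * (ennreal \<delta> * ?S t x)"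
      by (intro add_left_mono mult_left_mono D) simp
    finally show ?thesis unfolding wave_profile .
  qed
  have lowp: "profile m g s \<xi> = 0" "profile_deriv m g s \<xi> = 0" if "norm \<xi> < a" for s \<xi>
    using norm_profile[of m g s \<xi>] norm_profile_deriv[of m g s \<xi>] low[OF that] by auto
  let ?B = "A * L2sq lborel g * L2sq lborel (\<Psi> t1)"
  have T1: "nullform \<Gamma> (wave 0 (profile m g t1)) \<Psi> t1 t2 \<le> ?B"
    using massless_nullform[OF an M band_profile(1)[OF g] lowp(1) a ab h b' t12]
    unfolding A_def \<Psi>_def band_profile(2)[OF g] .
  have T2: "nullform \<Gamma> (wave 0 (profile_deriv m g s)) \<Psi> t1 t2 \<le> ennreal (m\<^sup>2) * ?B" for s
  proof -
    have "nullform \<Gamma> (wave 0 (profile_deriv m g s)) \<Psi> t1 t2 \<le> A * L2sq lborel (profile_deriv m g s) * L2sq lborel (\<Psi> t1)"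
      unfolding A_def \<Psi>_def
      by (rule massless_nullform[OF an M band_profile(3)[OF g] lowp(2) a ab h b' t12])
    also have "\<dots> \<le> A * (ennreal (m\<^sup>2) * L2sq lborel g) * L2sq lborel (\<Psi> t1)"
      by (intro mult_right_mono mult_left_mono band_profile(4)[OF g]) auto
    finally show ?thesis by (simp only: mult_ac)
  qed
  have "nullform \<Gamma> (wave m g) \<Psi> t1 t2 \<le> (\<integral>\<^sup>+t. indicator {t1..t2} t * (\<integral>\<^sup>+x. 2 * ennreal ((norm (?q t x t1))\<^sup>2) + 2 * (ennreal \<delta> * ?S t x) \<partial>lborel) \<partial>lborel)"
    unfolding nullform_def
  proof (intro nn_integral_mono)
    fix t
    show "indicator {t1..t2} t * (\<integral>\<^sup>+x. ennreal ((norm (bilin \<Gamma> (wave m g t x) (\<Psi> t x)))\<^sup>2) \<partial>lborel)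
       \<le> indicator {t1..t2} t * (\<integral>\<^sup>+x. 2 * ennreal ((norm (?q t x t1))\<^sup>2) + 2 * (ennreal \<delta> * ?S t x) \<partial>lborel)"
      by (cases "t \<in> {t1..t2}") (auto intro!: nn_integral_mono pt)
  qed
  also have "\<dots> = (\<integral>\<^sup>+t. 2 * (indicator {t1..t2} t * (\<integral>\<^sup>+x. ennreal ((norm (?q t x t1))\<^sup>2) \<partial>lborel))
        + 2 * (ennreal \<delta> * (indicator {t1..t2} t * (\<integral>\<^sup>+x. ?S t x \<partial>lborel))) \<partial>lborel)"
  proof (intro nn_integral_cong)
    fix t
    show "indicator {t1..t2} t * (\<integral>\<^sup>+x. 2 * ennreal ((norm (?q t x t1))\<^sup>2) + 2 * (ennreal \<delta> * ?S t x) \<partial>lborel)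
       = 2 * (indicator {t1..t2} t * (\<integral>\<^sup>+x. ennreal ((norm (?q t x t1))\<^sup>2) \<partial>lborel))
        + 2 * (ennreal \<delta> * (indicator {t1..t2} t * (\<integral>\<^sup>+x. ?S t x \<partial>lborel)))"
      apply (subst nn_integral_add, measurable)
      apply (subst nn_integral_cmult, measurable)
      apply (subst nn_integral_cmult, measurable)
      apply (subst nn_integral_cmult, measurable)
      apply (simp only: distrib_left mult_ac)
      done
  qed
  also have "\<dots> = 2 * nullform \<Gamma> (wave 0 (profile m g t1)) \<Psi> t1 t2
        + 2 * (ennreal \<delta> * (\<integral>\<^sup>+t. indicator {t1..t2} t * (\<integral>\<^sup>+x. ?S t x \<partial>lborel) \<partial>lborel))"
    unfolding nullform_def
    apply (subst nn_integral_add, measurable)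
    apply (subst nn_integral_cmult, measurable)
    apply (subst nn_integral_cmult, measurable)
    apply (subst nn_integral_cmult, measurable)
    done
  \<comment> \<open>With \<open>s\<close> outermost every inner integral is the null form of a
    massless wave with a fixed profile.\<close>
  also have "(\<integral>\<^sup>+t. indicator {t1..t2} t * (\<integral>\<^sup>+x. ?S t x \<partial>lborel) \<partial>lborel)
     = (\<integral>\<^sup>+s. indicator {t1..t2} s * nullform \<Gamma> (wave 0 (profile_deriv m g s)) \<Psi> t1 t2 \<partial>lborel)"
  proof -
    have "(\<integral>\<^sup>+x. ?S t x \<partial>lborel) = (\<integral>\<^sup>+s. indicator {t1..t2} s * (\<integral>\<^sup>+x. ennreal ((norm (?q' t x s))\<^sup>2) \<partial>lborel) \<partial>lborel)" for t
    proof -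
      have "(\<integral>\<^sup>+x. ?S t x \<partial>lborel) = (\<integral>\<^sup>+s. (\<integral>\<^sup>+x. indicator {t1..t2} s * ennreal ((norm (?q' t x s))\<^sup>2) \<partial>lborel) \<partial>lborel)"
        by (rule lborel_pair.Fubini') measurable
      then show ?thesis by (simp add: nn_integral_cmult)
    qed
    then have "(\<integral>\<^sup>+t. indicator {t1..t2} t * (\<integral>\<^sup>+x. ?S t x \<partial>lborel) \<partial>lborel)
      = (\<integral>\<^sup>+t. (\<integral>\<^sup>+s. indicator {t1..t2} t * (indicator {t1..t2} s * (\<integral>\<^sup>+x. ennreal ((norm (?q' t x s))\<^sup>2) \<partial>lborel)) \<partial>lborel) \<partial>lborel)"
      by (simp add: nn_integral_cmult)
    also have "\<dots> = (\<integral>\<^sup>+s. (\<integral>\<^sup>+t. indicator {t1..t2} t * (indicator {t1..t2} s * (\<integral>\<^sup>+x. ennreal ((norm (?q' t x s))\<^sup>2) \<partial>lborel)) \<partial>lborel) \<partial>lborel)"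
      by (rule lborel_pair.Fubini') measurable
    also have "\<dots> = (\<integral>\<^sup>+s. indicator {t1..t2} s * nullform \<Gamma> (wave 0 (profile_deriv m g s)) \<Psi> t1 t2 \<partial>lborel)"
      unfolding nullform_def by (simp add: mult.left_commute[of "indicator {t1..t2} _" "indicator {t1..t2} _"] nn_integral_cmult)
    finally show ?thesis .
  qed
  also have "2 * nullform \<Gamma> (wave 0 (profile m g t1)) \<Psi> t1 t2
        + 2 * (ennreal \<delta> * (\<integral>\<^sup>+s. indicator {t1..t2} s * nullform \<Gamma> (wave 0 (profile_deriv m g s)) \<Psi> t1 t2 \<partial>lborel))
     \<le> 2 * ?B + 2 * (ennreal \<delta> * (\<integral>\<^sup>+s. indicator {t1..t2} s * (ennreal (m\<^sup>2) * ?B) \<partial>lborel))"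
    by (intro add_mono mult_left_mono nn_integral_mono T1 T2) auto
  also have "(\<integral>\<^sup>+s. indicator {t1..t2} s * (ennreal (m\<^sup>2) * ?B) \<partial>lborel) = ennreal \<delta> * (ennreal (m\<^sup>2) * ?B)"
    using t12 by (simp add: nn_integral_multc \<delta>_def)
  \<comment> \<open>One factor \<delta> stems from Cauchy--Schwarz in \<open>s\<close>, the other
    from the integral over \<open>s\<close>; together with the squared mass they form
    \<open>(m * \<delta>)\<^sup>2\<close>.\<close>
  also have "2 * ?B + 2 * (ennreal \<delta> * (ennreal \<delta> * (ennreal (m\<^sup>2) * ?B))) \<le> 2 * ?B + 2 * ?B"
  proof -
    have "(m * \<delta>)\<^sup>2 \<le> 1\<^sup>2" using m \<delta>0 short by (intro power_mono) (auto simp: \<delta>_def)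
    then have "ennreal (\<delta> * (\<delta> * m\<^sup>2)) \<le> ennreal 1"
      by (intro ennreal_leI) (simp add: power2_eq_square mult_ac)
    then have "ennreal \<delta> * (ennreal \<delta> * ennreal (m\<^sup>2)) \<le> 1"
      using \<delta>0 by (simp add: ennreal_mult)
    then have "ennreal \<delta> * (ennreal \<delta> * ennreal (m\<^sup>2)) * ?B \<le> 1 * ?B" by (rule mult_right_mono) simp
    then have "ennreal \<delta> * (ennreal \<delta> * (ennreal (m\<^sup>2) * ?B)) \<le> ?B" by (simp only: mult.assoc mult_1)
    then show ?thesis by (intro add_left_mono mult_left_mono) auto
  qed
  also have "2 * ?B + 2 * ?B = ennreal (2048 * pi * M\<^sup>2 * (b ^ 3 / a)) * L2sq lborel g * L2sq lborel (\<Psi> t1)"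
  proof -
    have "ennreal (2048 * pi * M\<^sup>2 * (b ^ 3 / a)) = 4 * A"
      unfolding A_def using a ab by (subst ennreal_numeral[symmetric], subst ennreal_mult[symmetric]) auto
    moreover have "2 * ?B + 2 * ?B = 4 * ?B" by (simp flip: distrib_right)
    ultimately show ?thesis by (simp only: mult_ac)
  qed
  finally show ?thesis unfolding \<Psi>_def .
qed

section \<open>Long time intervals and the two bounds in the minimum\<close>

text \<open>Squared norms add over time intervals, and all intervals cost the same, because the wave
  at each left endpoint is bounded by the profile through \<open>wave_L2sq_le\<close>.\<close>

lemma massive_nullform_long:
  assumes an: "anticommutes_alpha \<Gamma>" and M: "\<And>v. norm (\<Gamma> *v v) \<le> M * norm v"
    and g: "band b g" and low: "\<And>\<xi>. norm \<xi> < a \<Longrightarrow> g \<xi> = 0" and a: "0 < a" and ab: "0 \<le> b"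
    and h: "band b' h" and b': "0 \<le> b'" and m: "0 \<le> m" and T: "0 < T"
  shows "nullform \<Gamma> (wave m g) (wave m h) 0 T
     \<le> ennreal ((2 + m * T) * (2048 * pi * M\<^sup>2 * (b ^ 3 / a) * (2 * pi) ^ 3)) * L2sq lborel g * L2sq lborel h"
proof -
  note [measurable] = band_measurable[OF g] band_measurable[OF h]
  \<comment> \<open>Adding 1 to the ceiling keeps \<open>n\<close> positive even for
    \<open>m = 0\<close>, and \<open>n\<close> still does not exceed
    \<open>2 + m * T\<close>.\<close>
  define n where "n = nat \<lceil>m * T\<rceil> + 1"
  define D where "D = 2048 * pi * M\<^sup>2 * (b ^ 3 / a)"
  have D0: "0 \<le> D" using a ab by (simp add: D_def)
  have n1: "0 < real n" by (simp add: n_def)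
  have mT: "0 \<le> m * T" using m T by simp
  then have nle: "real n \<le> 2 + m * T" and nge: "m * T \<le> real n"
    unfolding n_def by linarith+
  define p where "p i = real i * (T / real n)" for i
  have short: "m * (p (Suc i) - p i) \<le> 1" for i
  proof -
    have "m * (p (Suc i) - p i) = m * T / real n" unfolding p_def of_nat_Suc by (simp add: algebra_simps add_divide_distrib)
    also have "\<dots> \<le> 1" using nge n1 by simp
    finally show ?thesis .
  qed
  have pm: "p i \<le> p (Suc i)" for i unfolding p_def using T n1 by (intro mult_right_mono) auto
  \<comment> \<open>Neighbouring closed intervals share an endpoint, so the indicators satisfy an
    inequality, enough for nonnegative integrands.\<close>
  have cover: "(indicator {0..T} t :: ennreal) \<le> (\<Sum>i<n. indicator {p i..p (Suc i)} t)" for t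
  proof (cases "t \<in> {0..T}")
    case True
    \<comment> \<open>For \<open>t = T\<close> the floor would give index \<open>n\<close>; this
      endpoint belongs to the last interval, of index \<open>n - 1\<close>.\<close>
    define j where "j = (if t = T then n - 1 else nat \<lfloor>t / (T / real n)\<rfloor>)"
    have Tn: "0 < T / real n" using T n1 by simp
    have "j < n \<and> t \<in> {p j..p (Suc j)}"
    proof (cases "t = T")
      case True
      have "p (Suc j) = T" using True n1 by (simp add: j_def p_def n_def)
      moreover have "p j \<le> T" using pm[of j] calculation by simp
      ultimately show ?thesis using True by (simp add: j_def n_def)
    next
      case False
      then have t: "0 \<le> t" "t < T" using \<open>t \<in> {0..T}\<close> by auto
      have q: "0 \<le> t / (T / real n)" using t Tn by simp
      have qn: "t / (T / real n) < real n" using t T n1 by (simp add: field_simps)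
      have j: "real j \<le> t / (T / real n)" "t / (T / real n) < real j + 1"
      proof -
        have "real j = real_of_int \<lfloor>t / (T / real n)\<rfloor>" using False q unfolding j_def by simp
        then show "real j \<le> t / (T / real n)" "t / (T / real n) < real j + 1" by linarith+
      qed
      have "j < n" using j qn by linarith
      moreover have "p j \<le> t" "t \<le> p (Suc j)"
      proof -
        show "p j \<le> t" unfolding p_def using j(1) pos_le_divide_eq[OF Tn] by blast
        have "t < (real j + 1) * (T / real n)" using j(2) pos_divide_less_eq[OF Tn] by blast
        then show "t \<le> p (Suc j)" unfolding p_def of_nat_Suc by (simp only: add.commute less_imp_le)
      qed
      ultimately show ?thesis by simp
    qed
    then have "indicator {p j..p (Suc j)} t = (1::ennreal)" "j \<in> {..<n}" by auto
    moreover from this(2) have "(indicator {p j..p (Suc j)} t :: ennreal) \<le> (\<Sum>i<n. indicator {p i..p (Suc i)} t)"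
      by (intro member_le_sum[of j "{..<n}" "\<lambda>i. indicator {p i..p (Suc i)} t"]) auto
    ultimately show ?thesis using True by simp
  qed simp
  let ?X = "\<lambda>t. \<integral>\<^sup>+x. ennreal ((norm (bilin \<Gamma> (wave m g t x) (wave m h t x)))\<^sup>2) \<partial>lborel"
  have "nullform \<Gamma> (wave m g) (wave m h) 0 T \<le> (\<integral>\<^sup>+t. (\<Sum>i<n. indicator {p i..p (Suc i)} t) * ?X t \<partial>lborel)"
    unfolding nullform_def by (intro nn_integral_mono mult_right_mono cover) simp
  also have "\<dots> = (\<integral>\<^sup>+t. (\<Sum>i<n. indicator {p i..p (Suc i)} t * ?X t) \<partial>lborel)"
    by (simp only: sum_distrib_right)
  also have "\<dots> = (\<Sum>i<n. nullform \<Gamma> (wave m g) (wave m h) (p i) (p (Suc i)))"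
    unfolding nullform_def by (rule nn_integral_sum) measurable
  also have "\<dots> \<le> (\<Sum>i<n. ennreal (D * (2 * pi) ^ 3) * L2sq lborel g * L2sq lborel h)"
  proof (intro sum_mono)
    fix i
    have "nullform \<Gamma> (wave m g) (wave m h) (p i) (p (Suc i)) \<le> ennreal D * L2sq lborel g * L2sq lborel (wave m h (p i))"
      unfolding D_def by (rule massive_nullform[OF an M g low a ab h b' pm m short])
    also have "\<dots> \<le> ennreal D * L2sq lborel g * (ennreal ((2 * pi) ^ 3) * L2sq lborel h)"
      by (intro mult_left_mono wave_L2sq_le[OF h b']) simp
    also have "\<dots> = ennreal (D * (2 * pi) ^ 3) * L2sq lborel g * L2sq lborel h"
      using D0 by (simp only: ennreal_mult zero_le_power mult_ac pi_ge_zero zero_le_numeral mult_nonneg_nonneg)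
    finally show "nullform \<Gamma> (wave m g) (wave m h) (p i) (p (Suc i)) \<le> ennreal (D * (2 * pi) ^ 3) * L2sq lborel g * L2sq lborel h" .
  qed
  also have "\<dots> = ennreal (real n * (D * (2 * pi) ^ 3)) * L2sq lborel g * L2sq lborel h"
    using D0 by (simp only: sum_constant card_lessThan ennreal_mult' of_nat_0_le_iff ennreal_of_nat_eq_real_of_nat mult_ac)
  also have "\<dots> \<le> ennreal ((2 + m * T) * (D * (2 * pi) ^ 3)) * L2sq lborel g * L2sq lborel h"
    using D0 by (intro mult_right_mono ennreal_leI nle) auto
  finally show ?thesis unfolding D_def .
qed

text \<open>At each time the first wave is taken in the sup norm and the second in L2; both bounds
  are uniform in time, so the time integral contributes \<open>T\<close>.\<close>

lemma bernstein_nullform: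
  assumes M: "\<And>v. norm (\<Gamma> *v v) \<le> M * norm v"
    and g: "band b g" and ab: "0 \<le> b" and h: "band b' h" and b': "0 \<le> b'" and T: "0 < T" and M0: "0 \<le> M"
  shows "nullform \<Gamma> (wave m g) (wave m h) 0 T
     \<le> ennreal (T * (M\<^sup>2 * (8 * b ^ 3) * (2 * pi) ^ 3)) * L2sq lborel g * L2sq lborel h"
proof -
  note [measurable] = band_measurable[OF g] band_measurable[OF h]
  define S where "S = M\<^sup>2 * (8 * b ^ 3)"
  have S0: "0 \<le> S" using ab by (simp add: S_def)
  have pt: "ennreal ((norm (bilin \<Gamma> (wave m g t x) (wave m h t x)))\<^sup>2) \<le> ennreal S * L2sq lborel g * ennreal ((norm (wave m h t x))\<^sup>2)" for t x
  proof -
    have "norm (bilin \<Gamma> (wave m g t x) (wave m h t x)) \<le> norm (\<Gamma> *v wave m g t x) * norm (wave m h t x)"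
      unfolding bilin_def by (rule herm_cauchy_schwarz)
    also have "\<dots> \<le> (M * (sqrt (8 * b ^ 3) * L2_norm lborel g)) * norm (wave m h t x)"
      by (intro mult_right_mono order_trans[OF M] mult_left_mono wave_norm_le[OF g ab] M0) auto
    finally have "(norm (bilin \<Gamma> (wave m g t x) (wave m h t x)))\<^sup>2 \<le> ((M * (sqrt (8 * b ^ 3) * L2_norm lborel g)) * norm (wave m h t x))\<^sup>2"
      by (intro power_mono) auto
    also have "\<dots> = S * (L2_norm lborel g)\<^sup>2 * (norm (wave m h t x))\<^sup>2"
      using ab by (simp add: S_def power_mult_distrib)
    finally have "ennreal ((norm (bilin \<Gamma> (wave m g t x) (wave m h t x)))\<^sup>2) \<le> ennreal (S * (L2_norm lborel g)\<^sup>2 * (norm (wave m h t x))\<^sup>2)"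
      by (rule ennreal_leI)
    then show ?thesis
      using S0 by (simp add: ennreal_mult square_integrable_L2sq[OF band_square_integrable[OF g]])
  qed
  have "nullform \<Gamma> (wave m g) (wave m h) 0 T \<le> (\<integral>\<^sup>+t. indicator {0..T} t * (\<integral>\<^sup>+x. ennreal S * L2sq lborel g * ennreal ((norm (wave m h t x))\<^sup>2) \<partial>lborel) \<partial>lborel)"
    unfolding nullform_def by (intro nn_integral_mono mult_left_mono pt) simp
  also have "\<dots> = (\<integral>\<^sup>+t. indicator {0..T} t * (ennreal S * L2sq lborel g * L2sq lborel (wave m h t)) \<partial>lborel)"
    unfolding L2sq_def[of lborel "wave m h _"] by (subst nn_integral_cmult) auto
  also have "\<dots> \<le> (\<integral>\<^sup>+t. indicator {0..T} t * (ennreal S * L2sq lborel g * (ennreal ((2 * pi) ^ 3) * L2sq lborel h)) \<partial>lborel)"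
    by (intro nn_integral_mono mult_left_mono wave_L2sq_le[OF h b']) auto
  also have "\<dots> = ennreal T * (ennreal S * L2sq lborel g * (ennreal ((2 * pi) ^ 3) * L2sq lborel h))"
    using T by (simp add: nn_integral_multc)
  also have "\<dots> = ennreal (T * (S * (2 * pi) ^ 3)) * L2sq lborel g * L2sq lborel h"
    using T S0 by (simp only: ennreal_mult less_imp_le zero_le_power mult_ac pi_ge_zero zero_le_numeral mult_nonneg_nonneg)
  finally show ?thesis unfolding S_def .
qed

section \<open>Dirac components\<close>

lemma mat_of_real_mult: "mat (of_real c) *v (v::complex^4) = c *\<^sub>R v"
  by (simp add: vec_eq_iff forall_4 matrix_vector_mult_def mat_def sum_4 scaleR_conv_complex)

text \<open>For every \<open>t\<close> the multiplier relation brings its own transform of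
  \<open>g\<close>; uniqueness identifies all of them with one profile \<open>h\<close>. Its
  evolution is integrable, so inversion applies at each time. At \<open>t = 0\<close> the evolution
  is the identity, which bounds the profile by the initial data.\<close>

lemma dirac_component_wave:
  assumes [measurable]: "cutoff \<in> borel_measurable borel"
    and supp: "\<And>\<xi>. cutoff \<xi> \<noteq> 0 \<Longrightarrow> c0 \<le> norm \<xi> \<and> norm \<xi> \<le> C0" and C0: "0 \<le> C0" and N: "0 < N"
    and comp: "dirac_component cutoff m N f \<Phi>"
  obtains h where "band (C0 * N) h" "\<And>\<xi>. norm \<xi> < c0 * N \<Longrightarrow> h \<xi> = 0"
    "\<And>t. AE x in lborel. \<Phi> t x = (1 / (2 * pi) ^ 3) *\<^sub>R wave m h t x"
    "L2sq lborel h \<le> ennreal (4 * (2 * pi) ^ 3) * L2sq lborel (\<Phi> 0)"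
    "\<And>t. square_integrable lborel (\<Phi> t)"
proof -
  obtain g where LP: "LP_projection cutoff N f g" and pr: "\<And>t. dirac_propagator m t g (\<Phi> t)"
    using comp unfolding dirac_component_def by auto
  obtain fh where gh: "has_fourier_L2 g (\<lambda>\<xi>. mat (of_real (cutoff (\<xi> /\<^sub>R N))) *v fh \<xi>)"
    using LP unfolding LP_projection_def fourier_multiplier_def by auto
  define h where "h \<xi> = cutoff (\<xi> /\<^sub>R N) *\<^sub>R fh \<xi>" for \<xi>
  have gh': "has_fourier_L2 g h"
    using gh unfolding mat_of_real_mult h_def .
  then have sh: "square_integrable lborel h" by (simp add: has_fourier_L2_def)
  then have [measurable]: "h \<in> borel_measurable borel" by (simp add: square_integrable_def)
  have hs: "h \<xi> = 0 \<or> c0 * N \<le> norm \<xi> \<and> norm \<xi> \<le> C0 * N" for \<xi>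
    using supp[of "\<xi> /\<^sub>R N"] N by (cases "cutoff (\<xi> /\<^sub>R N) = 0") (auto simp: h_def field_simps)
  have band: "band (C0 * N) h"
    using sh hs by (force simp: band_def square_integrable_iff_L2sq)
  have CN: "0 \<le> C0 * N" using C0 N by simp
  have Pt: "\<exists>u. has_fourier_L2 (\<Phi> t) u \<and> (AE \<xi> in lborel. u \<xi> = evol m t \<xi> (h \<xi>))" for t
  proof -
    obtain w where w: "has_fourier_L2 g w" "has_fourier_L2 (\<Phi> t) (\<lambda>\<xi>. propagator_symbol m t \<xi> *v w \<xi>)"
      using pr[of t] unfolding dirac_propagator_def fourier_multiplier_def by auto
    have "AE \<xi> in lborel. w \<xi> = h \<xi>" by (rule has_fourier_L2_unique[OF w(1) gh'])
    then have "AE \<xi> in lborel. propagator_symbol m t \<xi> *v w \<xi> = evol m t \<xi> (h \<xi>)"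
      by eventually_elim (simp add: propagator_symbol_evol)
    with w(2) show ?thesis by blast
  qed
  show thesis
  proof
    show "band (C0 * N) h" by (rule band)
    show "h \<xi> = 0" if "norm \<xi> < c0 * N" for \<xi> using hs[of \<xi>] that by auto
    show "square_integrable lborel (\<Phi> t)" for t using Pt[of t] by (auto simp: has_fourier_L2_def)
    show "AE x in lborel. \<Phi> t x = (1 / (2 * pi) ^ 3) *\<^sub>R wave m h t x" for t
    proof -
      obtain u where u: "has_fourier_L2 (\<Phi> t) u" and ae: "AE \<xi> in lborel. u \<xi> = evol m t \<xi> (h \<xi>)" using Pt by blast
      have [measurable]: "u \<in> borel_measurable borel" using u by (simp add: has_fourier_L2_def square_integrable_def)
      have ui: "integrable lborel u"
        using band_L1(1)[OF band_evol[OF band] CN, of m t] ae by (subst integrable_cong_AE[of u lborel "\<lambda>\<xi>. evol m t \<xi> (h \<xi>)"]) auto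
      have "osc 1 u x = wave m h t x" for x
        unfolding wave_def osc_def by (rule integral_cong_AE) (use ae in \<open>auto elim: eventually_mono\<close>)
      then show ?thesis using has_fourier_L2_inversion[OF u ui] by simp
    qed
    show "L2sq lborel h \<le> ennreal (4 * (2 * pi) ^ 3) * L2sq lborel (\<Phi> 0)"
    proof -
      obtain u where u: "has_fourier_L2 (\<Phi> 0) u" and ae: "AE \<xi> in lborel. u \<xi> = evol m 0 \<xi> (h \<xi>)" using Pt by blast
      have "L2sq lborel u = L2sq lborel h"
        unfolding L2sq_def by (rule nn_integral_cong_AE) (use ae in \<open>auto elim: eventually_mono\<close>)
      then show ?thesis using has_fourier_L2_bound[OF u] by simp
    qed
  qed
qed

lemma matrix_vector_bound: "\<exists>M\<ge>0. \<forall>v. norm ((\<Gamma>::complex^4^4) *v v) \<le> M * norm v"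
proof -
  have "linear ((*v) \<Gamma>)" by (intro linearI) (simp_all add: matrix_vector_right_distrib matrix_vector_scaleR)
  then have "bounded_linear ((*v) \<Gamma>)" by (simp add: linear_conv_bounded_linear)
  from bounded_linear.nonneg_bounded[OF this] show ?thesis by (auto simp: mult.commute)
qed

lemma nullform_cadj: "nullform \<Gamma> u v t1 t2 = nullform (cadj \<Gamma>) v u t1 t2"
  unfolding nullform_def norm_bilin_cadj[of \<Gamma>] ..

text \<open>The wave of lower frequency stands in the first slot, the one that is split into rays or
  taken in the sup norm. \<open>K\<close> dominates the numerical constants of both
  estimates.\<close>

lemma nullform_low_high:
  assumes an: "anticommutes_alpha \<Gamma>" and M: "\<And>v. norm (\<Gamma> *v v) \<le> M * norm v" and M0: "0 \<le> M"
    and g: "band (C0 * N1) g" and low: "\<And>\<xi>. norm \<xi> < c0 * N1 \<Longrightarrow> g \<xi> = 0" and c: "0 < c0" "0 < C0"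
    and h: "band (C0 * N2) h" and N: "0 < N1" "N1 \<le> N2" and m: "0 \<le> m" and T: "0 < T"
    and K: "2048 * pi * M\<^sup>2 * (C0 ^ 3 / c0) * (2 * pi) ^ 3 \<le> K" "M\<^sup>2 * (8 * C0 ^ 3) * (2 * pi) ^ 3 \<le> K"
  shows "nullform \<Gamma> (wave m g) (wave m h) 0 T \<le> ennreal (K * (bilinear_const m T N1 N2)\<^sup>2) * L2sq lborel g * L2sq lborel h"
proof -
  have b: "0 \<le> C0 * N1" "0 \<le> C0 * N2" and a: "0 < c0 * N1" using c N by auto
  have mT: "0 \<le> m * T" using m T by simp
  \<comment> \<open>The square of the minimum is one of two explicit values, and the estimate with
    the same power of \<open>N1\<close> is used in each case.\<close>
  have "(min (N1 * sqrt (2 + m * T)) (N1 powr (3/2) * T powr (1/2)))\<^sup>2 \<in> {(2 + m * T) * N1\<^sup>2, T * N1 ^ 3}"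
  proof -
    have 1: "(N1 * sqrt (2 + m * T))\<^sup>2 = (2 + m * T) * N1\<^sup>2" using mT by (simp add: power_mult_distrib)
    have "(N1 powr (3/2) * T powr (1/2))\<^sup>2 = (N1 powr (3/2))\<^sup>2 * (T powr (1/2))\<^sup>2" by (rule power_mult_distrib)
    also have "(N1 powr (3/2))\<^sup>2 = N1 ^ 3" using N by (simp add: powr_power)
    also have "(T powr (1/2))\<^sup>2 = T" using T by (simp add: powr_power)
    finally have "(N1 powr (3/2) * T powr (1/2))\<^sup>2 = T * N1 ^ 3" by (simp add: mult.commute)
    then show ?thesis using 1 by (auto simp: min_def)
  qed
  moreover have "bilinear_const m T N1 N2 = min (N1 * sqrt (2 + m * T)) (N1 powr (3/2) * T powr (1/2))"
    using N by (simp add: bilinear_const_def min_absorb1)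
  ultimately consider "(bilinear_const m T N1 N2)\<^sup>2 = (2 + m * T) * N1\<^sup>2" | "(bilinear_const m T N1 N2)\<^sup>2 = T * N1 ^ 3"
    by auto
  then show ?thesis
  proof cases
    case 1
    have "nullform \<Gamma> (wave m g) (wave m h) 0 T
       \<le> ennreal ((2 + m * T) * (2048 * pi * M\<^sup>2 * ((C0 * N1) ^ 3 / (c0 * N1)) * (2 * pi) ^ 3)) * L2sq lborel g * L2sq lborel h"
      by (rule massive_nullform_long[OF an M g low a b(1) h b(2) m T])
    also have "\<dots> \<le> ennreal (K * (bilinear_const m T N1 N2)\<^sup>2) * L2sq lborel g * L2sq lborel h"
    proof (intro mult_right_mono ennreal_leI)
      have "(2 + m * T) * (2048 * pi * M\<^sup>2 * ((C0 * N1) ^ 3 / (c0 * N1)) * (2 * pi) ^ 3)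
         = (2048 * pi * M\<^sup>2 * (C0 ^ 3 / c0) * (2 * pi) ^ 3) * ((2 + m * T) * N1\<^sup>2)"
        using N c by (simp add: field_simps power2_eq_square power3_eq_cube)
      also have "\<dots> \<le> K * ((2 + m * T) * N1\<^sup>2)"
        using mT by (intro mult_right_mono K) auto
      finally show "(2 + m * T) * (2048 * pi * M\<^sup>2 * ((C0 * N1) ^ 3 / (c0 * N1)) * (2 * pi) ^ 3) \<le> K * (bilinear_const m T N1 N2)\<^sup>2"
        unfolding 1 .
    qed auto
    finally show ?thesis .
  next
    case 2
    have "nullform \<Gamma> (wave m g) (wave m h) 0 T
       \<le> ennreal (T * (M\<^sup>2 * (8 * (C0 * N1) ^ 3) * (2 * pi) ^ 3)) * L2sq lborel g * L2sq lborel h"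
      by (rule bernstein_nullform[OF M g b(1) h b(2) T M0])
    also have "\<dots> \<le> ennreal (K * (bilinear_const m T N1 N2)\<^sup>2) * L2sq lborel g * L2sq lborel h"
    proof (intro mult_right_mono ennreal_leI)
      have "T * (M\<^sup>2 * (8 * (C0 * N1) ^ 3) * (2 * pi) ^ 3) = (M\<^sup>2 * (8 * C0 ^ 3) * (2 * pi) ^ 3) * (T * N1 ^ 3)"
        by (simp add: power_mult_distrib)
      also have "\<dots> \<le> K * (T * N1 ^ 3)"
        using T N by (intro mult_right_mono K) auto
      finally show "T * (M\<^sup>2 * (8 * (C0 * N1) ^ 3) * (2 * pi) ^ 3) \<le> K * (bilinear_const m T N1 N2)\<^sup>2"
        unfolding 2 .
    qed auto
    finally show ?thesis .
  qed
qed

lemma slab_sets: "{0..T} \<times> (UNIV :: (real^3) set) \<in> sets (borel :: (real \<times> (real^3)) measure)"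
  by (intro borel_closed closed_Times) auto

lemma L2sq_slab:
  fixes F :: "real \<Rightarrow> real^3 \<Rightarrow> complex"
  assumes [measurable]: "case_prod F \<in> borel_measurable borel"
  shows "L2sq (spacetime_slab T) (case_prod F) = (\<integral>\<^sup>+t. indicator {0..T} t * (\<integral>\<^sup>+x. ennreal ((norm (F t x))\<^sup>2) \<partial>lborel) \<partial>lborel)"
proof -
  have mF: "case_prod F \<in> borel_measurable (lborel \<Otimes>\<^sub>M lborel)"
    using assms unfolding lborel_prod by simp
  then have [measurable]: "(\<lambda>p. F (fst p) (snd p)) \<in> borel_measurable (lborel \<Otimes>\<^sub>M lborel)"
    by (simp add: case_prod_beta')
  have "L2sq (spacetime_slab T) (case_prod F)
     = (\<integral>\<^sup>+p. ennreal ((norm (case_prod F p))\<^sup>2) * indicator ({0..T} \<times> UNIV) p \<partial>lborel)"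
    unfolding L2sq_def spacetime_slab_def
    by (rule nn_integral_restrict_space) (use slab_sets in simp)
  also have "\<dots> = (\<integral>\<^sup>+p. indicator {0..T} (fst p) * ennreal ((norm (F (fst p) (snd p)))\<^sup>2) \<partial>(lborel \<Otimes>\<^sub>M lborel))"
    unfolding lborel_prod by (intro nn_integral_cong) (auto simp: indicator_def split: prod.splits)
  also have "\<dots> = (\<integral>\<^sup>+t. \<integral>\<^sup>+x. indicator {0..T} t * ennreal ((norm (F t x))\<^sup>2) \<partial>lborel \<partial>lborel)"
    by (subst lborel.nn_integral_fst[symmetric]) simp_all
  also have "\<dots> = (\<integral>\<^sup>+t. indicator {0..T} t * (\<integral>\<^sup>+x. ennreal ((norm (F t x))\<^sup>2) \<partial>lborel) \<partial>lborel)"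
  proof (intro nn_integral_cong)
    fix t :: real
    have [measurable]: "F t \<in> borel_measurable borel"
      using measurable_compose[OF measurable_Pair1' mF, of t] by simp
    show "(\<integral>\<^sup>+x. indicator {0..T} t * ennreal ((norm (F t x))\<^sup>2) \<partial>lborel) = indicator {0..T} t * (\<integral>\<^sup>+x. ennreal ((norm (F t x))\<^sup>2) \<partial>lborel)"
      by (intro nn_integral_cmult) measurable
  qed
  finally show ?thesis .
qed

lemma bilin_scaleR: "bilin \<Gamma> (r *\<^sub>R u) (r *\<^sub>R v) = (r\<^sup>2) *\<^sub>R bilin \<Gamma> u v"
  by (simp add: bilin_def matrix_vector_scaleR herm_scaleR_left herm_scaleR_right power2_eq_square)

theorem bilinear_estimate:
  fixes cutoff :: "real^3 \<Rightarrow> real"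
  assumes cut: "frequency_cutoff cutoff" and an: "anticommutes_alpha \<Gamma>"
  obtains C where "C > 0"
    "\<And>m T N1 N2 \<Phi>0 \<Psi>0 \<Phi> \<Psi>. \<lbrakk>m \<ge> 0; T > 0; N1 \<in> dyadic; N2 \<in> dyadic;
        dirac_component cutoff m N1 \<Phi>0 \<Phi>; dirac_component cutoff m N2 \<Psi>0 \<Psi>\<rbrakk> \<Longrightarrow>
      square_integrable (spacetime_slab T) (\<lambda>(t, x). bilin \<Gamma> (\<Phi> t x) (\<Psi> t x)) \<and>
      L2_norm (spacetime_slab T) (\<lambda>(t, x). bilin \<Gamma> (\<Phi> t x) (\<Psi> t x))
        \<le> C * bilinear_const m T N1 N2 * L2_norm lborel (\<Phi> 0) * L2_norm lborel (\<Psi> 0)"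
proof -
  obtain c0 C0 where c: "0 < c0" "c0 < C0" and cl: "closure {\<xi>. cutoff \<xi> \<noteq> 0} \<subseteq> {\<xi>. c0 \<le> norm \<xi> \<and> norm \<xi> \<le> C0}"
    using cut unfolding frequency_cutoff_def by auto
  have "C_order 0 cutoff" using cut unfolding frequency_cutoff_def smooth_def by blast
  then have [measurable]: "cutoff \<in> borel_measurable borel" by (simp add: borel_measurable_continuous_onI)
  have supp: "c0 \<le> norm \<xi> \<and> norm \<xi> \<le> C0" if "cutoff \<xi> \<noteq> 0" for \<xi>
    using cl closure_subset[of "{\<xi>. cutoff \<xi> \<noteq> 0}"] that by blast
  obtain M1 where M1: "0 \<le> M1" "\<And>v. norm (\<Gamma> *v v) \<le> M1 * norm v" using matrix_vector_bound by blast
  obtain M2 where M2: "0 \<le> M2" "\<And>v. norm (cadj \<Gamma> *v v) \<le> M2 * norm v" using matrix_vector_bound by blast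
  \<comment> \<open>One bound for \<Gamma> and its adjoint, since the slots are exchanged when the
    second frequency is the lower one.\<close>
  define M where "M = max M1 M2"
  have M0: "0 \<le> M" using M1(1) by (simp add: M_def)
  have MG: "norm (\<Gamma> *v v) \<le> M * norm v" "norm (cadj \<Gamma> *v v) \<le> M * norm v" for v
  proof -
    have "M1 * norm v \<le> M * norm v" "M2 * norm v \<le> M * norm v"
      by (auto simp: M_def intro: mult_right_mono)
    then show "norm (\<Gamma> *v v) \<le> M * norm v" "norm (cadj \<Gamma> *v v) \<le> M * norm v"
      using M1(2)[of v] M2(2)[of v] by linarith+
  qed
  define K where "K = max (2048 * pi * M\<^sup>2 * (C0 ^ 3 / c0) * (2 * pi) ^ 3) (M\<^sup>2 * (8 * C0 ^ 3) * (2 * pi) ^ 3)"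
  have K: "2048 * pi * M\<^sup>2 * (C0 ^ 3 / c0) * (2 * pi) ^ 3 \<le> K" "M\<^sup>2 * (8 * C0 ^ 3) * (2 * pi) ^ 3 \<le> K"
    by (simp_all add: K_def)
  have K0: "0 \<le> K" using K(2) c by (intro order_trans[OF _ K(2)]) auto
  \<comment> \<open>\<kappa> is the inversion factor of a single wave; it enters to the fourth power
    because a product of two waves is squared. \<open>B\<close> is the loss from the initial data to
    the profile, incurred once per wave.\<close>
  define \<kappa> where "\<kappa> = 1 / (2 * pi) ^ 3"
  define B where "B = 4 * (2 * pi) ^ 3"
  \<comment> \<open>Adding 1 makes \<open>C\<close> positive even if \<open>K\<close> is 0, as can
    happen for \<Gamma> = 0.\<close>
  define C where "C = sqrt (\<kappa> ^ 4 * K * B\<^sup>2) + 1"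
  have \<kappa>B: "0 \<le> \<kappa>" "0 \<le> B" by (simp_all add: \<kappa>_def B_def)
  have C0': "0 < C" unfolding C_def using \<kappa>B K0 by (intro add_nonneg_pos) auto
  have CC: "\<kappa> ^ 4 * K * B\<^sup>2 \<le> C\<^sup>2"
  proof -
    have "\<kappa> ^ 4 * K * B\<^sup>2 = (sqrt (\<kappa> ^ 4 * K * B\<^sup>2))\<^sup>2" using \<kappa>B K0 by simp
    also have "\<dots> \<le> C\<^sup>2" unfolding C_def using \<kappa>B K0 by (intro power_mono) auto
    finally show ?thesis .
  qed
  show thesis
  proof (rule that[OF C0'], intro conjI)
    fix m T N1 N2 :: real and \<Phi>0 \<Psi>0 \<Phi> \<Psi>
    assume m: "0 \<le> m" and T: "0 < T" and N1: "N1 \<in> dyadic" and N2: "N2 \<in> dyadic"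
      and \<Phi>: "dirac_component cutoff m N1 \<Phi>0 \<Phi>" and \<Psi>: "dirac_component cutoff m N2 \<Psi>0 \<Psi>"
    have N: "0 < N1" "0 < N2" using N1 N2 by (auto simp: dyadic_def)
    have C00: "0 \<le> C0" "0 < C0" using c by auto
    obtain g where g: "band (C0 * N1) g" "\<And>\<xi>. norm \<xi> < c0 * N1 \<Longrightarrow> g \<xi> = 0"
        "\<And>t. AE x in lborel. \<Phi> t x = (1 / (2 * pi) ^ 3) *\<^sub>R wave m g t x"
        "L2sq lborel g \<le> ennreal (4 * (2 * pi) ^ 3) * L2sq lborel (\<Phi> 0)" "\<And>t. square_integrable lborel (\<Phi> t)"
      using dirac_component_wave[OF _ supp C00(1) N(1) \<Phi>] by auto
    obtain h where h: "band (C0 * N2) h" "\<And>\<xi>. norm \<xi> < c0 * N2 \<Longrightarrow> h \<xi> = 0"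
        "\<And>t. AE x in lborel. \<Psi> t x = (1 / (2 * pi) ^ 3) *\<^sub>R wave m h t x"
        "L2sq lborel h \<le> ennreal (4 * (2 * pi) ^ 3) * L2sq lborel (\<Psi> 0)" "\<And>t. square_integrable lborel (\<Psi> t)"
      using dirac_component_wave[OF _ supp C00(1) N(2) \<Psi>] by auto
    let ?bc = "bilinear_const m T N1 N2"
    have nf: "nullform \<Gamma> (wave m g) (wave m h) 0 T \<le> ennreal (K * ?bc\<^sup>2) * L2sq lborel g * L2sq lborel h"
    proof (cases "N1 \<le> N2")
      case True
      show ?thesis
        by (rule nullform_low_high[OF an MG(1) M0 g(1,2) c(1) C00(2) h(1) N(1) True m T K])
    next
      case False
      \<comment> \<open>Exchanging the slots replaces \<Gamma> by its adjoint and leaves the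
        constant unchanged, since the minimum of the frequencies is symmetric.\<close>
      then have le: "N2 \<le> N1" by simp
      have "nullform (cadj \<Gamma>) (wave m h) (wave m g) 0 T \<le> ennreal (K * (bilinear_const m T N2 N1)\<^sup>2) * L2sq lborel h * L2sq lborel g"
        by (rule nullform_low_high[OF anticommutes_cadj[OF an] MG(2) M0 h(1,2) c(1) C00(2) g(1) N(2) le m T K])
      moreover have "bilinear_const m T N2 N1 = ?bc" by (simp add: bilinear_const_def min.commute)
      ultimately show ?thesis unfolding nullform_cadj[of \<Gamma>] by (simp only: mult_ac)
    qed
    have mm: "case_prod \<Phi> \<in> borel_measurable borel" "case_prod \<Psi> \<in> borel_measurable borel"
      using \<Phi> \<Psi> unfolding dirac_component_def by auto
    have "(\<lambda>p. bilin \<Gamma> (case_prod \<Phi> p) (case_prod \<Psi> p)) \<in> borel_measurable borel"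
      using mm by measurable
    then have meas: "(\<lambda>(t, x). bilin \<Gamma> (\<Phi> t x) (\<Psi> t x)) \<in> borel_measurable borel"
      by (simp add: case_prod_beta')
    let ?F = "\<lambda>(t, x). bilin \<Gamma> (\<Phi> t x) (\<Psi> t x)"
    let ?L = "L2_norm lborel (\<Phi> 0)" and ?R = "L2_norm lborel (\<Psi> 0)"
    have "L2sq (spacetime_slab T) ?F = nullform \<Gamma> \<Phi> \<Psi> 0 T"
      unfolding nullform_def by (rule L2sq_slab[OF meas])
    also have "\<dots> = ennreal (\<kappa> ^ 4) * nullform \<Gamma> (wave m g) (wave m h) 0 T"
    proof -
      note [measurable] = band_measurable[OF g(1)] band_measurable[OF h(1)]
      have "(\<integral>\<^sup>+x. ennreal ((norm (bilin \<Gamma> (\<Phi> t x) (\<Psi> t x)))\<^sup>2) \<partial>lborel)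
         = (\<integral>\<^sup>+x. ennreal (\<kappa> ^ 4) * ennreal ((norm (bilin \<Gamma> (wave m g t x) (wave m h t x)))\<^sup>2) \<partial>lborel)" for t
      proof (rule nn_integral_cong_AE)
        show "AE x in lborel. ennreal ((norm (bilin \<Gamma> (\<Phi> t x) (\<Psi> t x)))\<^sup>2)
           = ennreal (\<kappa> ^ 4) * ennreal ((norm (bilin \<Gamma> (wave m g t x) (wave m h t x)))\<^sup>2)"
          using g(3)[of t] h(3)[of t]
        proof eventually_elim
          case (elim x)
          have "(norm (bilin \<Gamma> (\<Phi> t x) (\<Psi> t x)))\<^sup>2 = \<kappa> ^ 4 * (norm (bilin \<Gamma> (wave m g t x) (wave m h t x)))\<^sup>2"
            unfolding elim \<kappa>_def[symmetric] bilin_scaleR by (simp add: power_mult_distrib)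
          then show ?case by (simp add: ennreal_mult)
        qed
      qed
      then have "nullform \<Gamma> \<Phi> \<Psi> 0 T = (\<integral>\<^sup>+t. ennreal (\<kappa> ^ 4) * (indicator {0..T} t * (\<integral>\<^sup>+x. ennreal ((norm (bilin \<Gamma> (wave m g t x) (wave m h t x)))\<^sup>2) \<partial>lborel)) \<partial>lborel)"
        unfolding nullform_def by (simp add: nn_integral_cmult mult.left_commute)
      also have "\<dots> = ennreal (\<kappa> ^ 4) * nullform \<Gamma> (wave m g) (wave m h) 0 T"
        unfolding nullform_def by (rule nn_integral_cmult) measurable
      finally show ?thesis .
    qed
    also have "\<dots> \<le> ennreal (\<kappa> ^ 4) * (ennreal (K * ?bc\<^sup>2) * L2sq lborel g * L2sq lborel h)"
      by (intro mult_left_mono nf) simp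
    also have "\<dots> \<le> ennreal (\<kappa> ^ 4) * (ennreal (K * ?bc\<^sup>2) * (ennreal B * L2sq lborel (\<Phi> 0)) * (ennreal B * L2sq lborel (\<Psi> 0)))"
      unfolding B_def by (intro mult_left_mono mult_mono g(4) h(4)) auto
    also have "\<dots> = ennreal (\<kappa> ^ 4 * ((K * ?bc\<^sup>2) * (B * ?L\<^sup>2) * (B * ?R\<^sup>2)))"
      using \<kappa>B K0 by (simp add: square_integrable_L2sq[OF g(5)] square_integrable_L2sq[OF h(5)] ennreal_mult)
    also have "\<dots> \<le> ennreal ((C * ?bc * ?L * ?R)\<^sup>2)"
    proof (intro ennreal_leI)
      have "\<kappa> ^ 4 * ((K * ?bc\<^sup>2) * (B * ?L\<^sup>2) * (B * ?R\<^sup>2)) = (\<kappa> ^ 4 * K * B\<^sup>2) * (?bc\<^sup>2 * ?L\<^sup>2 * ?R\<^sup>2)"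
        by (simp add: power2_eq_square mult_ac)
      also have "\<dots> \<le> C\<^sup>2 * (?bc\<^sup>2 * ?L\<^sup>2 * ?R\<^sup>2)" by (intro mult_right_mono CC) auto
      finally show "\<kappa> ^ 4 * ((K * ?bc\<^sup>2) * (B * ?L\<^sup>2) * (B * ?R\<^sup>2)) \<le> (C * ?bc * ?L * ?R)\<^sup>2"
        by (simp add: power_mult_distrib mult_ac)
    qed
    finally have bound: "L2sq (spacetime_slab T) ?F \<le> ennreal ((C * ?bc * ?L * ?R)\<^sup>2)" .
    show sq: "square_integrable (spacetime_slab T) ?F"
      unfolding square_integrable_iff_L2sq
    proof
      show "?F \<in> borel_measurable (spacetime_slab T)"
        unfolding spacetime_slab_def using meas by (intro measurable_restrict_space1) simp
      show "L2sq (spacetime_slab T) ?F < \<infinity>" by (rule le_less_trans[OF bound]) simp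
    qed
    have "(L2_norm (spacetime_slab T) ?F)\<^sup>2 \<le> (C * ?bc * ?L * ?R)\<^sup>2"
      using bound unfolding square_integrable_L2sq[OF sq] by (subst (asm) ennreal_le_iff) auto
    moreover have "0 \<le> C * ?bc * ?L * ?R"
      using C0' N m T by (intro mult_nonneg_nonneg L2_norm_nonneg) (auto simp: bilinear_const_def)
    ultimately show "L2_norm (spacetime_slab T) ?F \<le> C * ?bc * ?L * ?R"
      by (rule power2_le_imp_le)
  qed
qed

text \<open>Fubini turns the iterated integral of the quadrilinear estimate into an integral over
  the slab, where Cauchy--Schwarz applies.\<close>

lemma slab_integral:
  fixes F :: "real \<Rightarrow> real^3 \<Rightarrow> complex"
  assumes F: "integrable (spacetime_slab T) (case_prod F)"
  shows "(LINT t:{0..T}|lborel. LINT x|lborel. F t x) = (\<integral>p. case_prod F p \<partial>spacetime_slab T)"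
proof -
  have i: "integrable lborel (\<lambda>p. indicator ({0..T} \<times> UNIV) p *\<^sub>R case_prod F p)"
    using F unfolding spacetime_slab_def
    by (subst (asm) integrable_restrict_space) (use slab_sets in auto)
  then have i': "integrable (lborel \<Otimes>\<^sub>M lborel) (\<lambda>(t, x). indicator {0..T} t *\<^sub>R F t x)"
  proof -
    have "(\<lambda>p. indicator ({0..T} \<times> UNIV) p *\<^sub>R case_prod F p) = (\<lambda>(t, x). indicator {0..T} t *\<^sub>R F t x)"
      by (auto simp: fun_eq_iff indicator_def)
    with i show ?thesis unfolding lborel_prod by simp
  qed
  have "(\<integral>p. case_prod F p \<partial>spacetime_slab T) = (\<integral>p. indicator ({0..T} \<times> UNIV) p *\<^sub>R case_prod F p \<partial>lborel)"
    unfolding spacetime_slab_def by (rule integral_restrict_space) (use slab_sets in simp)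
  also have "\<dots> = (\<integral>p. (case p of (t, x) \<Rightarrow> indicator {0..T} t *\<^sub>R F t x) \<partial>(lborel \<Otimes>\<^sub>M lborel))"
    unfolding lborel_prod by (intro Bochner_Integration.integral_cong refl) (auto simp: indicator_def)
  also have "\<dots> = (\<integral>t. \<integral>x. indicator {0..T} t *\<^sub>R F t x \<partial>lborel \<partial>lborel)"
    using lborel_pair.integral_fst'[OF i'] by simp
  also have "\<dots> = (LINT t:{0..T}|lborel. LINT x|lborel. F t x)"
    by (simp add: set_lebesgue_integral_def)
  finally show ?thesis ..
qed

text \<open>The scalar leaves the conjugate-linear slot as its conjugate, which does not change the
  modulus.\<close>

lemma herm_product: "herm (b *s (\<Gamma> *v u)) v = cnj b * bilin \<Gamma> u v"
  by (simp add: herm_smult_left bilin_def)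

theorem theorem1p1:
  fixes cutoff :: "real^3 \<Rightarrow> real"
  assumes "frequency_cutoff cutoff"
  shows
    "(\<forall>\<Gamma>. anticommutes_alpha \<Gamma> \<longrightarrow>
       (\<exists>C>0. \<forall>m\<ge>0. \<forall>T>0. \<forall>N1\<in>dyadic. \<forall>N2\<in>dyadic. \<forall>\<Phi>0 \<Psi>0 \<Phi> \<Psi>.
          square_integrable lborel \<Phi>0 \<longrightarrow> square_integrable lborel \<Psi>0 \<longrightarrow>
          dirac_component cutoff m N1 \<Phi>0 \<Phi> \<longrightarrow> dirac_component cutoff m N2 \<Psi>0 \<Psi> \<longrightarrow>
          square_integrable (spacetime_slab T) (\<lambda>(t, x). bilin \<Gamma> (\<Phi> t x) (\<Psi> t x)) \<and>
          L2_norm (spacetime_slab T) (\<lambda>(t, x). bilin \<Gamma> (\<Phi> t x) (\<Psi> t x))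
            \<le> C * bilinear_const m T N1 N2 * L2_norm lborel (\<Phi> 0) * L2_norm lborel (\<Psi> 0)))
     \<and>
     (\<forall>\<Gamma>1 \<Gamma>2. anticommutes_alpha \<Gamma>1 \<longrightarrow> anticommutes_alpha \<Gamma>2 \<longrightarrow>
       (\<exists>C>0. \<forall>m\<ge>0. \<forall>T>0. \<forall>(N :: nat \<Rightarrow> real) \<Phi>0 \<Phi>.
          (\<forall>j\<in>{0..3}. N j \<in> dyadic \<and> square_integrable lborel (\<Phi>0 j) \<and>
              dirac_component cutoff m (N j) (\<Phi>0 j) (\<Phi> j)) \<longrightarrow>
          integrable (spacetime_slab T)
            (\<lambda>(t, x). herm (bilin \<Gamma>1 (\<Phi> 1 t x) (\<Phi> 2 t x) *s (\<Gamma>2 *v \<Phi> 3 t x)) (\<Phi> 0 t x)) \<and>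
          cmod (LINT t:{0..T}|lborel. LINT x|lborel.
              herm (bilin \<Gamma>1 (\<Phi> 1 t x) (\<Phi> 2 t x) *s (\<Gamma>2 *v \<Phi> 3 t x)) (\<Phi> 0 t x))
            \<le> C * bilinear_const m T (N 1) (N 2) * bilinear_const m T (N 3) (N 0)
                * (\<Prod>j=0..3. L2_norm lborel (\<Phi> j 0))))"
proof (intro conjI allI impI)
  fix \<Gamma> assume "anticommutes_alpha \<Gamma>"
  from bilinear_estimate[OF assms this] obtain C where C: "C > 0"
    and e: "\<And>m T N1 N2 \<Phi>0 \<Psi>0 \<Phi> \<Psi>. \<lbrakk>m \<ge> 0; T > 0; N1 \<in> dyadic; N2 \<in> dyadic;
        dirac_component cutoff m N1 \<Phi>0 \<Phi>; dirac_component cutoff m N2 \<Psi>0 \<Psi>\<rbrakk> \<Longrightarrow>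
      square_integrable (spacetime_slab T) (\<lambda>(t, x). bilin \<Gamma> (\<Phi> t x) (\<Psi> t x)) \<and>
      L2_norm (spacetime_slab T) (\<lambda>(t, x). bilin \<Gamma> (\<Phi> t x) (\<Psi> t x))
        \<le> C * bilinear_const m T N1 N2 * L2_norm lborel (\<Phi> 0) * L2_norm lborel (\<Psi> 0)"
    by blast
  show "\<exists>C>0. \<forall>m\<ge>0. \<forall>T>0. \<forall>N1\<in>dyadic. \<forall>N2\<in>dyadic. \<forall>\<Phi>0 \<Psi>0 \<Phi> \<Psi>.
          square_integrable lborel \<Phi>0 \<longrightarrow> square_integrable lborel \<Psi>0 \<longrightarrow>
          dirac_component cutoff m N1 \<Phi>0 \<Phi> \<longrightarrow> dirac_component cutoff m N2 \<Psi>0 \<Psi> \<longrightarrow>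
          square_integrable (spacetime_slab T) (\<lambda>(t, x). bilin \<Gamma> (\<Phi> t x) (\<Psi> t x)) \<and>
          L2_norm (spacetime_slab T) (\<lambda>(t, x). bilin \<Gamma> (\<Phi> t x) (\<Psi> t x))
            \<le> C * bilinear_const m T N1 N2 * L2_norm lborel (\<Phi> 0) * L2_norm lborel (\<Psi> 0)"
  proof (rule exI[of _ C], rule conjI[OF C], intro allI impI ballI)
    fix m T N1 N2 :: real and \<Phi>0 \<Psi>0 \<Phi> \<Psi>
    assume "0 \<le> m" "0 < T" "N1 \<in> dyadic" "N2 \<in> dyadic"
      "dirac_component cutoff m N1 \<Phi>0 \<Phi>" "dirac_component cutoff m N2 \<Psi>0 \<Psi>"
    then show "square_integrable (spacetime_slab T) (\<lambda>(t, x). bilin \<Gamma> (\<Phi> t x) (\<Psi> t x)) \<and>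
      L2_norm (spacetime_slab T) (\<lambda>(t, x). bilin \<Gamma> (\<Phi> t x) (\<Psi> t x))
        \<le> C * bilinear_const m T N1 N2 * L2_norm lborel (\<Phi> 0) * L2_norm lborel (\<Psi> 0)"
      by (rule e)
  qed
next
  fix \<Gamma>1 \<Gamma>2 assume an: "anticommutes_alpha \<Gamma>1" "anticommutes_alpha \<Gamma>2"
  from bilinear_estimate[OF assms an(1)] obtain C1 where C1: "C1 > 0"
    and e1: "\<And>m T N1 N2 \<Phi>0 \<Psi>0 \<Phi> \<Psi>. \<lbrakk>m \<ge> 0; T > 0; N1 \<in> dyadic; N2 \<in> dyadic;
        dirac_component cutoff m N1 \<Phi>0 \<Phi>; dirac_component cutoff m N2 \<Psi>0 \<Psi>\<rbrakk> \<Longrightarrow>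
      square_integrable (spacetime_slab T) (\<lambda>(t, x). bilin \<Gamma>1 (\<Phi> t x) (\<Psi> t x)) \<and>
      L2_norm (spacetime_slab T) (\<lambda>(t, x). bilin \<Gamma>1 (\<Phi> t x) (\<Psi> t x))
        \<le> C1 * bilinear_const m T N1 N2 * L2_norm lborel (\<Phi> 0) * L2_norm lborel (\<Psi> 0)"
    by blast
  from bilinear_estimate[OF assms an(2)] obtain C2 where C2: "C2 > 0"
    and e2: "\<And>m T N1 N2 \<Phi>0 \<Psi>0 \<Phi> \<Psi>. \<lbrakk>m \<ge> 0; T > 0; N1 \<in> dyadic; N2 \<in> dyadic;
        dirac_component cutoff m N1 \<Phi>0 \<Phi>; dirac_component cutoff m N2 \<Psi>0 \<Psi>\<rbrakk> \<Longrightarrow>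
      square_integrable (spacetime_slab T) (\<lambda>(t, x). bilin \<Gamma>2 (\<Phi> t x) (\<Psi> t x)) \<and>
      L2_norm (spacetime_slab T) (\<lambda>(t, x). bilin \<Gamma>2 (\<Phi> t x) (\<Psi> t x))
        \<le> C2 * bilinear_const m T N1 N2 * L2_norm lborel (\<Phi> 0) * L2_norm lborel (\<Psi> 0)"
    by blast
  show "\<exists>C>0. \<forall>m\<ge>0. \<forall>T>0. \<forall>(N :: nat \<Rightarrow> real) \<Phi>0 \<Phi>.
          (\<forall>j\<in>{0..3}. N j \<in> dyadic \<and> square_integrable lborel (\<Phi>0 j) \<and>
              dirac_component cutoff m (N j) (\<Phi>0 j) (\<Phi> j)) \<longrightarrow>
          integrable (spacetime_slab T)
            (\<lambda>(t, x). herm (bilin \<Gamma>1 (\<Phi> 1 t x) (\<Phi> 2 t x) *s (\<Gamma>2 *v \<Phi> 3 t x)) (\<Phi> 0 t x)) \<and>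
          cmod (LINT t:{0..T}|lborel. LINT x|lborel.
              herm (bilin \<Gamma>1 (\<Phi> 1 t x) (\<Phi> 2 t x) *s (\<Gamma>2 *v \<Phi> 3 t x)) (\<Phi> 0 t x))
            \<le> C * bilinear_const m T (N 1) (N 2) * bilinear_const m T (N 3) (N 0)
                * (\<Prod>j=0..3. L2_norm lborel (\<Phi> j 0))"
  proof (rule exI[of _ "C1 * C2"], rule conjI[OF mult_pos_pos[OF C1 C2]], intro allI impI conjI)
    fix m T :: real and N :: "nat \<Rightarrow> real" and \<Phi>0 \<Phi>
    assume m: "0 \<le> m" and T: "0 < T" and A: "\<forall>j\<in>{0..3}. N j \<in> dyadic \<and> square_integrable lborel (\<Phi>0 j) \<and>
              dirac_component cutoff m (N j) (\<Phi>0 j) (\<Phi> j)"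
    let ?X = "\<lambda>(t, x). bilin \<Gamma>1 (\<Phi> 1 t x) (\<Phi> 2 t x)" and ?Y = "\<lambda>(t, x). bilin \<Gamma>2 (\<Phi> 3 t x) (\<Phi> 0 t x)"
    let ?I = "\<lambda>t x. herm (bilin \<Gamma>1 (\<Phi> 1 t x) (\<Phi> 2 t x) *s (\<Gamma>2 *v \<Phi> 3 t x)) (\<Phi> 0 t x)"
    have X: "square_integrable (spacetime_slab T) ?X"
        "L2_norm (spacetime_slab T) ?X \<le> C1 * bilinear_const m T (N 1) (N 2) * L2_norm lborel (\<Phi> 1 0) * L2_norm lborel (\<Phi> 2 0)"
      using e1[OF m T, of "N 1" "N 2" "\<Phi>0 1" "\<Phi> 1" "\<Phi>0 2" "\<Phi> 2"] A by auto
    have Y: "square_integrable (spacetime_slab T) ?Y"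
        "L2_norm (spacetime_slab T) ?Y \<le> C2 * bilinear_const m T (N 3) (N 0) * L2_norm lborel (\<Phi> 3 0) * L2_norm lborel (\<Phi> 0 0)"
      using e2[OF m T, of "N 3" "N 0" "\<Phi>0 3" "\<Phi> 3" "\<Phi>0 0" "\<Phi> 0"] A by auto
    \<comment> \<open>The integrand factors into the bilinear form of the fields 1, 2 and that of
      the fields 3, 0, which explains how the frequencies are paired in the two constants.\<close>
    have I: "case_prod ?I p = cnj (?X p) * ?Y p" for p
      by (cases p) (simp add: herm_product)
    have XY: "integrable (spacetime_slab T) (\<lambda>p. norm (?X p) * norm (?Y p))"
      by (rule square_integrable_mult_norm[OF X(1) Y(1)])
    have mXY: "?X \<in> borel_measurable (spacetime_slab T)" "?Y \<in> borel_measurable (spacetime_slab T)"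
      using X(1) Y(1) by (auto simp: square_integrable_def)
    have [measurable]: "cnj \<in> borel_measurable borel" by (intro borel_measurable_continuous_onI continuous_intros)
    show II: "integrable (spacetime_slab T) (case_prod ?I)"
    proof (rule Bochner_Integration.integrable_bound[OF XY])
      show "case_prod ?I \<in> borel_measurable (spacetime_slab T)"
        unfolding I[abs_def] by (intro borel_measurable_times measurable_compose[OF mXY(1)] mXY(2)) simp
      show "AE p in spacetime_slab T. norm (case_prod ?I p) \<le> norm (norm (?X p) * norm (?Y p))"
        unfolding I by (simp add: norm_mult)
    qed
    have "cmod (LINT t:{0..T}|lborel. LINT x|lborel. ?I t x) = norm (\<integral>p. case_prod ?I p \<partial>spacetime_slab T)"
      unfolding slab_integral[OF II] ..
    also have "\<dots> \<le> (\<integral>p. norm (case_prod ?I p) \<partial>spacetime_slab T)" by (rule integral_norm_bound)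
    also have "\<dots> = (\<integral>p. norm (?X p) * norm (?Y p) \<partial>spacetime_slab T)"
      unfolding I by (simp add: norm_mult)
    also have "\<dots> \<le> L2_norm (spacetime_slab T) ?X * L2_norm (spacetime_slab T) ?Y"
      by (rule L2_cauchy_schwarz[OF X(1) Y(1)])
    also have "\<dots> \<le> (C1 * bilinear_const m T (N 1) (N 2) * L2_norm lborel (\<Phi> 1 0) * L2_norm lborel (\<Phi> 2 0))
       * (C2 * bilinear_const m T (N 3) (N 0) * L2_norm lborel (\<Phi> 3 0) * L2_norm lborel (\<Phi> 0 0))"
      by (intro mult_mono X(2) Y(2) L2_norm_nonneg order_trans[OF L2_norm_nonneg X(2)])
    also have "\<dots> = C1 * C2 * bilinear_const m T (N 1) (N 2) * bilinear_const m T (N 3) (N 0) * (\<Prod>j=0..3. L2_norm lborel (\<Phi> j 0))"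
    proof -
      have "{0..3::nat} = {0, 1, 2, 3}" by auto
      then have "(\<Prod>j=0..3. L2_norm lborel (\<Phi> j 0))
         = L2_norm lborel (\<Phi> 0 0) * (L2_norm lborel (\<Phi> 1 0) * (L2_norm lborel (\<Phi> 2 0) * L2_norm lborel (\<Phi> 3 0)))"
        by simp
      then show ?thesis by (simp only: mult_ac)
    qed
    finally show "cmod (LINT t:{0..T}|lborel. LINT x|lborel. ?I t x)
       \<le> C1 * C2 * bilinear_const m T (N 1) (N 2) * bilinear_const m T (N 3) (N 0) * (\<Prod>j=0..3. L2_norm lborel (\<Phi> j 0))" .
  qed
qed

end
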